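(* Let $f(s)$ be an almost periodic function in a vertical strip $U=\{s=\sigma+it:\alpha<\sigma<\beta\}$, where $-\infty\le\alpha<\beta\le\infty$, whose Dirichlet series is given by $\sum_{n\ge1}a_ne^{\lambda_ns}$, where the set of Fourier exponents $\{\lambda_1,\lambda_2,\ldots\}$ is linearly independent over $\mathbb{Q}$ and has at least three elements. Suppose that $U$ is the largest open vertical strip of almost periodicity of $f$ and that at least one of the following conditions is satisfied: a) $\displaystyle\lim_{\sigma\to\alpha^+}\sum_{i\ge1}|a_i|e^{\sigma\lambda_i}>2\sup\{|a_i|e^{\alpha\lambda_i}:i\ge1\}$; b) $\displaystyle\lim_{\sigma\to\beta^-}\sum_{i\ge1}|a_i|e^{\sigma\lambda_i}>2\sup\{|a_i|e^{\beta\lambda_i}:i\ge1\}$. Then $R_f\ne\emptyset$.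
   Context: Write $s=\sigma+it$ with $\sigma,t\in\mathbb{R}$. A function $f$, analytic in the vertical strip $U=\{\sigma+it:\alpha<\sigma<\beta\}$, is called almost periodic in $U$ if for every reduced strip $\{\alpha_1\le\sigma\le\beta_1\}$ with $\alpha<\alpha_1<\beta_1<\beta$ and every $\varepsilon>0$ there is $l>0$ such that each interval of length $l$ on the real line contains a number $\tau$ with $|f(s+i\tau)-f(s)|\le\varepsilon$ for all $s$ in the reduced strip. Equivalently, $f$ is a uniform limit, on every reduced strip of $U$, of exponential polynomials $a_1e^{\lambda_1s}+\cdots+a_ne^{\lambda_ns}$ with $a_j\in\mathbb{C}$, $\lambda_j\in\mathbb{R}$. That $U$ is the largest open vertical strip of almost periodicity of $f$ means that $f$ does not extend to an almost periodic function in any open vertical strip strictly containing $U$. Fourier exponents and Dirichlet series: for $\lambda\in\mathbb{R}$ the number $a(\lambda)=\lim_{T\to\infty}\frac1{2T}\int_{-T}^{T}f(\sigma+it)e^{-\lambda(\sigma+it)}\,dt$ exists and does not depend on $\sigma\in(\alpha,\beta)$. It is nonzero for at most countably many $\lambda$, called the Fourier exponents of $f$; enumerating them as $\lambda_1,\lambda_2,\ldots$ (distinct; finitely or infinitely many) and putting $a_n=a(\lambda_n)\neq0$, the series $\sum_{n\ge1}a_ne^{\lambda_ns}$ is the Dirichlet series of $f$. It is a known fact that if the Fourier exponents are linearly independent over $\mathbb{Q}$, the Dirichlet series converges absolutely to $f$ in $U$. The limits and suprema in a) and b) are taken in $[0,+\infty]$; if $\alpha=-\infty$ (resp. $\beta=+\infty$),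 $e^{\alpha\lambda_i}$ (resp. $e^{\beta\lambda_i}$) denotes the limit of $e^{\sigma\lambda_i}$ as $\sigma\to\alpha$ (resp. $\sigma\to\beta$) in $[0,+\infty]$. The set $R_f$ is defined by $R_f:=\overline{\{\operatorname{Re}s: f(s)=0,\ s\in U\}}\cap(\alpha,\beta)$, where the bar denotes closure in $\mathbb{R}$. *)

theory Defs
  imports "HOL-Complex_Analysis.Complex_Analysis"
begin

definition vstrip :: "ereal \<Rightarrow> ereal \<Rightarrow> complex set" where
  "vstrip \<alpha> \<beta> = {s. Re s \<in> einterval \<alpha> \<beta>}"

definition almost_periodic_in :: "(complex \<Rightarrow> complex) \<Rightarrow> ereal \<Rightarrow> ereal \<Rightarrow> bool" where
  "almost_periodic_in f \<alpha> \<beta> \<longleftrightarrow>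
     f holomorphic_on vstrip \<alpha> \<beta> \<and>
     (\<forall>\<alpha>1 \<beta>1 :: real. \<alpha> < ereal \<alpha>1 \<longrightarrow> \<alpha>1 < \<beta>1 \<longrightarrow> ereal \<beta>1 < \<beta> \<longrightarrow>
       (\<forall>\<epsilon>>0. \<exists>l>0. \<forall>x::real. \<exists>\<tau>\<in>{x..x + l}.
          \<forall>s. \<alpha>1 \<le> Re s \<and> Re s \<le> \<beta>1 \<longrightarrow> norm (f (s + \<i> * of_real \<tau>) - f s) \<le> \<epsilon>))"

definition largest_ap_strip :: "(complex \<Rightarrow> complex) \<Rightarrow> ereal \<Rightarrow> ereal \<Rightarrow> bool" where
  "largest_ap_strip f \<alpha> \<beta> \<longleftrightarrow>
     almost_periodic_in f \<alpha> \<beta> \<and>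
     (\<forall>\<alpha>' \<beta>'. vstrip \<alpha> \<beta> \<subset> vstrip \<alpha>' \<beta>' \<longrightarrow>
        \<not> (\<exists>g. almost_periodic_in g \<alpha>' \<beta>' \<and> (\<forall>s\<in>vstrip \<alpha> \<beta>. g s = f s)))"

text \<open>
  The number \<open>c\<close> is the value \<open>a(l)\<close> of the mean value transform of \<open>f\<close> at \<open>l\<close>. For \<open>f\<close> almost
  periodic and \<open>\<alpha> < \<beta>\<close>, there is exactly one such \<open>c\<close> for every \<open>l\<close>.
\<close>

definition has_fourier_coeff ::
    "(complex \<Rightarrow> complex) \<Rightarrow> ereal \<Rightarrow> ereal \<Rightarrow> real \<Rightarrow> complex \<Rightarrow> bool" where
  "has_fourier_coeff f \<alpha> \<beta> l c \<longleftrightarrow>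
     (\<forall>\<sigma>\<in>einterval \<alpha> \<beta>.
        ((\<lambda>T::real. 1 / (2 * of_real T) *
            integral {-T..T} (\<lambda>t. f (Complex \<sigma> t) * exp (- of_real l * Complex \<sigma> t)))
          \<longlongrightarrow> c) at_top)"

definition fourier_exponents :: "(complex \<Rightarrow> complex) \<Rightarrow> ereal \<Rightarrow> ereal \<Rightarrow> real set" where
  "fourier_exponents f \<alpha> \<beta> = {l. \<exists>c. c \<noteq> 0 \<and> has_fourier_coeff f \<alpha> \<beta> l c}"

text \<open>
  The terms are indexed by \<open>1 \<le> n \<le> N\<close>, where \<open>N = \<infinity>\<close> if there are infinitely many exponents.
\<close>

definition dirichlet_index :: "enat \<Rightarrow> nat set" where
  "dirichlet_index N = {n. 1 \<le> n \<and> enat n \<le> N}"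

definition is_dirichlet_series ::
    "(complex \<Rightarrow> complex) \<Rightarrow> ereal \<Rightarrow> ereal \<Rightarrow> enat \<Rightarrow> (nat \<Rightarrow> complex) \<Rightarrow> (nat \<Rightarrow> real) \<Rightarrow> bool" where
  "is_dirichlet_series f \<alpha> \<beta> N a l \<longleftrightarrow>
     bij_betw l (dirichlet_index N) (fourier_exponents f \<alpha> \<beta>) \<and>
     (\<forall>n\<in>dirichlet_index N. has_fourier_coeff f \<alpha> \<beta> (l n) (a n))"

definition lin_indep_over_Q :: "real set \<Rightarrow> bool" where
  "lin_indep_over_Q S \<longleftrightarrow> module.independent (\<lambda>(q::rat) (x::real). of_rat q * x) S"

lemma vector_space_rat_real: "vector_space (\<lambda>(q::rat) (x::real). of_rat q * x)"
  by unfold_locales (simp_all add: algebra_simps of_rat_add of_rat_mult)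

text \<open>
  \<open>exp (x * l)\<close> as an element of \<open>[0, \<infinity>]\<close> for an extended real \<open>x\<close>; for infinite \<open>x\<close> it is the
  limit of \<open>exp (\<sigma> * l)\<close> as the real \<open>\<sigma>\<close> tends to \<open>x\<close> (see the \<open>tendsto\<close> lemmas below).
\<close>

definition eexp_mult :: "ereal \<Rightarrow> real \<Rightarrow> ennreal" where
  "eexp_mult x l =
     (case x of
        ereal \<sigma> \<Rightarrow> ennreal (exp (\<sigma> * l))
      | PInfty \<Rightarrow> (if l > 0 then \<infinity> else if l = 0 then 1 else 0)
      | MInfty \<Rightarrow> (if l > 0 then 0 else if l = 0 then 1 else \<infinity>))"

lemma eexp_mult_simps [simp]:
  "eexp_mult (ereal \<sigma>) l = ennreal (exp (\<sigma> * l))"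
  "eexp_mult \<infinity> l = (if l > 0 then \<infinity> else if l = 0 then 1 else 0)"
  "eexp_mult (-\<infinity>) l = (if l > 0 then 0 else if l = 0 then 1 else \<infinity>)"
  by (simp_all add: eexp_mult_def)

lemma tendsto_eexp_mult_PInf: "((\<lambda>\<sigma>. ennreal (exp (\<sigma> * l))) \<longlongrightarrow> eexp_mult \<infinity> l) at_top"
proof (cases l "0::real" rule: linorder_cases)
  case greater
  have "filterlim (\<lambda>\<sigma>. exp (\<sigma> * l)) at_top at_top"
    using greater by real_asymp
  then show ?thesis using greater by (auto simp: tendsto_top_iff_ennreal filterlim_at_top_dense ennreal_less_iff)
next
  case less
  have "((\<lambda>\<sigma>. exp (\<sigma> * l)) \<longlongrightarrow> 0) at_top"
    using less by real_asymp
  then have "((\<lambda>\<sigma>. ennreal (exp (\<sigma> * l))) \<longlongrightarrow> ennreal 0) at_top" by (rule tendsto_ennrealI)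
  then show ?thesis using less by simp
qed simp

lemma tendsto_eexp_mult_MInf: "((\<lambda>\<sigma>. ennreal (exp (\<sigma> * l))) \<longlongrightarrow> eexp_mult (-\<infinity>) l) at_bot"
  using tendsto_eexp_mult_PInf[of "- l"] by (auto simp: filterlim_at_bot_mirror split: if_splits)

definition abs_dirichlet_sum :: "enat \<Rightarrow> (nat \<Rightarrow> complex) \<Rightarrow> (nat \<Rightarrow> real) \<Rightarrow> real \<Rightarrow> ennreal" where
  "abs_dirichlet_sum N a l \<sigma> = (\<Sum>\<^sub>\<infinity>i\<in>dirichlet_index N. ennreal (norm (a i) * exp (\<sigma> * l i)))"

definition dirichlet_term_sup :: "enat \<Rightarrow> (nat \<Rightarrow> complex) \<Rightarrow> (nat \<Rightarrow> real) \<Rightarrow> ereal \<Rightarrow> ennreal" where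
  "dirichlet_term_sup N a l x = (SUP i\<in>dirichlet_index N. ennreal (norm (a i)) * eexp_mult x (l i))"

definition zero_re_set :: "(complex \<Rightarrow> complex) \<Rightarrow> ereal \<Rightarrow> ereal \<Rightarrow> real set" where
  "zero_re_set f \<alpha> \<beta> = closure {Re s | s. f s = 0 \<and> s \<in> vstrip \<alpha> \<beta>} \<inter> einterval \<alpha> \<beta>"

end

theory Submission
  imports Defs "HOL-Analysis.Kronecker_Approximation_Theorem"
begin

text \<open>
  Near the endpoint in question, condition a) or b) yields an abscissa \<open>\<sigma>\<close> in the strip at which no
  term \<open>\<bar>a\<^sub>i\<bar> exp (\<sigma> \<lambda>\<^sub>i)\<close> exceeds the sum of the others. Segments of these lengths can be closed up to
  a polygon, that is, the terms can be given phases that make the series vanish at \<open>\<sigma>\<close>. The exponents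
  being independent over the rationals, Kronecker's theorem realises the phases as limits of vertical
  translations: some translates \<open>f (s + i t\<^sub>n)\<close> converge locally uniformly to a function that
  vanishes at \<open>\<sigma>\<close> but is not constant, so by Hurwitz's theorem \<open>f\<close> itself has a zero in the strip.

  That the Dirichlet series converges absolutely to \<open>f\<close> rests on two facts about almost periodic
  functions on a vertical line. Integrating \<open>f\<close> against a Riesz product bounds \<open>\<Sum> \<bar>a\<^sub>i\<bar> exp (\<sigma> \<lambda>\<^sub>i)\<close> by
  twice the supremum of \<open>f\<close> (Bohr), and an almost periodic function whose Fourier coefficients all
  vanish is zero. For the latter, the values at the differences of \<open>N\<close> equidistant points are
  averaged over a positive proportion of the pairs, along which \<open>h\<close> is almost constant; a discrete
  Fourier transform shows that this average is small.
\<close>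

text \<open>The factor 2 in both conditions is the polygon inequality: segments close up exactly
  when none is longer than half of the total length. Independence enters twice: in Riesz products it
  keeps the mixed frequencies away from the other exponents, and in Kronecker's theorem it makes the
  phases free. The two facts about a line complement each other. The Riesz bound makes the
  coefficients absolutely summable but does not tell what the series sums to; uniqueness, applied to
  the difference of \<open>f\<close> and the series, settles this. For uniqueness, let the
  translates of \<open>h\<close> fall into \<open>k\<close> classes. One class holds at least N/k of
  N equidistant points, and \<open>h (t + x - y)\<close> is close to \<open>h t\<close> for all x, y
  in it. The sum over all such pairs is a quadratic form at an indicator function, so the largest
  value of the discrete transform bounds it; dividing by the number of pairs loses only a factor of
  order \<open>k\<close>, which does not depend on N. The phases are attained only in the limit, so
  \<open>f\<close> need not vanish on the chosen line; Hurwitz's theorem yields a zero somewhere in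
  the strip.\<close>

section \<open>Almost periodic functions on the line\<close>

text \<open>Bochner's form of almost periodicity: for every \<open>\<epsilon>\<close> the translates of \<open>h\<close> fall into finitely many
  classes of diameter at most \<open>\<epsilon>\<close>. Unlike Bohr's condition it passes directly to sums and products.\<close>

definition ap_fun :: "(real \<Rightarrow> complex) \<Rightarrow> bool" where
  "ap_fun h \<longleftrightarrow> continuous_on UNIV h \<and>
     (\<forall>\<epsilon>>0. \<exists>c::real \<Rightarrow> nat. finite (range c) \<and>
        (\<forall>x y t. c x = c y \<longrightarrow> norm (h (t + x) - h (t + y)) \<le> \<epsilon>))"

text \<open>Later classifications use pairs, points of a net or integers as labels. An injective
  numbering of the finite range turns them into the \<open>nat\<close> labels of the
  definition.\<close>

lemma ap_funI:
  fixes h :: "real \<Rightarrow> complex"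
  assumes "continuous_on UNIV h"
    and "\<And>\<epsilon>. \<epsilon> > 0 \<Longrightarrow> \<exists>c::real \<Rightarrow> 'b. finite (range c) \<and>
        (\<forall>x y t. c x = c y \<longrightarrow> norm (h (t + x) - h (t + y)) \<le> \<epsilon>)"
  shows "ap_fun h"
  unfolding ap_fun_def
proof (intro conjI allI impI)
  fix \<epsilon> :: real assume "\<epsilon> > 0"
  then obtain c :: "real \<Rightarrow> 'b" where c: "finite (range c)"
    "\<And>x y t. c x = c y \<Longrightarrow> norm (h (t + x) - h (t + y)) \<le> \<epsilon>"
    using assms(2) by blast
  have "countable (range c)" using c(1) by (rule countable_finite)
  then have "inj_on (to_nat_on (range c)) (range c)" by (rule inj_on_to_nat_on)
  then have "c x = c y" if "to_nat_on (range c) (c x) = to_nat_on (range c) (c y)" for x y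
    using that by (auto simp: inj_on_def)
  moreover have "finite (range (\<lambda>x. to_nat_on (range c) (c x)))"
    using finite_imageI[OF c(1), of "to_nat_on (range c)"] by (simp add: image_image)
  ultimately show "\<exists>c::real \<Rightarrow> nat. finite (range c) \<and>
        (\<forall>x y t. c x = c y \<longrightarrow> norm (h (t + x) - h (t + y)) \<le> \<epsilon>)"
    using c(2) by (intro exI[of _ "\<lambda>x. to_nat_on (range c) (c x)"]) auto
qed (rule assms(1))

lemma ap_fun_continuous: "ap_fun h \<Longrightarrow> continuous_on S h"
  unfolding ap_fun_def using continuous_on_subset by blast

lemma ap_funE:
  assumes "ap_fun h" "\<epsilon> > 0"
  obtains c :: "real \<Rightarrow> nat" where "finite (range c)"
    "\<And>x y t. c x = c y \<Longrightarrow> norm (h (t + x) - h (t + y)) \<le> \<epsilon>"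
  using assms unfolding ap_fun_def by blast

lemma ap_fun_finite_net:
  assumes "ap_fun h" "\<epsilon> > 0"
  obtains F where "finite F" "F \<noteq> {}" "\<And>x. \<exists>y\<in>F. \<forall>t. norm (h (t + x) - h (t + y)) \<le> \<epsilon>"
proof -
  obtain c :: "real \<Rightarrow> nat" where c: "finite (range c)"
    "\<And>x y t. c x = c y \<Longrightarrow> norm (h (t + x) - h (t + y)) \<le> \<epsilon>"
    using ap_funE[OF assms] by blast
  show ?thesis
  proof (rule that[of "inv c ` range c"])
    show "finite (inv c ` range c)" using c(1) by simp
    fix x
    have "c x = c (inv c (c x))" by (simp add: f_inv_into_f)
    then show "\<exists>y\<in>inv c ` range c. \<forall>t. norm (h (t + x) - h (t + y)) \<le> \<epsilon>"
      using c(2) by blast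
  qed auto
qed

text \<open>The net is used at the single point 0: every value of \<open>h\<close> is within 1 of
  one of finitely many values.\<close>

lemma ap_fun_bounded:
  assumes "ap_fun h"
  obtains B where "B > 0" "\<And>t. norm (h t) \<le> B"
proof -
  obtain F where F: "finite F" "F \<noteq> {}" "\<And>x. \<exists>y\<in>F. \<forall>t. norm (h (t + x) - h (t + y)) \<le> 1"
    using ap_fun_finite_net[OF assms, of 1] by auto
  have "norm (h x) \<le> 1 + (\<Sum>y\<in>F. norm (h y))" for x
  proof -
    obtain y where y: "y \<in> F" "norm (h (0 + x) - h (0 + y)) \<le> 1" using F(3) by blast
    have "norm (h y) \<le> (\<Sum>y\<in>F. norm (h y))" using F(1) y(1) by (intro member_le_sum) auto
    then show ?thesis using y(2) norm_triangle_ineq2[of "h x" "h y"] by simp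
  qed
  then show ?thesis by (intro that[of "1 + (\<Sum>y\<in>F. norm (h y))"]) (auto intro!: sum_nonneg add_pos_nonneg)
qed

lemma finite_range_Pair:
  assumes "finite (range c)" "finite (range d)"
  shows "finite (range (\<lambda>x. (c x, d x)))"
  by (rule finite_subset[of _ "range c \<times> range d"]) (use assms in auto)

lemma ap_fun_add:
  assumes "ap_fun g" "ap_fun h"
  shows "ap_fun (\<lambda>t. g t + h t)"
proof (rule ap_funI)
  fix \<epsilon> :: real assume \<epsilon>: "\<epsilon> > 0"
  then have \<epsilon>2: "\<epsilon>/2 > 0" by simp
  obtain c :: "real \<Rightarrow> nat" where c: "finite (range c)"
    "\<And>x y t. c x = c y \<Longrightarrow> norm (g (t + x) - g (t + y)) \<le> \<epsilon>/2"
    using ap_funE[OF assms(1) \<epsilon>2] by blast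
  obtain d :: "real \<Rightarrow> nat" where d: "finite (range d)"
    "\<And>x y t. d x = d y \<Longrightarrow> norm (h (t + x) - h (t + y)) \<le> \<epsilon>/2"
    using ap_funE[OF assms(2) \<epsilon>2] by blast
  have "norm (g (t + x) + h (t + x) - (g (t + y) + h (t + y))) \<le> \<epsilon>" if "c x = c y" "d x = d y" for x y t
    using norm_triangle_ineq[of "g (t + x) - g (t + y)" "h (t + x) - h (t + y)"]
      c(2)[OF that(1), of t] d(2)[OF that(2), of t] by (simp add: algebra_simps)
  then show "\<exists>c::real \<Rightarrow> nat \<times> nat. finite (range c) \<and>
        (\<forall>x y t. c x = c y \<longrightarrow> norm (g (t + x) + h (t + x) - (g (t + y) + h (t + y))) \<le> \<epsilon>)"
    using finite_range_Pair[OF c(1) d(1)] by (intro exI[of _ "\<lambda>x. (c x, d x)"]) auto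
qed (intro continuous_intros ap_fun_continuous assms)

lemma ap_fun_mult:
  assumes "ap_fun g" "ap_fun h"
  shows "ap_fun (\<lambda>t. g t * h t)"
proof (rule ap_funI)
  fix \<epsilon> :: real assume \<epsilon>: "\<epsilon> > 0"
  obtain A where A: "A > 0" "\<And>t. norm (g t) \<le> A" using ap_fun_bounded[OF assms(1)] by blast
  obtain B where B: "B > 0" "\<And>t. norm (h t) \<le> B" using ap_fun_bounded[OF assms(2)] by blast
  obtain c :: "real \<Rightarrow> nat" where c: "finite (range c)"
    "\<And>x y t. c x = c y \<Longrightarrow> norm (g (t + x) - g (t + y)) \<le> \<epsilon>/(2*B)"
    using ap_funE[OF assms(1), of "\<epsilon>/(2*B)"] \<epsilon> B(1) by auto
  obtain d :: "real \<Rightarrow> nat" where d: "finite (range d)"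
    "\<And>x y t. d x = d y \<Longrightarrow> norm (h (t + x) - h (t + y)) \<le> \<epsilon>/(2*A)"
    using ap_funE[OF assms(2), of "\<epsilon>/(2*A)"] \<epsilon> A(1) by auto
  have "norm (g (t + x) * h (t + x) - g (t + y) * h (t + y)) \<le> \<epsilon>" if "c x = c y" "d x = d y" for x y t
  proof -
    have "norm (g (t + x) * h (t + x) - g (t + y) * h (t + y))
       = norm ((g (t + x) - g (t + y)) * h (t + x) + g (t + y) * (h (t + x) - h (t + y)))"
      by (simp add: algebra_simps)
    also have "\<dots> \<le> norm (g (t + x) - g (t + y)) * norm (h (t + x)) + norm (g (t + y)) * norm (h (t + x) - h (t + y))"
      by (metis norm_triangle_ineq norm_mult)
    also have "\<dots> \<le> \<epsilon>/(2*B) * B + A * (\<epsilon>/(2*A))"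
      using c(2)[OF that(1), of t] d(2)[OF that(2), of t] A B \<epsilon> by (intro add_mono mult_mono) auto
    also have "\<dots> = \<epsilon>" using A(1) B(1) by (simp add: field_simps)
    finally show ?thesis .
  qed
  then show "\<exists>c::real \<Rightarrow> nat \<times> nat. finite (range c) \<and>
        (\<forall>x y t. c x = c y \<longrightarrow> norm (g (t + x) * h (t + x) - g (t + y) * h (t + y)) \<le> \<epsilon>)"
    using finite_range_Pair[OF c(1) d(1)] by (intro exI[of _ "\<lambda>x. (c x, d x)"]) auto
qed (intro continuous_intros ap_fun_continuous assms)

lemma ap_fun_const [simp]: "ap_fun (\<lambda>t. c)"
  by (rule ap_funI) (auto intro!: exI[of _ "\<lambda>_. 0::nat"])

text \<open>Translating by x only multiplies the function by the constant
  \<open>cis (\<mu> * x)\<close>. Total boundedness of the unit circle sorts these constants into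
  finitely many classes.\<close>

lemma ap_fun_cis: "ap_fun (\<lambda>t. cis (\<mu> * t))"
proof (rule ap_funI)
  fix \<epsilon> :: real assume \<epsilon>: "\<epsilon> > 0"
  have "compact (sphere (0::complex) 1)" by simp
  then obtain K where K: "finite K" "sphere (0::complex) 1 \<subseteq> (\<Union>x\<in>K. ball x (\<epsilon>/2))"
    using compact_eq_totally_bounded[of "sphere (0::complex) 1"] \<epsilon> by (meson half_gt_zero)
  define c where "c x = (SOME k. k \<in> K \<and> dist k (cis (\<mu> * x)) < \<epsilon>/2)" for x
  have c: "c x \<in> K \<and> dist (c x) (cis (\<mu> * x)) < \<epsilon>/2" for x
  proof -
    have "cis (\<mu> * x) \<in> sphere 0 1" by simp
    then have "\<exists>k. k \<in> K \<and> dist k (cis (\<mu> * x)) < \<epsilon>/2" using K(2) unfolding subset_iff UN_iff mem_ball by blast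
    then show ?thesis unfolding c_def by (rule someI_ex)
  qed
  have "norm (cis (\<mu> * (t + x)) - cis (\<mu> * (t + y))) \<le> \<epsilon>" if "c x = c y" for x y t
  proof -
    have "cis (\<mu> * (t + x)) - cis (\<mu> * (t + y)) = cis (\<mu> * t) * (cis (\<mu> * x) - cis (\<mu> * y))"
      by (simp add: algebra_simps flip: cis_mult)
    then have "norm (cis (\<mu> * (t + x)) - cis (\<mu> * (t + y))) = dist (cis (\<mu> * x)) (cis (\<mu> * y))"
      by (simp add: norm_mult dist_norm)
    also have "\<dots> < \<epsilon>" using c[of x] c[of y] that dist_triangle_half_r by metis
    finally show ?thesis by simp
  qed
  moreover have "finite (range c)" using c K(1) by (meson finite_subset image_subset_iff)
  ultimately show "\<exists>c::real \<Rightarrow> complex. finite (range c) \<and>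
        (\<forall>x y t. c x = c y \<longrightarrow> norm (cis (\<mu> * (t + x)) - cis (\<mu> * (t + y))) \<le> \<epsilon>)" by blast
qed (intro continuous_intros)

lemma ap_fun_uniform_limit:
  assumes "\<And>\<epsilon>. \<epsilon> > 0 \<Longrightarrow> \<exists>g. ap_fun g \<and> (\<forall>t. norm (h t - g t) \<le> \<epsilon>)"
  shows "ap_fun h"
proof (rule ap_funI)
  have "\<exists>g. ap_fun g \<and> (\<forall>t. norm (h t - g t) \<le> inverse (Suc n))" for n
    by (rule assms) simp
  then obtain g where g: "\<And>n. ap_fun (g n)" "\<And>n t. norm (h t - g n t) \<le> inverse (Suc n)" by metis
  have "uniform_limit UNIV g h sequentially"
  proof (rule uniform_limitI)
    fix e :: real assume "e > 0"
    then obtain N where N: "inverse (real (Suc N)) < e" using reals_Archimedean by blast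
    have "dist (g n x) (h x) < e" if "n \<ge> N" for n x
    proof -
      have "inverse (real (Suc n)) \<le> inverse (real (Suc N))" using that by (simp add: le_imp_inverse_le)
      then have "norm (h x - g n x) < e" using g(2)[of x n] N by linarith
      then show ?thesis by (simp add: dist_norm norm_minus_commute)
    qed
    then show "\<forall>\<^sub>F n in sequentially. \<forall>x\<in>UNIV. dist (g n x) (h x) < e"
      by (auto simp: eventually_at_top_linorder)
  qed
  then show "continuous_on UNIV h"
    by (rule uniform_limit_theorem[rotated]) (auto intro!: always_eventually ap_fun_continuous g)
  fix \<epsilon> :: real assume "\<epsilon> > 0"
  then have \<epsilon>: "\<epsilon>/3 > 0" by simp
  obtain g where g: "ap_fun g" "\<And>t. norm (h t - g t) \<le> \<epsilon>/3" using assms[OF \<epsilon>] by blast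
  obtain c :: "real \<Rightarrow> nat" where c: "finite (range c)"
    "\<And>x y t. c x = c y \<Longrightarrow> norm (g (t + x) - g (t + y)) \<le> \<epsilon>/3"
    using ap_funE[OF g(1) \<epsilon>] by blast
  have "norm (h (t + x) - h (t + y)) \<le> \<epsilon>" if "c x = c y" for x y t
  proof -
    have "norm (h (t + x) - h (t + y)) = norm ((h (t + x) - g (t + x)) + (g (t + x) - g (t + y)) - (h (t + y) - g (t + y)))"
      by simp
    also have "\<dots> \<le> norm (h (t + x) - g (t + x)) + norm (g (t + x) - g (t + y)) + norm (h (t + y) - g (t + y))"
      by (meson add_right_mono norm_triangle_ineq norm_triangle_ineq4 order_trans)
    also have "\<dots> \<le> \<epsilon>/3 + \<epsilon>/3 + \<epsilon>/3" by (intro add_mono g c that)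
    finally show ?thesis by simp
  qed
  then show "\<exists>c::real \<Rightarrow> nat. finite (range c) \<and>
        (\<forall>x y t. c x = c y \<longrightarrow> norm (h (t + x) - h (t + y)) \<le> \<epsilon>)" using c(1) by blast
qed

text \<open>Continuity at the finitely many net points suffices: if the translates by y and z nearly
  agree, then \<open>h x - h y\<close> nearly equals \<open>h ((x - y) + z) - h z\<close>.\<close>

lemma ap_fun_uniformly_continuous:
  assumes "ap_fun h" "\<epsilon> > 0"
  obtains \<delta> where "\<delta> > 0" "\<And>x y. \<bar>x - y\<bar> < \<delta> \<Longrightarrow> norm (h x - h y) \<le> \<epsilon>"
proof -
  have \<epsilon>: "\<epsilon>/3 > 0" using assms(2) by simp
  obtain F where F: "finite F" "F \<noteq> {}" "\<And>x. \<exists>y\<in>F. \<forall>t. norm (h (t + x) - h (t + y)) \<le> \<epsilon>/3"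
    using ap_fun_finite_net[OF assms(1) \<epsilon>] by blast
  have "\<forall>y\<in>F. \<exists>d>0. \<forall>x. dist x y < d \<longrightarrow> dist (h x) (h y) < \<epsilon>/3"
    using ap_fun_continuous[OF assms(1), of UNIV] \<epsilon> unfolding continuous_on_iff by blast
  then obtain d where d: "\<And>y. y \<in> F \<Longrightarrow> d y > 0"
      "\<And>y x. y \<in> F \<Longrightarrow> dist x y < d y \<Longrightarrow> dist (h x) (h y) < \<epsilon>/3" by metis
  show ?thesis
  proof (rule that[of "Min (d ` F)"])
    show "Min (d ` F) > 0" using F d by simp
    fix x y assume xy: "\<bar>x - y\<bar> < Min (d ` F)"
    obtain z where z: "z \<in> F" "\<And>t. norm (h (t + y) - h (t + z)) \<le> \<epsilon>/3" using F(3) by blast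
    have "dist ((x - y) + z) z < d z" using xy z(1) F by (auto simp: dist_real_def)
    then have 1: "norm (h ((x - y) + z) - h z) < \<epsilon>/3" using d(2)[OF z(1)] by (simp add: dist_norm)
    have "h x - h y = (h ((x - y) + y) - h ((x - y) + z)) + (h ((x - y) + z) - h z) - (h (0 + y) - h (0 + z))" by simp
    then have "norm (h x - h y) \<le> norm (h ((x - y) + y) - h ((x - y) + z)) + norm (h ((x - y) + z) - h z) + norm (h (0 + y) - h (0 + z))"
      by (metis (no_types, lifting) add_right_mono norm_triangle_ineq norm_triangle_ineq4 order_trans)
    also have "\<dots> \<le> \<epsilon>/3 + \<epsilon>/3 + \<epsilon>/3" by (intro add_mono z(2) less_imp_le[OF 1])
    finally show "norm (h x - h y) \<le> \<epsilon>" by simp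
  qed
qed

text \<open>Bohr's condition implies Bochner's: each x is a translation number \<open>p x\<close>
  plus a remainder in [0, l]. The translation number hardly changes \<open>h\<close>, and by uniform
  continuity the remainder matters only up to \<open>d\<close>, so the cells of length
  \<open>d\<close> in [0, l] serve as classes.\<close>

lemma ap_fun_of_relatively_dense:
  fixes h :: "real \<Rightarrow> complex"
  assumes cont: "continuous_on UNIV h"
    and dense: "\<And>\<epsilon>. \<epsilon> > 0 \<Longrightarrow> \<exists>l>0. \<forall>x. \<exists>\<tau>\<in>{x..x + l}. \<forall>t. norm (h (t + \<tau>) - h t) \<le> \<epsilon>"
  shows "ap_fun h"
proof (rule ap_funI)
  have unif: "\<exists>\<delta>>0. \<forall>x y. \<bar>x - y\<bar> < \<delta> \<longrightarrow> norm (h x - h y) \<le> \<epsilon>" if "\<epsilon> > 0" for \<epsilon>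
  proof -
    have \<epsilon>: "\<epsilon>/3 > 0" using that by simp
    obtain l where l: "l > 0" "\<And>x. \<exists>\<tau>\<in>{x..x + l}. \<forall>t. norm (h (t + \<tau>) - h t) \<le> \<epsilon>/3"
      using dense[OF \<epsilon>] by blast
    \<comment> \<open>A translation number in \<open>{-x..-x+l}\<close> moves x into [0, l]. The
      margin 1 makes room for y, which lies within 1 of x.\<close>
    have "uniformly_continuous_on {-1..l+1} h"
      by (intro compact_uniformly_continuous continuous_on_subset[OF cont]) auto
    then obtain d where d: "d > 0" "\<And>x y. x \<in> {-1..l+1} \<Longrightarrow> y \<in> {-1..l+1} \<Longrightarrow> dist x y < d \<Longrightarrow> dist (h x) (h y) < \<epsilon>/3"
      using \<epsilon> unfolding uniformly_continuous_on_def by meson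
    have "norm (h x - h y) \<le> \<epsilon>" if xy: "\<bar>x - y\<bar> < min d 1" for x y
    proof -
      obtain \<tau> where \<tau>: "\<tau> \<in> {-x..-x+l}" "\<And>t. norm (h (t + \<tau>) - h t) \<le> \<epsilon>/3" using l(2) by blast
      have "dist (h (x + \<tau>)) (h (y + \<tau>)) < \<epsilon>/3"
        using xy \<tau>(1) by (intro d(2)) (auto simp: dist_real_def)
      then have 1: "norm (h (x + \<tau>) - h (y + \<tau>)) \<le> \<epsilon>/3" by (simp add: dist_norm)
      have "h x - h y = (h (x + \<tau>) - h (y + \<tau>)) - (h (x + \<tau>) - h x) + (h (y + \<tau>) - h y)" by simp
      then have "norm (h x - h y) \<le> norm (h (x + \<tau>) - h (y + \<tau>)) + norm (h (x + \<tau>) - h x) + norm (h (y + \<tau>) - h y)"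
        by (metis (no_types, lifting) add_right_mono norm_triangle_ineq norm_triangle_ineq4 order_trans)
      also have "\<dots> \<le> \<epsilon>/3 + \<epsilon>/3 + \<epsilon>/3" by (intro add_mono 1 \<tau>)
      finally show ?thesis by simp
    qed
    then show ?thesis using d(1) by (intro exI[of _ "min d 1"]) auto
  qed
  fix \<epsilon> :: real assume "\<epsilon> > 0"
  then have \<epsilon>: "\<epsilon>/3 > 0" by simp
  obtain l where l: "l > 0" "\<And>x. \<exists>\<tau>\<in>{x..x + l}. \<forall>t. norm (h (t + \<tau>) - h t) \<le> \<epsilon>/3"
    using dense[OF \<epsilon>] by blast
  obtain d where d: "d > 0" "\<And>x y. \<bar>x - y\<bar> < d \<Longrightarrow> norm (h x - h y) \<le> \<epsilon>/3" using unif[OF \<epsilon>] by blast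
  have "\<forall>x. \<exists>\<tau>. \<tau> \<in> {x-l..x} \<and> (\<forall>t. norm (h (t + \<tau>) - h t) \<le> \<epsilon>/3)"
    using l(2)[of "_ - l"] by fastforce
  then obtain p where p: "\<And>x. p x \<in> {x-l..x}" "\<And>x t. norm (h (t + p x) - h t) \<le> \<epsilon>/3" by metis
  define c where "c x = \<lfloor>(x - p x) / d\<rfloor>" for x
  have "0 \<le> x - p x \<and> x - p x \<le> l" for x using p(1)[of x] by auto
  then have "range c \<subseteq> {0..\<lfloor>l/d\<rfloor>}"
    using d(1) by (auto simp: c_def zero_le_floor intro!: floor_mono divide_right_mono)
  then have "finite (range c)" by (rule finite_subset) simp
  moreover have "norm (h (t + x) - h (t + y)) \<le> \<epsilon>" if "c x = c y" for x y t
  proof -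
    have "\<bar>(x - p x) / d - (y - p y) / d\<bar> < 1" using that unfolding c_def by linarith
    then have "\<bar>(x - p x) - (y - p y)\<bar> < d" using d(1) by (simp flip: diff_divide_distrib add: abs_divide)
    then have 1: "norm (h (t + x - p x) - h (t + y - p y)) \<le> \<epsilon>/3" by (intro d(2)) (simp add: algebra_simps)
    have "h (t + x) - h (t + y) = (h (t + x - p x) - h (t + y - p y)) + (h ((t + x - p x) + p x) - h (t + x - p x)) - (h ((t + y - p y) + p y) - h (t + y - p y))" by simp
    then have "norm (h (t + x) - h (t + y)) \<le> norm (h (t + x - p x) - h (t + y - p y)) + norm (h ((t + x - p x) + p x) - h (t + x - p x)) + norm (h ((t + y - p y) + p y) - h (t + y - p y))"
      by (metis (no_types, lifting) add_right_mono norm_triangle_ineq norm_triangle_ineq4 order_trans)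
    also have "\<dots> \<le> \<epsilon>/3 + \<epsilon>/3 + \<epsilon>/3" by (intro add_mono 1 p)
    finally show ?thesis by simp
  qed
  ultimately show "\<exists>c::real \<Rightarrow> int. finite (range c) \<and>
        (\<forall>x y t. c x = c y \<longrightarrow> norm (h (t + x) - h (t + y)) \<le> \<epsilon>)" by blast
qed (rule cont)

section \<open>Mean values\<close>

definition has_mean :: "(real \<Rightarrow> complex) \<Rightarrow> complex \<Rightarrow> bool" where
  "has_mean h c \<longleftrightarrow> ((\<lambda>T::real. 1 / (2 * of_real T) * integral {-T..T} h) \<longlongrightarrow> c) at_top"

lemma continuous_integrable_real:
  fixes h :: "real \<Rightarrow> complex"
  assumes "continuous_on UNIV h"
  shows "h integrable_on {a..b}"
  using integrable_continuous_real continuous_on_subset[OF assms] by blast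

lemma norm_integral_Icc_le:
  fixes h :: "real \<Rightarrow> complex"
  assumes "continuous_on UNIV h" "a \<le> b" "\<And>t. t \<in> {a..b} \<Longrightarrow> norm (h t) \<le> B"
  shows "norm (integral {a..b} h) \<le> B * (b - a)"
  using integral_bound[OF assms(2) continuous_on_subset[OF assms(1)]] assms(3) by auto

lemma integral_Icc_split:
  fixes h :: "real \<Rightarrow> complex"
  assumes "continuous_on UNIV h" "a \<le> b" "b \<le> c"
  shows "integral {a..c} h = integral {a..b} h + integral {b..c} h"
  using Henstock_Kurzweil_Integration.integral_combine[OF assms(2,3) continuous_integrable_real[OF assms(1)]] by simp

lemma integral_Icc_shift:
  fixes h :: "real \<Rightarrow> complex"
  assumes "continuous_on UNIV h"
  shows "integral {x + a..x + b} h = integral {a..b} (\<lambda>t. h (t + x))"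
proof -
  have "(h has_integral integral {x + a..x + b} h) {x + a..x + b}"
    using continuous_integrable_real[OF assms] by blast
  then have "((\<lambda>t. h (1 *\<^sub>R t + x)) has_integral (1 / \<bar>1\<bar> ^ DIM(real)) *\<^sub>R integral {x + a..x + b} h) ((\<lambda>t. (1 / 1) *\<^sub>R t + - ((1 / 1) *\<^sub>R x)) ` cbox (x + a) (x + b))"
    using has_integral_affinity[of h "integral {x + a..x + b} h" "x + a" "x + b" 1 x] by simp
  moreover have "(\<lambda>t. (1 / 1) *\<^sub>R t + - ((1 / 1) *\<^sub>R x)) ` cbox (x + a) (x + b) = {a..b}"
    using image_add_atLeastAtMost[of "-x" "x+a" "x+b"] by (simp add: add.commute image_def)
  ultimately show ?thesis by (simp add: integral_unique[symmetric])
qed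

text \<open>The point is that \<open>K\<close> depends neither on x nor on T. Replacing x by a net
  point y costs \<epsilon> per unit length, and the windows at y and at 0 differ only by pieces near
  their ends, of total length at most 2\<bar>y\<bar>.\<close>

lemma ap_fun_integral_translate:
  assumes "ap_fun h" "\<epsilon> > 0"
  obtains K where "\<And>x T. T \<ge> 0 \<Longrightarrow> norm (integral {x..x + T} h - integral {0..T} h) \<le> \<epsilon> * T + K"
proof -
  note cont = ap_fun_continuous[OF assms(1), of UNIV]
  obtain B where B: "B > 0" "\<And>t. norm (h t) \<le> B" using ap_fun_bounded[OF assms(1)] by blast
  obtain F where F: "finite F" "F \<noteq> {}" "\<And>x. \<exists>y\<in>F. \<forall>t. norm (h (t + x) - h (t + y)) \<le> \<epsilon>"
    using ap_fun_finite_net[OF assms] by blast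
  have Fb: "norm (integral {y..y + T} h - integral {0..T} h) \<le> 2 * B * \<bar>y\<bar>" if "T \<ge> 0" for y T
  proof -
    \<comment> \<open>Both windows lie in the interval from \<open>m\<close> to
      \<open>m + \<bar>y\<bar> + T\<close>, so one decomposition covers both signs of y.\<close>
    define m where "m = min 0 y"
    have bd: "norm (integral {a..b} h) \<le> B * (b - a)" if "a \<le> b" for a b
      using norm_integral_Icc_le[OF cont that] B(2) by blast
    have "integral {m..m + \<bar>y\<bar> + T} h = integral {m..y} h + integral {y..m + \<bar>y\<bar> + T} h"
      by (rule integral_Icc_split[OF cont]) (use that in \<open>auto simp: m_def\<close>)
    moreover have "integral {y..m + \<bar>y\<bar> + T} h = integral {y..y + T} h + integral {y + T..m + \<bar>y\<bar> + T} h"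
      by (rule integral_Icc_split[OF cont]) (use that in \<open>auto simp: m_def\<close>)
    moreover have "integral {m..m + \<bar>y\<bar> + T} h = integral {m..0} h + integral {0..m + \<bar>y\<bar> + T} h"
      by (rule integral_Icc_split[OF cont]) (use that in \<open>auto simp: m_def\<close>)
    moreover have "integral {0..m + \<bar>y\<bar> + T} h = integral {0..T} h + integral {T..m + \<bar>y\<bar> + T} h"
      by (rule integral_Icc_split[OF cont]) (use that in \<open>auto simp: m_def\<close>)
    ultimately have "integral {y..y + T} h - integral {0..T} h =
        (integral {m..0} h - integral {m..y} h) + (integral {T..m + \<bar>y\<bar> + T} h - integral {y + T..m + \<bar>y\<bar> + T} h)"
      by (simp add: algebra_simps)
    then have "norm (integral {y..y + T} h - integral {0..T} h) \<le>
        (norm (integral {m..0} h) + norm (integral {m..y} h)) + (norm (integral {T..m + \<bar>y\<bar> + T} h) + norm (integral {y + T..m + \<bar>y\<bar> + T} h))"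
      by (metis (no_types) norm_triangle_mono norm_triangle_ineq4)
    also have "\<dots> \<le> (B * (0 - m) + B * (y - m)) + (B * (m + \<bar>y\<bar>) + B * (m + \<bar>y\<bar> - y))"
      by (intro add_mono order_trans[OF bd]) (auto simp: m_def)
    also have "\<dots> = 2 * B * \<bar>y\<bar>" by (auto simp: m_def min_def algebra_simps abs_if)
    finally show ?thesis .
  qed
  show ?thesis
  proof (rule that[of "\<Sum>y\<in>F. 2 * B * \<bar>y\<bar>"])
    fix x T :: real assume T: "T \<ge> 0"
    obtain y where y: "y \<in> F" "\<And>t. norm (h (t + x) - h (t + y)) \<le> \<epsilon>" using F(3) by blast
    have c2: "continuous_on UNIV (\<lambda>t. h (t + z))" for z
      by (intro continuous_on_compose2[OF cont] continuous_intros) auto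
    have "integral {x..x + T} h - integral {y..y + T} h = integral {0..T} (\<lambda>t. h (t + x) - h (t + y))"
      using integral_Icc_shift[OF cont, of x 0 T] integral_Icc_shift[OF cont, of y 0 T]
        integral_diff[OF continuous_integrable_real[OF c2[of x]] continuous_integrable_real[OF c2[of y]], of 0 T] by simp
    also have "norm \<dots> \<le> \<epsilon> * (T - 0)"
      by (intro norm_integral_Icc_le continuous_intros c2 T y)
    finally have 1: "norm (integral {x..x + T} h - integral {y..y + T} h) \<le> \<epsilon> * T" by simp
    have "2 * B * \<bar>y\<bar> \<le> (\<Sum>y\<in>F. 2 * B * \<bar>y\<bar>)"
      using B(1) F(1) y(1) by (intro member_le_sum) auto
    then show "norm (integral {x..x + T} h - integral {0..T} h) \<le> \<epsilon> * T + (\<Sum>y\<in>F. 2 * B * \<bar>y\<bar>)"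
      using 1 Fb[OF T, of y] norm_triangle_ineq[of "integral {x..x + T} h - integral {y..y + T} h" "integral {y..y + T} h - integral {0..T} h"]
      by simp
  qed
qed

lemma integral_multiple:
  fixes h :: "real \<Rightarrow> complex"
  assumes "continuous_on UNIV h" "T \<ge> 0"
  shows "integral {x..x + of_nat k * T} h = (\<Sum>j<k. integral {x + of_nat j * T..x + of_nat j * T + T} h)"
proof (induction k)
  case (Suc k)
  have "integral {x..x + of_nat (Suc k) * T} h = integral {x..x + of_nat k * T} h + integral {x + of_nat k * T..x + of_nat (Suc k) * T} h"
    by (rule integral_Icc_split[OF assms(1)]) (use assms(2) in \<open>auto simp: mult_right_mono\<close>)
  then show ?case using Suc by (simp add: algebra_simps)
qed simp

lemma has_mean_unique: "has_mean h c \<Longrightarrow> has_mean h d \<Longrightarrow> c = d"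
  unfolding has_mean_def by (rule tendsto_unique[rotated]) auto

text \<open>A window of length k n consists of k windows of length n with almost equal integrals, so
  \<open>m (k * n)\<close> is close to \<open>m n\<close>. Both \<open>m p\<close> and
  \<open>m n\<close> are thus close to \<open>m (p * n)\<close>, which makes \<open>m\<close> a
  Cauchy sequence. The error bound uniform in x is what the discretisation below needs beyond the
  mere existence of the mean.\<close>

theorem ap_fun_uniform_mean:
  assumes "ap_fun h"
  obtains c where "has_mean h c"
    "\<And>\<epsilon>. \<epsilon> > 0 \<Longrightarrow> \<exists>K. \<forall>x. \<forall>T\<ge>0. norm (integral {x..x + T} h - of_real T * c) \<le> \<epsilon> * T + K"
proof -
  note cont = ap_fun_continuous[OF assms(1), of UNIV]
  obtain B where B: "B > 0" "\<And>t. norm (h t) \<le> B" using ap_fun_bounded[OF assms(1)] by blast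
  define m where "m n = integral {0..real n} h / of_nat n" for n
  have mult: "norm (m (k * n) - m n) \<le> \<epsilon> + K / n"
    if K: "\<And>x T. T \<ge> 0 \<Longrightarrow> norm (integral {x..x + T} h - integral {0..T} h) \<le> \<epsilon> * T + K" and "k > 0" "n > 0"
    for \<epsilon> K k n
  proof -
    have "integral {0..0 + real k * real n} h - of_nat k * integral {0..real n} h
        = (\<Sum>j<k. integral {0 + real j * real n..0 + real j * real n + real n} h - integral {0..real n} h)"
      by (subst integral_multiple[OF cont]) (auto simp: sum_subtractf)
    also have "norm \<dots> \<le> (\<Sum>j<k. \<epsilon> * n + K)" by (intro sum_norm_le K) auto
    finally have *: "norm (integral {0..real k * real n} h - of_nat k * integral {0..real n} h) \<le> k * (\<epsilon> * n + K)" by simp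
    have "m (k * n) - m n = (integral {0..real k * real n} h - of_nat k * integral {0..real n} h) / (of_nat k * of_nat n)"
      using that unfolding m_def by (simp add: field_simps)
    then have "norm (m (k * n) - m n) = norm (integral {0..real k * real n} h - of_nat k * integral {0..real n} h) / (k * n)"
      by (simp add: norm_divide norm_mult)
    also have "\<dots> \<le> k * (\<epsilon> * n + K) / (k * n)" using * by (intro divide_right_mono) auto
    also have "\<dots> = \<epsilon> + K / n" using that by (simp add: field_simps)
    finally show ?thesis .
  qed
  have "Cauchy m"
  proof (rule metric_CauchyI)
    fix e :: real assume e: "e > 0"
    \<comment> \<open>Two comparisons, each costing e/5 for the translations and less than e/5 for
      \<open>K / n\<close>, leave the total below e.\<close>
    then have e4: "e/5 > 0" by simp
    obtain K where K: "\<And>x T. T \<ge> 0 \<Longrightarrow> norm (integral {x..x + T} h - integral {0..T} h) \<le> (e/5) * T + K"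
      using ap_fun_integral_translate[OF assms e4] by blast
    obtain M :: nat where M: "M > 0" "\<bar>K\<bar> / (e/5) < M" using reals_Archimedean2[of "max 1 (\<bar>K\<bar> / (e/5))"]
      by (metis less_numeral_extra(1) max.strict_boundedE of_nat_0_less_iff order_less_trans)
    have *: "K / n < e/5" if "n \<ge> M" for n
    proof -
      have "\<bar>K\<bar> < e/5 * M" using M e by (simp add: field_simps)
      also have "\<dots> \<le> e/5 * n" using that e by (intro mult_left_mono) auto
      finally show ?thesis using that M by (simp add: field_simps)
    qed
    show "\<exists>M. \<forall>p\<ge>M. \<forall>n\<ge>M. dist (m p) (m n) < e"
    proof (intro exI[of _ M] allI impI)
      fix p n assume pn: "M \<le> p" "M \<le> n"
      have "norm (m (n * p) - m p) \<le> e/5 + K / p" by (rule mult[OF K]) (use pn M in auto)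
      moreover have "norm (m (p * n) - m n) \<le> e/5 + K / n" by (rule mult[OF K]) (use pn M in auto)
      moreover have "norm (m p - m n) \<le> norm (m (n * p) - m p) + norm (m (p * n) - m n)"
        by (metis dist_norm dist_triangle2 dist_commute mult.commute)
      ultimately show "dist (m p) (m n) < e" using *[OF pn(1)] *[OF pn(2)] e unfolding dist_norm by linarith
    qed
  qed
  then obtain c where c: "m \<longlonglongrightarrow> c" using Cauchy_convergent_iff convergent_def by blast
  have unif: "\<exists>K. \<forall>x. \<forall>T\<ge>0. norm (integral {x..x + T} h - of_real T * c) \<le> \<epsilon> * T + K" if "\<epsilon> > 0" for \<epsilon>
  proof -
    have \<epsilon>: "\<epsilon>/2 > 0" using that by simp
    obtain K where K: "\<And>x T. T \<ge> 0 \<Longrightarrow> norm (integral {x..x + T} h - integral {0..T} h) \<le> (\<epsilon>/2) * T + K"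
      using ap_fun_integral_translate[OF assms \<epsilon>] by blast
    have K0: "K \<ge> 0" using order_trans[OF norm_ge_zero K[of 0 0]] by simp
    have 1: "norm (integral {0..real n} h - of_nat n * c) \<le> \<epsilon>/2 * n + K" for n
    proof (cases "n = 0")
      case False
      \<comment> \<open>Letting the multiple grow in \<open>mult\<close> replaces
        \<open>m (k * n)\<close> by the limit \<open>c\<close>; \<open>Suc\<close> keeps the
        multiple positive.\<close>
      have "(\<lambda>k. m (Suc k * n)) \<longlonglongrightarrow> c"
        by (rule filterlim_compose[OF c]) (use False in \<open>auto intro!: filterlim_subseq strict_monoI\<close>)
      then have "(\<lambda>k. norm (m (Suc k * n) - m n)) \<longlonglongrightarrow> norm (c - m n)" by (intro tendsto_intros)
      then have "norm (c - m n) \<le> \<epsilon>/2 + K / n"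
        by (rule LIMSEQ_le_const2) (use False in \<open>auto intro!: mult[OF K] simp del: mult_Suc\<close>)
      then have "norm (of_nat n * (m n - c)) \<le> n * (\<epsilon>/2 + K / n)"
        by (simp add: norm_mult norm_minus_commute mult_left_mono)
      moreover have "of_nat n * (m n - c) = integral {0..real n} h - of_nat n * c"
        using False by (simp add: m_def field_simps)
      moreover have "real n * (\<epsilon>/2 + K / n) = \<epsilon>/2 * n + K" using False by (simp add: field_simps)
      ultimately show ?thesis by simp
    qed (use K0 in auto)
    \<comment> \<open>The constant collects one \<open>K\<close> for moving the window to 0, one
      \<open>K\<close> for its integral part, and \<open>B + norm c\<close> for the fractional part
      of \<open>T\<close>.\<close>
    have "norm (integral {x..x + T} h - of_real T * c) \<le> \<epsilon> * T + (2 * K + B + norm c)" if T: "T \<ge> 0" for x T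
    proof -
      define n where "n = nat \<lfloor>T\<rfloor>"
      have n: "real n \<le> T" "T - real n \<le> 1" using T by (auto simp: n_def) linarith
      have s: "integral {0..T} h = integral {0..real n} h + integral {real n..T} h"
        by (rule integral_Icc_split[OF cont]) (use n in auto)
      have a: "norm (integral {real n..T} h) \<le> B * (T - real n)"
        by (rule norm_integral_Icc_le[OF cont]) (use n B in auto)
      have b: "B * (T - real n) \<le> B * 1" using n B by (intro mult_left_mono) auto
      have d: "norm (of_real (T - real n) * c) \<le> 1 * norm c"
        unfolding norm_mult norm_of_real by (rule mult_right_mono) (use n in auto)
      have e: "\<epsilon>/2 * n \<le> \<epsilon>/2 * T" using \<epsilon> n by (intro mult_left_mono) auto
      have "integral {x..x + T} h - of_real T * c = (integral {x..x + T} h - integral {0..T} h)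
         + (integral {0..real n} h - of_nat n * c) + (integral {real n..T} h - of_real (T - real n) * c)"
        unfolding s by (simp add: algebra_simps)
      then have "norm (integral {x..x + T} h - of_real T * c) \<le> norm (integral {x..x + T} h - integral {0..T} h)
         + norm (integral {0..real n} h - of_nat n * c) + (norm (integral {real n..T} h) + norm (of_real (T - real n) * c))"
        by (metis (no_types) norm_triangle_mono norm_triangle_ineq4 norm_triangle_ineq)
      then show ?thesis using K[OF T, of x] 1[of n] a b d e by (simp add: algebra_simps)
    qed
    then show ?thesis by blast
  qed
  have "has_mean h c"
    unfolding has_mean_def
  proof (rule tendstoI)
    fix e :: real assume "e > 0"
    then have e2: "e/2 > 0" by simp
    obtain K where K: "\<And>x T. T \<ge> 0 \<Longrightarrow> norm (integral {x..x + T} h - of_real T * c) \<le> (e/2) * T + K"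
      using unif[OF e2] by blast
    have "\<forall>\<^sub>F T in at_top. T > max 0 (K / e)" by (rule eventually_gt_at_top)
    then show "\<forall>\<^sub>F T in at_top. dist (1 / (2 * of_real T) * integral {-T..T} h) c < e"
    proof eventually_elim
      case (elim T)
      then have T: "T > 0" "K < e * T" using \<open>e > 0\<close> by (auto simp: field_simps)
      \<comment> \<open>The symmetric interval is the window of length \<open>2 * T\<close> that
        starts at \<open>-T\<close>.\<close>
      have *: "norm (integral {-T..-T + 2 * T} h - of_real (2 * T) * c) \<le> (e/2) * (2 * T) + K"
        by (rule K) (use T in auto)
      have "1 / (2 * of_real T) * integral {-T..T} h - c = (integral {-T..-T + 2 * T} h - of_real (2 * T) * c) / of_real (2 * T)"
        using T by (simp add: field_simps)
      then have "norm (1 / (2 * of_real T) * integral {-T..T} h - c) = norm (integral {-T..-T + 2 * T} h - of_real (2 * T) * c) / (2 * T)"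
        using T by (simp only: norm_divide norm_of_real)
      also have "\<dots> \<le> ((e/2) * (2 * T) + K) / (2 * T)" using * T by (intro divide_right_mono) auto
      also have "\<dots> < e" using T by (simp add: field_simps)
      finally show ?case by (simp add: dist_norm)
    qed
  qed
  then show ?thesis using unif that by blast
qed

lemma has_mean_add:
  assumes "continuous_on UNIV g" "continuous_on UNIV h" "has_mean g c" "has_mean h d"
  shows "has_mean (\<lambda>t. g t + h t) (c + d)"
  using tendsto_add[OF assms(3,4)[unfolded has_mean_def]] continuous_integrable_real[OF assms(1)] continuous_integrable_real[OF assms(2)]
  unfolding has_mean_def by (simp add: integral_add ring_distribs)

lemma has_mean_cmult: "has_mean h c \<Longrightarrow> has_mean (\<lambda>t. k * h t) (k * c)"
  unfolding has_mean_def using tendsto_mult[OF tendsto_const[of k]] by (fastforce simp: mult_ac)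

lemma has_mean_bound:
  assumes "continuous_on UNIV h" "\<And>t. norm (h t) \<le> B" "has_mean h c"
  shows "norm c \<le> B"
proof -
  have "((\<lambda>T::real. norm (1 / (2 * of_real T) * integral {-T..T} h)) \<longlongrightarrow> norm c) at_top"
    using assms(3) unfolding has_mean_def by (rule tendsto_norm)
  moreover have "\<forall>\<^sub>F T in at_top. norm (1 / (2 * complex_of_real T) * integral {-T..T} h) \<le> B"
    using eventually_gt_at_top[of "0::real"]
  proof eventually_elim
    case (elim T)
    have "norm (integral {-T..T} h) \<le> B * (T - (-T))"
      by (rule norm_integral_Icc_le[OF assms(1)]) (use elim assms(2) in auto)
    then show ?case using elim by (simp add: norm_mult norm_divide field_simps)
  qed
  ultimately show ?thesis by (rule tendsto_upperbound) auto
qed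

lemma has_mean_const: "has_mean (\<lambda>t. c) c"
  unfolding has_mean_def
proof (rule tendsto_eventually)
  show "\<forall>\<^sub>F T in at_top. 1 / (2 * complex_of_real T) * integral {-T..T} (\<lambda>t. c) = c"
    using eventually_gt_at_top[of "0::real"] by eventually_elim (simp add: scaleR_conv_of_real)
qed

lemma has_mean_cis:
  assumes "\<mu> \<noteq> 0"
  shows "has_mean (\<lambda>t. cis (\<mu> * t)) 0"
  unfolding has_mean_def
proof (rule Lim_null_comparison)
  have "norm (1 / (2 * complex_of_real T) * integral {-T..T} (\<lambda>t. cis (\<mu> * t))) \<le> (1 / \<bar>\<mu>\<bar>) / T" if "T > 0" for T
  proof -
    have "((\<lambda>t. cis (\<mu> * t)) has_integral (cis (\<mu> * T) / (\<i> * \<mu>) - cis (\<mu> * (-T)) / (\<i> * \<mu>))) {-T..T}"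
    proof (rule fundamental_theorem_of_calculus)
      fix x :: real
      have "((\<lambda>t. exp (\<i> * of_real (\<mu> * t)) / (\<i> * \<mu>)) has_vector_derivative exp (\<i> * of_real (\<mu> * x))) (at x within {-T..T})"
        using assms by (auto intro!: derivative_eq_intros has_vector_derivative_real_field simp: field_simps)
      then show "((\<lambda>t. cis (\<mu> * t) / (\<i> * \<mu>)) has_vector_derivative cis (\<mu> * x)) (at x within {-T..T})"
        by (simp add: cis_conv_exp)
    qed (use that in auto)
    then have "integral {-T..T} (\<lambda>t. cis (\<mu> * t)) = cis (\<mu> * T) / (\<i> * \<mu>) - cis (\<mu> * (-T)) / (\<i> * \<mu>)" by blast
    also have "norm \<dots> \<le> norm (cis (\<mu> * T) / (\<i> * \<mu>)) + norm (cis (\<mu> * (-T)) / (\<i> * \<mu>))" by (rule norm_triangle_ineq4)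
    also have "\<dots> = 2 / \<bar>\<mu>\<bar>" by (simp add: norm_divide norm_mult)
    finally show ?thesis using that assms by (simp add: norm_mult norm_divide field_simps)
  qed
  then show "\<forall>\<^sub>F T in at_top. norm (1 / (2 * complex_of_real T) * integral {-T..T} (\<lambda>t. cis (\<mu> * t))) \<le> (1 / \<bar>\<mu>\<bar>) / T"
    by (rule eventually_mono[OF eventually_gt_at_top[of "0::real"]])
  show "((\<lambda>T. (1 / \<bar>\<mu>\<bar>) / T) \<longlongrightarrow> 0) at_top"
    by real_asymp
qed

section \<open>Uniqueness of Fourier coefficients\<close>

lemma norm_cis_minus_one_le: "norm (cis x - 1) \<le> \<bar>x\<bar>"
proof -
  have "norm (cis x - 1) = 2 * \<bar>sin (x / 2)\<bar>"
    using dist_exp_i_1[of x] by (simp add: cis_conv_exp)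
  also have "\<dots> \<le> \<bar>x\<bar>" using abs_sin_x_le_abs_x[of "x/2"] by simp
  finally show ?thesis .
qed

lemma norm_cis_diff_le: "norm (cis x - cis y) \<le> \<bar>x - y\<bar>"
proof -
  have "cis x - cis y = cis y * (cis (x - y) - 1)" by (simp add: ring_distribs cis_mult)
  then show ?thesis using norm_cis_minus_one_le[of "x - y"] by (simp add: norm_mult)
qed

lemma continuous_mult_cis:
  fixes h :: "real \<Rightarrow> complex"
  assumes "continuous_on UNIV h"
  shows "continuous_on UNIV (\<lambda>t. h t * cis (- (\<mu> * t)))"
  by (intro continuous_intros assms)

text \<open>The mean at \<mu> controls windows of one fixed length \<open>S\<close>. A small change
  of the frequency hardly alters the integrand on so short a window, once the phase at its left end
  is factored out. Long windows are cut into pieces of length \<open>S\<close>, so \<delta> does not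
  depend on their length.\<close>

lemma integral_cis_near:
  assumes "ap_fun h" "\<epsilon> > 0" and zero: "has_mean (\<lambda>t. h t * cis (- (\<mu> * t))) 0"
  obtains \<delta> T1 where "\<delta> > 0"
    "\<And>T x \<nu>. T \<ge> T1 \<Longrightarrow> \<bar>\<nu> - \<mu>\<bar> < \<delta> \<Longrightarrow> norm (integral {x..x + T} (\<lambda>t. h t * cis (- (\<nu> * t)))) \<le> \<epsilon> * T"
proof -
  note cont = ap_fun_continuous[OF assms(1), of UNIV]
  obtain B where B: "B > 0" "\<And>t. norm (h t) \<le> B" using ap_fun_bounded[OF assms(1)] by blast
  define g where "g \<nu> t = h t * cis (- (\<nu> * t))" for \<nu> t
  have gcont: "continuous_on UNIV (g \<nu>)" for \<nu>
    unfolding g_def using cont by (rule continuous_mult_cis)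
  have gB: "norm (g \<nu> t) \<le> B" for \<nu> t using B(2) by (simp add: g_def norm_mult)
  have "ap_fun (g \<mu>)" unfolding g_def using ap_fun_mult[OF assms(1) ap_fun_cis[of "-\<mu>"]] by simp
  then obtain c where c: "has_mean (g \<mu>) c"
    "\<And>\<epsilon>. \<epsilon> > 0 \<Longrightarrow> \<exists>K. \<forall>x. \<forall>T\<ge>0. norm (integral {x..x + T} (g \<mu>) - of_real T * c) \<le> \<epsilon> * T + K"
    using ap_fun_uniform_mean by blast
  have "c = 0" using c(1) zero has_mean_unique unfolding g_def by blast
  have "\<epsilon>/4 > 0" using assms by simp
  from c(2)[OF this] obtain K
    where "\<forall>x. \<forall>T\<ge>0. norm (integral {x..x + T} (g \<mu>) - of_real T * c) \<le> \<epsilon>/4 * T + K" by blast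
  then have K: "norm (integral {x..x + T} (g \<mu>)) \<le> \<epsilon>/4 * T + K" if "T \<ge> 0" for x T
    using that unfolding \<open>c = 0\<close> by simp
  \<comment> \<open>\<open>S\<close> is long enough to absorb \<open>K\<close> into \<epsilon>/4 per
    unit length. Then \<delta> is chosen with \<open>B * \<delta> * S = \<epsilon>/4\<close>, so
    that a window of length \<open>S\<close> costs at most 3/4 of the allowance.\<close>
  define S where "S = max 1 (4 * K / \<epsilon>)"
  have S: "S \<ge> 1" "K \<le> \<epsilon>/4 * S" using assms(2) by (auto simp: S_def max_def field_simps)
  define \<delta> where "\<delta> = \<epsilon> / (4 * B * S)"
  have \<delta>: "\<delta> > 0" unfolding \<delta>_def using assms B S by auto
  have step: "norm (integral {x..x + S} (g \<nu>)) \<le> 3/4 * \<epsilon> * S" if "\<bar>\<nu> - \<mu>\<bar> < \<delta>" for x \<nu>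
  proof -
    have "integral {x..x + S} (g \<nu>) = integral {x..x + S} (\<lambda>t. cis (- ((\<nu> - \<mu>) * x)) * (g \<mu> t * cis (- ((\<nu> - \<mu>) * (t - x)))))"
      by (rule integral_cong) (simp add: g_def cis_mult algebra_simps)
    also have "\<dots> = cis (- ((\<nu> - \<mu>) * x)) * integral {x..x + S} (\<lambda>t. g \<mu> t * cis (- ((\<nu> - \<mu>) * (t - x))))"
      by simp
    finally have 1: "norm (integral {x..x + S} (g \<nu>)) = norm (integral {x..x + S} (\<lambda>t. g \<mu> t * cis (- ((\<nu> - \<mu>) * (t - x)))))"
      by (simp add: norm_mult)
    have c3: "continuous_on UNIV (\<lambda>t. g \<mu> t * cis (- ((\<nu> - \<mu>) * (t - x))))"
      by (intro continuous_intros gcont)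
    have "integral {x..x + S} (\<lambda>t. g \<mu> t * cis (- ((\<nu> - \<mu>) * (t - x)))) - integral {x..x + S} (g \<mu>)
       = integral {x..x + S} (\<lambda>t. g \<mu> t * cis (- ((\<nu> - \<mu>) * (t - x))) - g \<mu> t)"
      using integral_diff[OF continuous_integrable_real[OF c3] continuous_integrable_real[OF gcont]] by metis
    also have "norm \<dots> \<le> (B * (\<delta> * S)) * (x + S - x)"
    proof (rule norm_integral_Icc_le)
      show "continuous_on UNIV (\<lambda>t. g \<mu> t * cis (- ((\<nu> - \<mu>) * (t - x))) - g \<mu> t)"
        by (intro continuous_on_diff c3 gcont)
      fix t assume t: "t \<in> {x..x + S}"
      have "norm (g \<mu> t * cis (- ((\<nu> - \<mu>) * (t - x))) - g \<mu> t) = norm (g \<mu> t) * norm (cis (- ((\<nu> - \<mu>) * (t - x))) - 1)"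
        by (simp add: right_diff_distrib flip: norm_mult)
      also have "\<dots> \<le> B * \<bar>- ((\<nu> - \<mu>) * (t - x))\<bar>"
        by (intro mult_mono gB norm_cis_minus_one_le) (use B in auto)
      also have "\<dots> \<le> B * (\<delta> * S)"
        unfolding abs_minus abs_mult by (intro mult_mono) (use B that t \<delta> in auto)
      finally show "norm (g \<mu> t * cis (- ((\<nu> - \<mu>) * (t - x))) - g \<mu> t) \<le> B * (\<delta> * S)" .
    qed (use S in auto)
    also have "\<dots> = \<epsilon>/4 * S" using B S by (simp add: \<delta>_def field_simps)
    finally have 2: "norm (integral {x..x + S} (\<lambda>t. g \<mu> t * cis (- ((\<nu> - \<mu>) * (t - x)))) - integral {x..x + S} (g \<mu>)) \<le> \<epsilon>/4 * S" .
    have "norm (integral {x..x + S} (g \<mu>)) \<le> \<epsilon>/4 * S + \<epsilon>/4 * S" using K[of S x] S by linarith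
    with 2 have "norm (integral {x..x + S} (\<lambda>t. g \<mu> t * cis (- ((\<nu> - \<mu>) * (t - x))))) \<le> 3/4 * \<epsilon> * S"
      using norm_triangle_sub[of "integral {x..x + S} (\<lambda>t. g \<mu> t * cis (- ((\<nu> - \<mu>) * (t - x))))" "integral {x..x + S} (g \<mu>)"] by linarith
    then show ?thesis using 1 by simp
  qed
  show ?thesis
  \<comment> \<open>From this length on, the remaining quarter of the allowance pays for the last,
    incomplete piece.\<close>
  proof (rule that[of \<delta> "max 0 (4 * B * S / \<epsilon>)"])
    fix T x \<nu> assume T: "max 0 (4 * B * S / \<epsilon>) \<le> T" and \<nu>: "\<bar>\<nu> - \<mu>\<bar> < \<delta>"
    then have T': "T \<ge> 0" "B * S \<le> \<epsilon>/4 * T" using assms(2) by (auto simp: field_simps)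
    define n where "n = nat \<lfloor>T / S\<rfloor>"
    have "real n \<le> T / S" "T / S \<le> real n + 1" using T' S by (auto simp: n_def)
    then have n: "real n * S \<le> T" "T \<le> real n * S + S" using S by (auto simp: field_simps)
    have "integral {x..x + T} (g \<nu>) = integral {x..x + real n * S} (g \<nu>) + integral {x + real n * S..x + T} (g \<nu>)"
      by (rule integral_Icc_split[OF gcont]) (use n S in auto)
    also have "norm \<dots> \<le> norm (integral {x..x + real n * S} (g \<nu>)) + norm (integral {x + real n * S..x + T} (g \<nu>))"
      by (rule norm_triangle_ineq)
    also have "norm (integral {x..x + real n * S} (g \<nu>)) \<le> (\<Sum>j<n. 3/4 * \<epsilon> * S)"
      unfolding integral_multiple[OF gcont order_trans[OF zero_le_one S(1)]]
      by (intro sum_norm_le step \<nu>)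
    also have "(\<Sum>j<n. 3/4 * \<epsilon> * S) = 3/4 * \<epsilon> * (n * S)" by simp
    also have "\<dots> \<le> 3/4 * \<epsilon> * T" using n assms(2) by (intro mult_left_mono) auto
    also have "norm (integral {x + real n * S..x + T} (g \<nu>)) \<le> B * (x + T - (x + real n * S))"
      by (rule norm_integral_Icc_le[OF gcont]) (use n gB in auto)
    also have "\<dots> \<le> B * S" using B n by (intro mult_left_mono) auto
    finally show "norm (integral {x..x + T} (\<lambda>t. h t * cis (- (\<nu> * t)))) \<le> \<epsilon> * T"
      using T'(2) unfolding g_def by simp
  qed (rule \<delta>)
qed

text \<open>Compactness of the frequency range: finitely many of the neighbourhoods from
  \<open>integral_cis_near\<close> cover it, and the sum of their thresholds dominates each
  one.\<close>

lemma integral_cis_uniform: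
  assumes "ap_fun h" "\<epsilon> > 0" and zero: "\<And>\<mu>. has_mean (\<lambda>t. h t * cis (- (\<mu> * t))) 0"
  obtains T1 where
    "\<And>T x \<mu>. T \<ge> T1 \<Longrightarrow> \<bar>\<mu>\<bar> \<le> R \<Longrightarrow> norm (integral {x..x + T} (\<lambda>t. h t * cis (- (\<mu> * t)))) \<le> \<epsilon> * T"
proof -
  have "\<exists>\<delta> T1. \<delta> > 0 \<and> (\<forall>T x \<nu>. T \<ge> T1 \<longrightarrow> \<bar>\<nu> - \<mu>\<bar> < \<delta> \<longrightarrow> norm (integral {x..x + T} (\<lambda>t. h t * cis (- (\<nu> * t)))) \<le> \<epsilon> * T)" for \<mu>
    using integral_cis_near[OF assms(1,2) zero[of \<mu>]] by metis
  then obtain \<delta> T1 where \<delta>: "\<And>\<mu>. \<delta> \<mu> > 0"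
    "\<And>\<mu> T x \<nu>. T \<ge> T1 \<mu> \<Longrightarrow> \<bar>\<nu> - \<mu>\<bar> < \<delta> \<mu> \<Longrightarrow> norm (integral {x..x + T} (\<lambda>t. h t * cis (- (\<nu> * t)))) \<le> \<epsilon> * T"
    by metis
  have "compact {-R..R}" by simp
  moreover have "{-R..R} \<subseteq> (\<Union>\<mu>\<in>UNIV. ball \<mu> (\<delta> \<mu>))" using \<delta>(1) centre_in_ball by blast
  ultimately obtain C where C: "finite C" "{-R..R} \<subseteq> (\<Union>\<mu>\<in>C. ball \<mu> (\<delta> \<mu>))"
    by (metis compactE_image open_ball)
  show ?thesis
  proof (rule that[of "\<Sum>\<mu>\<in>C. \<bar>T1 \<mu>\<bar>"])
    fix T x \<nu> assume T: "(\<Sum>\<mu>\<in>C. \<bar>T1 \<mu>\<bar>) \<le> T" and \<nu>: "\<bar>\<nu>\<bar> \<le> R"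
    have "\<nu> \<in> {-R..R}" using \<nu> by auto
    then obtain \<mu> where \<mu>: "\<mu> \<in> C" "\<bar>\<nu> - \<mu>\<bar> < \<delta> \<mu>" using C(2) by (force simp: dist_real_def abs_minus_commute)
    have "\<bar>T1 \<mu>\<bar> \<le> (\<Sum>\<mu>\<in>C. \<bar>T1 \<mu>\<bar>)" using C(1) \<mu>(1) by (intro member_le_sum) auto
    then show "norm (integral {x..x + T} (\<lambda>t. h t * cis (- (\<nu> * t)))) \<le> \<epsilon> * T"
      using T \<mu>(2) by (intro \<delta>(2)[of \<mu>]) auto
  qed
qed

text \<open>For \<open>z = cis (- \<nu>)\<close> with \<open>\<nu>\<close> small the sum is a Riemann sum of an integral that is small
  uniformly in the frequency; for other \<open>z\<close> summation by parts suffices, because \<open>h\<close> varies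
  little over one step.\<close>

lemma ap_fun_discrete_sums:
  fixes \<epsilon> :: real
  assumes "ap_fun h" "\<epsilon> > 0" and zero: "\<And>\<mu>. has_mean (\<lambda>t. h t * cis (- (\<mu> * t))) 0"
  obtains d n0 where "d > 0"
    "\<And>n x z. n \<ge> n0 \<Longrightarrow> norm z = 1 \<Longrightarrow> norm (\<Sum>j<n. h (x + real j * d) * z ^ j) \<le> \<epsilon> * n"
proof -
  note cont = ap_fun_continuous[OF assms(1), of UNIV]
  obtain B where B: "B > 0" "\<And>t. norm (h t) \<le> B" using ap_fun_bounded[OF assms(1)] by blast
  \<comment> \<open>\<kappa> separates the two cases. Up to \<kappa> the phase turns so little over
    one step that the Riemann sum loses at most \<epsilon>/4 by it; beyond \<kappa> the chord
    \<open>norm (z - 1)\<close> is at least \<open>q\<close>. The cap at \<open>pi\<close> keeps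
    \<open>sin (\<kappa> / 2)\<close> positive.\<close>
  define \<kappa> where "\<kappa> = min pi (\<epsilon> / (4 * B))"
  have \<kappa>: "\<kappa> > 0" "\<kappa> \<le> pi" "B * \<kappa> \<le> \<epsilon>/4" using B assms(2) by (auto simp: \<kappa>_def min_def field_simps)
  define q where "q = 2 * sin (\<kappa> / 2)"
  have q: "q > 0" unfolding q_def using \<kappa> by (simp add: sin_gt_zero)
  \<comment> \<open>The variation of \<open>h\<close> over one step: the first bound serves the
    Riemann sums, the second the summation by parts, where one divides by \<open>q\<close>.\<close>
  define \<omega> where "\<omega> = min (\<epsilon>/4) (\<epsilon> * q / 2)"
  have \<omega>: "\<omega> > 0" "\<omega> \<le> \<epsilon>/4" "\<omega> \<le> \<epsilon> * q / 2" using assms(2) q by (auto simp: \<omega>_def)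
  obtain \<delta> where \<delta>: "\<delta> > 0" "\<And>x y. \<bar>x - y\<bar> < \<delta> \<Longrightarrow> norm (h x - h y) \<le> \<omega>"
    using ap_fun_uniformly_continuous[OF assms(1) \<omega>(1)] by blast
  define d where "d = \<delta>/2"
  have d: "d > 0" "\<And>x y. \<bar>x - y\<bar> \<le> d \<Longrightarrow> norm (h x - h y) \<le> \<omega>"
    using \<delta> by (auto simp: d_def)
  have "\<epsilon>/4 > 0" using assms(2) by simp
  from integral_cis_uniform[OF assms(1) this zero] obtain T1 where
    T1: "\<And>T x \<mu>. T \<ge> T1 \<Longrightarrow> \<bar>\<mu>\<bar> \<le> \<kappa>/d \<Longrightarrow> norm (integral {x..x + T} (\<lambda>t. h t * cis (- (\<mu> * t)))) \<le> \<epsilon>/4 * T"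
    by metis
  \<comment> \<open>The first entry makes the window \<open>n * d\<close> long enough for
    \<open>T1\<close>; the second makes the boundary terms of the summation by parts at most half of
    \<open>\<epsilon> * q * n\<close>.\<close>
  define n0 where "n0 = nat \<lceil>max (T1 / d) (4 * B / (\<epsilon> * q))\<rceil>"
  show ?thesis
  proof (rule that[OF d(1), of n0])
    fix n x and z :: complex assume "n \<ge> n0" and z: "norm z = 1"
    then have "real n \<ge> max (T1 / d) (4 * B / (\<epsilon> * q))" unfolding n0_def by linarith
    then have n: "real n * d \<ge> T1" "2 * B \<le> (\<epsilon> * q / 2) * n"
      using d q assms(2) by (auto simp: field_simps)
    define \<nu> where "\<nu> = - Arg z"
    have zc: "z = cis (- \<nu>)" using rcis_cmod_Arg[of z] z by (simp add: \<nu>_def rcis_def)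
    have \<nu>: "\<bar>\<nu>\<bar> \<le> pi" using Arg_bounded[of z] by (auto simp: \<nu>_def)
    define y where "y j = h (x + real j * d)" for j
    have yB: "norm (y j) \<le> B" for j by (simp add: y_def B)
    have y\<omega>: "norm (y (Suc j) - y j) \<le> \<omega>" for j
      unfolding y_def by (rule d(2)) (use d(1) in \<open>auto simp: algebra_simps\<close>)
    have "norm (\<Sum>j<n. y j * z ^ j) \<le> \<epsilon> * n"
    proof (cases "\<bar>\<nu>\<bar> \<le> \<kappa>")
      case False
      have "norm (z - 1) = 2 * \<bar>sin (- \<nu> / 2)\<bar>"
        unfolding zc using dist_exp_i_1[of "-\<nu>"] by (simp add: cis_conv_exp)
      also have "\<bar>sin (- \<nu> / 2)\<bar> = sin (\<bar>\<nu>\<bar> / 2)"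
        using \<nu> sin_ge_zero[of "\<bar>\<nu>\<bar> / 2"] by (cases "\<nu> \<ge> 0") auto
      finally have "norm (z - 1) = 2 * sin (\<bar>\<nu>\<bar> / 2)" .
      moreover have "sin (\<kappa> / 2) \<le> sin (\<bar>\<nu>\<bar> / 2)"
        using \<nu> False \<kappa> by (intro sin_monotone_2pi_le) auto
      ultimately have qz: "norm (z - 1) \<ge> q" by (simp add: q_def)
      have eq: "a + b = c \<Longrightarrow> b = c - a" for a b c :: complex by auto
      have 1: "(\<Sum>j<n. y (Suc j) * z ^ Suc j - y j * z ^ j) = y n * z ^ n - y 0"
        by (subst sum_lessThan_telescope) simp
      have 2: "(\<Sum>j<n. y (Suc j) * z ^ Suc j - y j * z ^ j) =
          (\<Sum>j<n. (y (Suc j) - y j) * z ^ Suc j) + (z - 1) * (\<Sum>j<n. y j * z ^ j)"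
        by (simp add: sum_distrib_left flip: sum.distrib) (simp add: algebra_simps)
      have "(z - 1) * (\<Sum>j<n. y j * z ^ j) = (y n * z ^ n - y 0) - (\<Sum>j<n. (y (Suc j) - y j) * z ^ Suc j)"
        by (rule eq) (rule trans[OF 2[symmetric] 1])
      then have "norm ((z - 1) * (\<Sum>j<n. y j * z ^ j)) \<le> (norm (y n * z ^ n) + norm (y 0)) + norm (\<Sum>j<n. (y (Suc j) - y j) * z ^ Suc j)"
        by (simp only:) (intro order_trans[OF norm_triangle_ineq4 add_right_mono] norm_triangle_ineq4)
      also have "\<dots> \<le> (B + B) + (\<Sum>j<n. \<omega>)"
        by (intro add_mono sum_norm_le) (use yB y\<omega> z in \<open>auto simp: norm_mult norm_power\<close>)
      also have "\<dots> \<le> \<epsilon> * q * n"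
        using n(2) mult_right_mono[OF \<omega>(3), of "real n"] by (simp add: algebra_simps)
      finally have "norm (z - 1) * norm (\<Sum>j<n. y j * z ^ j) \<le> \<epsilon> * q * n" by (simp add: norm_mult)
      moreover have "q * norm (\<Sum>j<n. y j * z ^ j) \<le> norm (z - 1) * norm (\<Sum>j<n. y j * z ^ j)"
        using qz by (intro mult_right_mono) auto
      ultimately have "q * norm (\<Sum>j<n. y j * z ^ j) \<le> q * (\<epsilon> * n)" by (simp add: mult_ac)
      then show ?thesis using q by simp
    next
      case True
      \<comment> \<open>\<open>G\<close> interpolates the summands: at \<open>u = x + j * d\<close>
        its value is \<open>y j * z ^ j\<close>. Its frequency \<open>\<nu> / d\<close> is at most
        \<open>\<kappa> / d\<close>, the range covered by \<open>T1\<close>.\<close>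
      define G where "G u = h u * cis (- (\<nu> / d * (u - x)))" for u
      have G: "continuous_on UNIV G" unfolding G_def by (intro continuous_intros cont)
      have "integral {x..x + real n * d} G = integral {x..x + real n * d} (\<lambda>u. cis (\<nu> / d * x) * (h u * cis (- (\<nu> / d * u))))"
        by (rule integral_cong) (simp add: G_def cis_mult algebra_simps diff_divide_distrib)
      also have "norm \<dots> = norm (integral {x..x + real n * d} (\<lambda>u. h u * cis (- (\<nu> / d * u))))"
        by (simp add: norm_mult)
      also have "\<dots> \<le> \<epsilon>/4 * (n * d)"
        by (rule T1[OF n(1)]) (use True d in \<open>simp add: divide_right_mono\<close>)
      finally have 1: "norm (integral {x..x + real n * d} G) \<le> \<epsilon>/4 * (n * d)" .
      have cell: "norm (integral {x + real j * d..x + real j * d + d} G - of_real d * (y j * z ^ j)) \<le> (\<epsilon>/2) * d" for j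
      proof -
        have zj: "z ^ j = cis (- (\<nu> * j))" unfolding zc by (simp add: Complex.DeMoivre mult.commute)
        have "integral {x + real j * d..x + real j * d + d} G - of_real d * (y j * z ^ j)
           = integral {x + real j * d..x + real j * d + d} (\<lambda>u. G u - y j * z ^ j)"
          using d(1) by (subst integral_diff) (auto intro: continuous_integrable_real[OF G] simp: scaleR_conv_of_real)
        also have "norm \<dots> \<le> (\<epsilon>/2) * (x + real j * d + d - (x + real j * d))"
        proof (rule norm_integral_Icc_le)
          fix u assume u: "u \<in> {x + real j * d..x + real j * d + d}"
          have "G u - y j * z ^ j = (h u - y j) * cis (- (\<nu> / d * (u - x))) + y j * (cis (- (\<nu> / d * (u - x))) - cis (- (\<nu> * j)))"
            unfolding zj G_def by (simp add: algebra_simps)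
          also have "norm \<dots> \<le> norm (h u - y j) + norm (y j) * norm (cis (- (\<nu> / d * (u - x))) - cis (- (\<nu> * j)))"
            by (rule order_trans[OF norm_triangle_ineq]) (simp add: norm_mult)
          also have "\<dots> \<le> \<omega> + B * \<bar>- (\<nu> / d * (u - x)) - (- (\<nu> * j))\<bar>"
            by (intro add_mono mult_mono norm_cis_diff_le yB) (use u B d(1) in \<open>auto simp: y_def intro!: d(2)\<close>)
          also have "- (\<nu> / d * (u - x)) - (- (\<nu> * j)) = - (\<nu> * ((u - x - j * d) / d))"
            using d(1) by (simp add: field_simps)
          also have "\<bar>\<dots>\<bar> \<le> \<kappa> * 1"
            unfolding abs_minus abs_mult using u d(1) True \<kappa> by (intro mult_mono) auto
          also have "\<omega> + B * (\<kappa> * 1) \<le> \<epsilon>/2" using \<omega>(2) \<kappa>(3) by simp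
          finally show "norm (G u - y j * z ^ j) \<le> \<epsilon>/2" using B by simp
        qed (use d(1) in \<open>auto intro!: continuous_intros G\<close>)
        finally show ?thesis by simp
      qed
      have "of_real d * (\<Sum>j<n. y j * z ^ j) = integral {x..x + real n * d} G - (\<Sum>j<n. integral {x + real j * d..x + real j * d + d} G - of_real d * (y j * z ^ j))"
        using d(1) by (simp add: integral_multiple[OF G] sum_subtractf sum_distrib_left)
      then have "norm (of_real d * (\<Sum>j<n. y j * z ^ j)) \<le> norm (integral {x..x + real n * d} G) + norm (\<Sum>j<n. integral {x + real j * d..x + real j * d + d} G - of_real d * (y j * z ^ j))"
        by (simp only: norm_triangle_ineq4)
      also have "\<dots> \<le> \<epsilon>/4 * (n * d) + (\<Sum>j<n. (\<epsilon>/2) * d)"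
        by (intro add_mono 1 sum_norm_le cell)
      also have "\<dots> \<le> d * (\<epsilon> * n)" using d(1) assms(2) by simp
      finally have "d * norm (\<Sum>j<n. y j * z ^ j) \<le> d * (\<epsilon> * n)" using d(1) by (simp add: norm_mult)
      then show ?thesis using d(1) by simp
    qed
    then show "norm (\<Sum>j<n. h (x + real j * d) * z ^ j) \<le> \<epsilon> * n" by (simp add: y_def)
  qed
qed

section \<open>Quadratic forms in differences and the discrete Fourier transform\<close>

lemma roots_of_unity_orthogonal:
  fixes M i k :: nat
  assumes "i < M" "k < M"
  defines "w \<equiv> cis (2 * pi / M)"
  shows "(\<Sum>m<M. w ^ (m * i) * cnj (w ^ (m * k))) = (if i = k then of_nat M else 0)"
proof -
  define u where "u = w ^ i * cnj (w ^ k)"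
  have wM: "w ^ M = 1" unfolding w_def using assms by (simp add: Complex.DeMoivre)
  have cw: "w * cnj w = 1" by (simp add: w_def cis_cnj cis_mult)
  have "u ^ M = (w ^ M) ^ i * cnj ((w ^ M) ^ k)"
    unfolding u_def by (simp add: power_mult_distrib mult.commute flip: power_mult)
  then have uM: "u ^ M = 1" by (simp add: wM)
  have eq: "(\<Sum>m<M. w ^ (m * i) * cnj (w ^ (m * k))) = (\<Sum>m<M. u ^ m)"
    unfolding u_def by (intro sum.cong) (simp_all add: power_mult_distrib mult.commute flip: power_mult)
  show ?thesis
  proof (cases "i = k")
    case True
    then have "u = 1" unfolding u_def complex_cnj_power using cw by (metis power_mult_distrib power_one)
    then show ?thesis using eq True by simp
  next
    case False
    have "u \<noteq> 1"
    proof
      assume "u = 1"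
      then have "w ^ i * (cnj w * w) ^ k = w ^ k" by (simp add: u_def power_mult_distrib mult.assoc[symmetric])
      then have "w ^ i = w ^ k" using cw by (simp add: mult.commute)
      then have "exp (2 * of_real pi * \<i> * of_nat i / of_nat M) = exp (2 * of_real pi * \<i> * of_nat k / of_nat M)"
        unfolding w_def by (simp add: cis_conv_exp mult_ac flip: exp_of_nat_mult)
      then show False using complex_root_unity_eq[of M i k] assms False by simp
    qed
    then have "(\<Sum>m<M. u ^ m) = 0" using geometric_sum[of u M] uM by simp
    then show ?thesis using eq False by simp
  qed
qed

text \<open>A discrete Fourier transform of length \<open>2 * N\<close> diagonalises the quadratic form.\<close>

lemma sum_differences_bound:
  fixes x :: "int \<Rightarrow> complex" and \<eta> :: real
  assumes N: "N > 0" and E: "E \<subseteq> {..<N}"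
    and bound: "\<And>z. norm z = 1 \<Longrightarrow> norm (\<Sum>j<2*N. x (int j - int N) * z ^ j) \<le> \<eta> * (2 * real N)"
  shows "norm (\<Sum>i\<in>E. \<Sum>k\<in>E. x (int i - int k)) \<le> 2 * real N * \<eta> * card E"
proof -
  \<comment> \<open>The differences of indices lie strictly between -N and N. Shifted by
    \<open>N\<close> they fall below \<open>M\<close>, so the cyclic transform of length
    \<open>M\<close> meets no wraparound.\<close>
  define M where "M = 2 * N"
  define w where "w = cis (2 * pi / M)"
  have fin: "finite E" using E finite_subset by blast
  have M: "M > 0" using N by (simp add: M_def)
  note orth = roots_of_unity_orthogonal[of _ M, folded w_def]
  define X where "X m = (\<Sum>j<M. x (int j - int N) * cnj (w ^ (m * j)))" for m
  have Xb: "norm (X m) \<le> \<eta> * M" for m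
    using bound[of "cnj (w ^ m)"] by (simp add: X_def M_def w_def norm_power power_mult)
  define e where "e m = (\<Sum>i\<in>E. w ^ (m * i))" for m
  have inv: "(\<Sum>m<M. X m * w ^ (m * p)) = M * x (int p - int N)" if "p < M" for p
  proof -
    have "(\<Sum>m<M. X m * w ^ (m * p)) = (\<Sum>m<M. \<Sum>j<M. x (int j - int N) * (w ^ (m * p) * cnj (w ^ (m * j))))"
      by (simp add: X_def sum_distrib_left mult_ac)
    also have "\<dots> = (\<Sum>j<M. x (int j - int N) * (\<Sum>m<M. w ^ (m * p) * cnj (w ^ (m * j))))"
      by (subst sum.swap) (simp add: sum_distrib_left)
    also have "\<dots> = (\<Sum>j<M. x (int j - int N) * (if p = j then of_nat M else 0))"
      using orth[OF that] by (intro sum.cong) auto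
    also have "\<dots> = M * x (int p - int N)" using that by (simp add: if_distrib[of "(*) _"] cong: if_cong)
    finally show ?thesis .
  qed
  have cw: "w ^ a * cnj (w ^ a) = 1" for a
    by (simp add: w_def cis_cnj Complex.DeMoivre cis_mult)
  have inv2: "M * x (int i - int k) = (\<Sum>m<M. X m * w ^ (m * N) * (w ^ (m * i) * cnj (w ^ (m * k))))"
    if "i \<in> E" "k \<in> E" for i k
  proof -
    have lt: "i < N" "k < N" using that E by auto
    have "w ^ (m * (i + N - k)) = w ^ (m * N) * (w ^ (m * i) * cnj (w ^ (m * k)))" for m
    proof -
      have "m * (i + N - k) + m * k = m * ((i + N - k) + k)" by (simp only: distrib_left)
      also have "\<dots> = m * N + m * i" using lt by (simp add: distrib_left)
      finally have "m * (i + N - k) + m * k = m * N + m * i" .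
      then have "w ^ (m * (i + N - k)) * w ^ (m * k) = w ^ (m * N) * w ^ (m * i)" by (metis power_add)
      then have "w ^ (m * (i + N - k)) * (w ^ (m * k) * cnj (w ^ (m * k))) = w ^ (m * N) * (w ^ (m * i) * cnj (w ^ (m * k)))"
        by (metis (no_types) mult.assoc)
      then show ?thesis by (simp only: cw mult_1_right)
    qed
    moreover have "int (i + N - k) - int N = int i - int k" using lt by auto
    moreover have "i + N - k < M" using lt by (auto simp: M_def)
    ultimately show ?thesis using inv[of "i + N - k"] by (simp add: mult.assoc)
  qed
  have norm_w: "norm w = 1" by (simp add: w_def)
  have ee: "e m * cnj (e m) = (\<Sum>i\<in>E. \<Sum>k\<in>E. w ^ (m * i) * cnj (w ^ (m * k)))" for m
    by (simp only: e_def cnj_sum sum_product)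
  \<comment> \<open>For each m the double sum factors into \<open>e m * cnj (e m)\<close>, a
    nonnegative weight, so a bound for all \<open>X m\<close> is enough.\<close>
  have "M * (\<Sum>i\<in>E. \<Sum>k\<in>E. x (int i - int k)) = (\<Sum>i\<in>E. \<Sum>k\<in>E. \<Sum>m<M. X m * w ^ (m * N) * (w ^ (m * i) * cnj (w ^ (m * k))))"
    by (simp add: sum_distrib_left inv2)
  also have "\<dots> = (\<Sum>m<M. X m * w ^ (m * N) * (e m * cnj (e m)))"
    by (simp only: sum.swap[of _ "{..<M}"] ee sum_distrib_left)
  finally have eq: "M * (\<Sum>i\<in>E. \<Sum>k\<in>E. x (int i - int k)) = (\<Sum>m<M. X m * w ^ (m * N) * (e m * cnj (e m)))" .
  have "real M * norm (\<Sum>i\<in>E. \<Sum>k\<in>E. x (int i - int k)) = norm (\<Sum>m<M. X m * w ^ (m * N) * (e m * cnj (e m)))"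
    unfolding eq[symmetric] by (simp only: norm_mult norm_of_nat)
  also have "\<dots> \<le> (\<Sum>m<M. \<eta> * M * (norm (e m))\<^sup>2)"
  proof (intro sum_norm_le)
    fix m
    have "norm (X m * w ^ (m * N) * (e m * cnj (e m))) = norm (X m) * (norm (e m))\<^sup>2"
      by (simp add: norm_mult norm_power norm_w power2_eq_square)
    then show "norm (X m * w ^ (m * N) * (e m * cnj (e m))) \<le> \<eta> * M * (norm (e m))\<^sup>2"
      using Xb[of m] by (simp add: mult_right_mono)
  qed
  also have "\<dots> = \<eta> * M * (\<Sum>m<M. (norm (e m))\<^sup>2)" by (simp add: sum_distrib_left)
  \<comment> \<open>Parseval's identity for the indicator function of \<open>E\<close>.\<close>
  also have "(\<Sum>m<M. (norm (e m))\<^sup>2) = M * card E"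
  proof -
    have "complex_of_real (\<Sum>m<M. (norm (e m))\<^sup>2) = (\<Sum>m<M. \<Sum>i\<in>E. \<Sum>k\<in>E. w ^ (m * i) * cnj (w ^ (m * k)))"
      by (simp only: of_real_sum complex_norm_square ee)
    also have "\<dots> = (\<Sum>i\<in>E. \<Sum>k\<in>E. \<Sum>m<M. w ^ (m * i) * cnj (w ^ (m * k)))"
      by (simp only: sum.swap[of _ _ "{..<M}"])
    also have "\<dots> = (\<Sum>i\<in>E. \<Sum>k\<in>E. if i = k then of_nat M else 0)"
      using E by (intro sum.cong orth refl) (auto simp: M_def)
    also have "\<dots> = complex_of_real (M * card E)" using fin by simp
    finally show ?thesis using of_real_eq_iff by blast
  qed
  finally show ?thesis using M by (simp add: M_def mult_ac)
qed

theorem ap_fun_eq_zero: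
  assumes "ap_fun h" and zero: "\<And>\<mu>. has_mean (\<lambda>t. h t * cis (- (\<mu> * t))) 0"
  shows "h t = 0"
proof (rule ccontr)
  assume "h t \<noteq> 0"
  define e where "e = norm (h t)"
  have e: "e > 0" "e/2 > 0" using \<open>h t \<noteq> 0\<close> by (auto simp: e_def)
  obtain c :: "real \<Rightarrow> nat" where c: "finite (range c)"
    "\<And>x y s. c x = c y \<Longrightarrow> norm (h (s + x) - h (s + y)) \<le> e/2"
    using ap_funE[OF assms(1) e(2)] by blast
  define k where "k = card (range c)"
  have k: "k > 0" using c(1) by (auto simp: k_def card_gt_0_iff)
  \<comment> \<open>With \<open>N \<le> card E * k\<close>, the bound for the quadratic form becomes
    e/4 per pair. Since the values being averaged are within e/2 of \<open>h t\<close>, this would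
    give \<open>norm (h t) \<le> 3/4 * e\<close>, against the definition of
    \<open>e\<close>.\<close>
  have "e / (8 * real k) > 0" using e k by simp
  from ap_fun_discrete_sums[OF assms(1) this zero] obtain d n0 where d: "d > 0"
    "\<And>n x z. n \<ge> n0 \<Longrightarrow> norm z = 1 \<Longrightarrow> norm (\<Sum>j<n. h (x + real j * d) * z ^ j) \<le> e / (8 * real k) * n" by metis
  define N where "N = max n0 1"
  define c' where "c' i = c (real i * d)" for i :: nat
  have "\<exists>q\<in>range c. card {..<N} \<le> card (c' -` {q} \<inter> {..<N}) * card (range c)"
    by (rule pigeonhole_card) (use c(1) in \<open>auto simp: c'_def\<close>)
  then obtain q where q: "N \<le> card (c' -` {q} \<inter> {..<N}) * k" by (auto simp: k_def)
  define E where "E = c' -` {q} \<inter> {..<N}"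
  have E: "finite E" "E \<subseteq> {..<N}" "N \<le> card E * k" using q by (auto simp: E_def)
  have E0: "card E > 0" using E(3) by (cases "card E = 0") (auto simp: N_def)
  define x where "x j = h (t + of_int j * d)" for j :: int
  have "norm (\<Sum>i\<in>E. \<Sum>k\<in>E. x (int i - int k)) \<le> 2 * real N * (e / (8 * real k)) * card E"
  proof (rule sum_differences_bound[OF _ E(2)])
    fix z :: complex assume z: "norm z = 1"
    have "x (int j - int N) = h (t - real N * d + real j * d)" for j
      by (simp add: x_def algebra_simps)
    then show "norm (\<Sum>j<2 * N. x (int j - int N) * z ^ j) \<le> e / (8 * real k) * (2 * real N)"
      using d(2)[of "2 * N" z "t - real N * d"] z by (simp add: N_def)
  qed (simp add: N_def)
  also have "2 * real N * (e / (8 * real k)) * card E \<le> 2 * (real (card E) * real k) * (e / (8 * real k)) * card E"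
    using E(3) e by (intro mult_right_mono mult_left_mono) (auto simp flip: of_nat_mult)
  also have "\<dots> = (card E)\<^sup>2 * e / 4" using k by (simp add: power2_eq_square)
  finally have 1: "norm (\<Sum>i\<in>E. \<Sum>k\<in>E. x (int i - int k)) \<le> (card E)\<^sup>2 * e / 4" .
  have "norm (\<Sum>i\<in>E. \<Sum>k\<in>E. (x (int i - int k) - h t)) \<le> (\<Sum>i\<in>E. \<Sum>k\<in>E. e/2)"
  proof (intro sum_norm_le)
    fix i k assume "i \<in> E" "k \<in> E"
    \<comment> \<open>The class condition is used at the base point \<open>t - k * d\<close>:
      translating it by \<open>k * d\<close> gives t, and by \<open>i * d\<close> gives the point at
      which \<open>x (i - k)\<close> is taken.\<close>
    then have "c (real i * d) = c (real k * d)" by (auto simp: E_def c'_def)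
    from c(2)[OF this, of "t - real k * d"] show "norm (x (int i - int k) - h t) \<le> e/2"
      by (simp add: x_def algebra_simps)
  qed
  then have 2: "norm ((\<Sum>i\<in>E. \<Sum>k\<in>E. x (int i - int k)) - (card E)\<^sup>2 * h t) \<le> (card E)\<^sup>2 * e / 2"
    by (simp add: sum_subtractf power2_eq_square mult.assoc)
  have "norm ((card E)\<^sup>2 * h t) = (card E)\<^sup>2 * e" by (simp add: norm_mult e_def norm_power)
  moreover have "norm ((card E)\<^sup>2 * h t) \<le> norm (\<Sum>i\<in>E. \<Sum>k\<in>E. x (int i - int k)) + norm ((\<Sum>i\<in>E. \<Sum>k\<in>E. x (int i - int k)) - (card E)\<^sup>2 * h t)"
    by (metis norm_minus_commute norm_triangle_sub)
  ultimately have "(card E)\<^sup>2 * e \<le> (card E)\<^sup>2 * e / 4 + (card E)\<^sup>2 * e / 2" using 1 2 by linarith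
  moreover have "(card E)\<^sup>2 * e > 0" using E0 e by simp
  ultimately show False by linarith
qed

section \<open>Almost periodic functions in a strip\<close>

lemma open_vstrip: "open (vstrip \<alpha> \<beta>)"
proof -
  have "vstrip \<alpha> \<beta> = Re -` einterval \<alpha> \<beta>" by (auto simp: vstrip_def)
  then show ?thesis by (simp add: open_vimage continuous_on_Re)
qed

lemma convex_vstrip: "convex (vstrip \<alpha> \<beta>)"
proof -
  have "vstrip \<alpha> \<beta> = Re -` einterval \<alpha> \<beta>" by (auto simp: vstrip_def)
  moreover have "convex (einterval \<alpha> \<beta>)"
    by (auto simp: einterval_iff is_interval_1 simp flip: is_interval_convex_1)
       (meson ereal_less_eq(3) le_less_trans less_le_trans)+
  ultimately show ?thesis by (simp add: convex_linear_vimage bounded_linear.linear bounded_linear_Re)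
qed

lemma einterval_shrink:
  assumes "\<sigma> \<in> einterval \<alpha> \<beta>" "\<sigma>' \<in> einterval \<alpha> \<beta>"
  obtains a b where "\<alpha> < ereal a" "a < \<sigma>" "a < \<sigma>'" "\<sigma> < b" "\<sigma>' < b" "ereal b < \<beta>"
proof -
  have "\<alpha> < ereal (min \<sigma> \<sigma>')" using assms by (simp add: einterval_iff min_def)
  from ereal_dense2[OF this] obtain a where a: "\<alpha> < ereal a" "a < min \<sigma> \<sigma>'" by (metis less_ereal.simps(1))
  have "ereal (max \<sigma> \<sigma>') < \<beta>" using assms by (simp add: einterval_iff max_def)
  from ereal_dense2[OF this] obtain b where b: "max \<sigma> \<sigma>' < b" "ereal b < \<beta>" by (metis less_ereal.simps(1))
  show ?thesis by (rule that[of a b]) (use a b in simp_all)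
qed

lemma almost_periodic_in_translations:
  assumes "almost_periodic_in f \<alpha> \<beta>" "\<alpha> < ereal a" "a < b" "ereal b < \<beta>" "\<epsilon> > 0"
  shows "\<exists>l>0. \<forall>x::real. \<exists>\<tau>\<in>{x..x + l}.
    \<forall>s. a \<le> Re s \<and> Re s \<le> b \<longrightarrow> norm (f (s + \<i> * of_real \<tau>) - f s) \<le> \<epsilon>"
proof -
  note H = assms(1)[unfolded almost_periodic_in_def, THEN conjunct2]
  show ?thesis using H[rule_format, OF assms(2-5)] by simp
qed

lemma vstrip_substrip:
  assumes "\<alpha> < ereal a" "ereal b < \<beta>" "a \<le> Re s" "Re s \<le> b"
  shows "s \<in> vstrip \<alpha> \<beta>"
proof -
  have "\<alpha> < ereal (Re s)" using assms(1) by (rule less_le_trans) (simp add: assms(3))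
  moreover have "ereal (Re s) < \<beta>" using _ assms(2) by (rule le_less_trans) (simp add: assms(4))
  ultimately show ?thesis by (simp add: vstrip_def einterval_iff)
qed

text \<open>A translation number moves any point of the closed substrip into a rectangle of height
  \<open>l\<close>, where continuity and compactness give a bound.\<close>

lemma almost_periodic_in_bounded:
  assumes "almost_periodic_in f \<alpha> \<beta>" "\<alpha> < ereal a" "a < b" "ereal b < \<beta>"
  obtains B where "\<And>s. a \<le> Re s \<Longrightarrow> Re s \<le> b \<Longrightarrow> norm (f s) \<le> B"
proof -
  have hol: "f holomorphic_on vstrip \<alpha> \<beta>" using assms(1) by (simp add: almost_periodic_in_def)
  obtain l where l: "l > 0" "\<And>x::real. \<exists>\<tau>\<in>{x..x + l}. \<forall>s. a \<le> Re s \<and> Re s \<le> b \<longrightarrow> norm (f (s + \<i> * of_real \<tau>) - f s) \<le> 1"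
    using almost_periodic_in_translations[OF assms zero_less_one] by blast
  define Q where "Q = cbox (Complex a 0) (Complex b l)"
  have "Q \<subseteq> vstrip \<alpha> \<beta>"
  proof
    fix s assume "s \<in> Q"
    then have "a \<le> Re s" "Re s \<le> b" by (auto simp: Q_def in_cbox_complex_iff)
    then show "s \<in> vstrip \<alpha> \<beta>" by (rule vstrip_substrip[OF assms(2,4)])
  qed
  then have "continuous_on Q f"
    using hol holomorphic_on_imp_continuous_on continuous_on_subset by blast
  then have "compact (f ` Q)" unfolding Q_def by (intro compact_continuous_image) auto
  then obtain B where B: "\<And>s. s \<in> Q \<Longrightarrow> norm (f s) \<le> B"
    using compact_imp_bounded bounded_iff by (metis imageI)
  have "norm (f s) \<le> B + 1" if s: "a \<le> Re s" "Re s \<le> b" for s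
  proof -
    obtain \<tau> where \<tau>: "\<tau> \<in> {- Im s..- Im s + l}" "norm (f (s + \<i> * of_real \<tau>) - f s) \<le> 1"
      using l(2)[of "- Im s"] s by blast
    have "norm (f (s + \<i> * of_real \<tau>)) \<le> B"
      by (rule B) (use \<tau>(1) s in \<open>auto simp: Q_def in_cbox_complex_iff\<close>)
    then show ?thesis using \<tau>(2) norm_triangle_sub[of "f s" "f (s + \<i> * of_real \<tau>)"]
      by (simp add: norm_minus_commute)
  qed
  then show ?thesis using that by blast
qed

lemma almost_periodic_in_line:
  assumes "almost_periodic_in f \<alpha> \<beta>" "\<sigma> \<in> einterval \<alpha> \<beta>"
  shows "ap_fun (\<lambda>t. f (Complex \<sigma> t))"
proof (rule ap_fun_of_relatively_dense)
  have hol: "f holomorphic_on vstrip \<alpha> \<beta>" using assms(1) by (simp add: almost_periodic_in_def)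
  have "continuous_on UNIV (\<lambda>t. Complex \<sigma> t)"
    by (simp add: Complex_eq continuous_intros)
  then show "continuous_on UNIV (\<lambda>t. f (Complex \<sigma> t))"
    by (rule continuous_on_compose2[OF holomorphic_on_imp_continuous_on[OF hol]])
       (use assms(2) in \<open>auto simp: vstrip_def\<close>)
  obtain a b where ab: "\<alpha> < ereal a" "a < \<sigma>" "\<sigma> < b" "ereal b < \<beta>"
    using einterval_shrink[OF assms(2,2)] by metis
  fix \<epsilon> :: real assume "\<epsilon> > 0"
  then obtain l where l: "l > 0" "\<And>x::real. \<exists>\<tau>\<in>{x..x + l}. \<forall>s. a \<le> Re s \<and> Re s \<le> b \<longrightarrow> norm (f (s + \<i> * of_real \<tau>) - f s) \<le> \<epsilon>"
    using almost_periodic_in_translations[OF assms(1) ab(1) _ ab(4)] ab(2,3) by (meson less_trans)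
  have "Complex \<sigma> (t + \<tau>) = Complex \<sigma> t + \<i> * of_real \<tau>" for t \<tau> by (simp add: complex_eq_iff)
  then have "\<exists>\<tau>\<in>{x..x + l}. \<forall>t. norm (f (Complex \<sigma> (t + \<tau>)) - f (Complex \<sigma> t)) \<le> \<epsilon>" for x
    using l(2)[of x] ab by (metis complex.sel(1) less_imp_le)
  then show "\<exists>l>0. \<forall>x. \<exists>\<tau>\<in>{x..x + l}. \<forall>t. norm (f (Complex \<sigma> (t + \<tau>)) - f (Complex \<sigma> t)) \<le> \<epsilon>"
    using l(1) by blast
qed

lemma has_fourier_coeff_iff:
  "has_fourier_coeff f \<alpha> \<beta> \<xi> c \<longleftrightarrow>
     (\<forall>\<sigma>\<in>einterval \<alpha> \<beta>. has_mean (\<lambda>t. f (Complex \<sigma> t) * exp (- of_real \<xi> * Complex \<sigma> t)) c)"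
  by (simp add: has_fourier_coeff_def has_mean_def)

lemma exp_Complex_line:
  "exp (of_real \<xi> * Complex \<sigma> t) = of_real (exp (\<sigma> * \<xi>)) * cis (\<xi> * t)"
  by (simp add: Complex_eq exp_add ring_distribs cis_conv_exp exp_of_real mult_ac flip: exp_of_real)

text \<open>Cauchy's theorem, in terms of a primitive \<open>P\<close>: the integrals over two
  vertical segments differ by the horizontal sides of a rectangle. These stay bounded as T grows, so
  they disappear after division by T.\<close>

lemma has_mean_line_independent:
  assumes ap: "almost_periodic_in f \<alpha> \<beta>" and \<sigma>: "\<sigma> \<in> einterval \<alpha> \<beta>" "\<sigma>' \<in> einterval \<alpha> \<beta>"
    and mean: "has_mean (\<lambda>t. f (Complex \<sigma> t) * exp (- of_real \<xi> * Complex \<sigma> t)) c"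
  shows "has_mean (\<lambda>t. f (Complex \<sigma>' t) * exp (- of_real \<xi> * Complex \<sigma>' t)) c"
proof -
  define F where "F s = f s * exp (- of_real \<xi> * s)" for s
  have "F holomorphic_on vstrip \<alpha> \<beta>"
    using ap unfolding F_def almost_periodic_in_def by (intro holomorphic_intros) auto
  then obtain P where P: "\<And>s. s \<in> vstrip \<alpha> \<beta> \<Longrightarrow> (P has_field_derivative F s) (at s)"
    using holomorphic_convex_primitive'[OF convex_vstrip open_vstrip] at_within_open[OF _ open_vstrip]
    by metis
  obtain a b where ab: "\<alpha> < ereal a" "a < \<sigma>" "a < \<sigma>'" "\<sigma> < b" "\<sigma>' < b" "ereal b < \<beta>"
    using einterval_shrink[OF \<sigma>] by metis
  define S where "S = {s. a \<le> Re s \<and> Re s \<le> b}"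
  have SU: "S \<subseteq> vstrip \<alpha> \<beta>"
    using vstrip_substrip[OF ab(1,6)] by (auto simp: S_def)
  obtain B0 where B0: "\<And>s. a \<le> Re s \<Longrightarrow> Re s \<le> b \<Longrightarrow> norm (f s) \<le> B0"
    using almost_periodic_in_bounded[OF ap ab(1) _ ab(6)] ab by (meson less_trans)
  define B where "B = B0 * exp (\<bar>\<xi>\<bar> * (\<bar>a\<bar> + \<bar>b\<bar>))"
  have FB: "norm (F s) \<le> B" if "s \<in> S" for s
  proof -
    have "\<bar>\<xi>\<bar> * \<bar>Re s\<bar> \<le> \<bar>\<xi>\<bar> * (\<bar>a\<bar> + \<bar>b\<bar>)"
      using that by (intro mult_left_mono) (auto simp: S_def)
    then have "- (\<xi> * Re s) \<le> \<bar>\<xi>\<bar> * (\<bar>a\<bar> + \<bar>b\<bar>)" using abs_ge_minus_self[of "\<xi> * Re s"] unfolding abs_mult by linarith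
    then have "norm (exp (- of_real \<xi> * s)) \<le> exp (\<bar>\<xi>\<bar> * (\<bar>a\<bar> + \<bar>b\<bar>))" by simp
    moreover have "norm (f s) \<le> B0" using B0 that by (auto simp: S_def)
    ultimately show ?thesis unfolding F_def B_def norm_mult
      by (intro mult_mono) (auto intro: order_trans[OF norm_ge_zero])
  qed
  have "convex S"
  proof -
    have "S = Re -` {a..b}" by (auto simp: S_def)
    then show ?thesis by (simp add: convex_linear_vimage bounded_linear.linear bounded_linear_Re)
  qed
  \<comment> \<open>This estimates the horizontal sides: their length is
    \<open>\<bar>\<sigma>' - \<sigma>\<bar>\<close> and the integrand is at most \<open>B\<close> on
    the substrip.\<close>
  have Pb: "norm (P u - P v) \<le> B * norm (u - v)" if "u \<in> S" "v \<in> S" for u v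
    using field_differentiable_bound[where S = S and f = P and f' = F and B = B and x = u and y = v] \<open>convex S\<close> that P SU FB
    by (meson has_field_derivative_at_within subsetD)
  have int: "((\<lambda>t. F (Complex x t)) has_integral (P (Complex x T) - P (Complex x (-T))) / \<i>) {-T..T}"
    if "a < x" "x < b" "T \<ge> 0" for x T
  proof -
    have "((\<lambda>t. F (Complex x t)) has_integral P (Complex x T) / \<i> - P (Complex x (-T)) / \<i>) {-T..T}"
    proof (rule fundamental_theorem_of_calculus)
      fix t :: real
      have "Complex x t \<in> vstrip \<alpha> \<beta>" using that SU by (auto simp: S_def)
      then have 1: "(P has_field_derivative F (Complex x t)) (at (Complex x t))" by (rule P)
      have 2: "((\<lambda>t. Complex x t) has_vector_derivative \<i>) (at t within {-T..T})"
        unfolding Complex_eq by (auto intro!: derivative_eq_intros simp: has_vector_derivative_def scaleR_conv_of_real)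
      have "(P \<circ> (\<lambda>t. Complex x t) has_vector_derivative \<i> * F (Complex x t)) (at t within {-T..T})"
        by (rule field_vector_diff_chain_within[OF 2]) (rule has_field_derivative_at_within[OF 1])
      from has_vector_derivative_divide[OF this, of \<i>]
      show "((\<lambda>t. P (Complex x t) / \<i>) has_vector_derivative F (Complex x t)) (at t within {-T..T})"
        by (simp add: o_def)
    qed (use that in auto)
    then show ?thesis by (simp only: diff_divide_distrib)
  qed
  define d where "d = B * \<bar>\<sigma>' - \<sigma>\<bar>"
  have diff: "norm (1 / (2 * of_real T) * integral {-T..T} (\<lambda>t. F (Complex \<sigma>' t)) - 1 / (2 * of_real T) * integral {-T..T} (\<lambda>t. F (Complex \<sigma> t))) \<le> d / T"
    if T: "T > 0" for T :: real
  proof -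
    have *: "norm (P (Complex \<sigma>' u) - P (Complex \<sigma> u)) \<le> d" for u
    proof -
      have "Complex \<sigma>' u - Complex \<sigma> u = of_real (\<sigma>' - \<sigma>)" by (simp add: complex_eq_iff)
      then have "norm (Complex \<sigma>' u - Complex \<sigma> u) = \<bar>\<sigma>' - \<sigma>\<bar>" by (simp only: norm_of_real)
      then show ?thesis using Pb[of "Complex \<sigma>' u" "Complex \<sigma> u"] ab by (simp add: S_def d_def)
    qed
    have I: "integral {-T..T} (\<lambda>t. F (Complex \<sigma> t)) = (P (Complex \<sigma> T) - P (Complex \<sigma> (-T))) / \<i>"
      by (rule integral_unique[OF int]) (use ab T in auto)
    have I': "integral {-T..T} (\<lambda>t. F (Complex \<sigma>' t)) = (P (Complex \<sigma>' T) - P (Complex \<sigma>' (-T))) / \<i>"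
      by (rule integral_unique[OF int]) (use ab T in auto)
    define p where "p = P (Complex \<sigma>' T) - P (Complex \<sigma> T)"
    define q where "q = P (Complex \<sigma>' (-T)) - P (Complex \<sigma> (-T))"
    have "norm p \<le> d" "norm q \<le> d" unfolding p_def q_def by (rule *)+
    then have pq: "norm (p - q) \<le> d + d" using norm_triangle_ineq4[of p q] by linarith
    have "1 / (2 * of_real T) * integral {-T..T} (\<lambda>t. F (Complex \<sigma>' t)) - 1 / (2 * of_real T) * integral {-T..T} (\<lambda>t. F (Complex \<sigma> t))
        = (p - q) / (2 * of_real T * \<i>)"
      unfolding I I' p_def q_def using T by (simp add: field_simps)
    then have "norm (1 / (2 * of_real T) * integral {-T..T} (\<lambda>t. F (Complex \<sigma>' t)) - 1 / (2 * of_real T) * integral {-T..T} (\<lambda>t. F (Complex \<sigma> t)))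
        = norm (p - q) / (2 * T)"
      using T by (simp only: norm_divide norm_mult norm_ii norm_of_real) simp
    also have "\<dots> \<le> (d + d) / (2 * T)" using T pq by (intro divide_right_mono) auto
    finally show ?thesis using T by simp
  qed
  have "((\<lambda>T. 1 / (2 * of_real T) * integral {-T..T} (\<lambda>t. F (Complex \<sigma>' t)) - 1 / (2 * of_real T) * integral {-T..T} (\<lambda>t. F (Complex \<sigma> t))) \<longlongrightarrow> 0) at_top"
  proof (rule Lim_null_comparison)
    show "\<forall>\<^sub>F T in at_top. norm (1 / (2 * of_real T) * integral {-T..T} (\<lambda>t. F (Complex \<sigma>' t)) - 1 / (2 * of_real T) * integral {-T..T} (\<lambda>t. F (Complex \<sigma> t))) \<le> d / T"
      by (rule eventually_mono[OF eventually_gt_at_top[of "0::real"]]) (rule diff)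
    show "((\<lambda>T. d / T) \<longlongrightarrow> 0) at_top" by real_asymp
  qed
  from tendsto_add[OF this mean[unfolded has_mean_def, folded F_def]] show ?thesis
    unfolding has_mean_def F_def by simp
qed

lemma has_fourier_coeff_ex:
  assumes "almost_periodic_in f \<alpha> \<beta>" "\<alpha> < \<beta>"
  shows "\<exists>c. has_fourier_coeff f \<alpha> \<beta> \<xi> c"
proof -
  obtain \<sigma> where \<sigma>: "\<sigma> \<in> einterval \<alpha> \<beta>" using einterval_nonempty[OF assms(2)] by blast
  have "ap_fun (\<lambda>t. f (Complex \<sigma> t) * (of_real (exp (\<sigma> * (- \<xi>))) * cis ((- \<xi>) * t)))"
    by (intro ap_fun_mult almost_periodic_in_line[OF assms(1) \<sigma>] ap_fun_const ap_fun_cis)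
  then have "ap_fun (\<lambda>t. f (Complex \<sigma> t) * exp (- of_real \<xi> * Complex \<sigma> t))"
    by (simp only: exp_Complex_line flip: of_real_minus)
  then obtain c where "has_mean (\<lambda>t. f (Complex \<sigma> t) * exp (- of_real \<xi> * Complex \<sigma> t)) c"
    by (rule ap_fun_uniform_mean)
  from has_mean_line_independent[OF assms(1) \<sigma> _ this] have "has_fourier_coeff f \<alpha> \<beta> \<xi> c"
    unfolding has_fourier_coeff_iff by blast
  then show ?thesis ..
qed

text \<open>Passes from coefficients of \<open>f\<close> to those of its restriction to a line:
  \<open>exp (\<sigma> * \<xi>)\<close> moves from the character into the coefficient.\<close>

lemma has_fourier_coeff_line:
  assumes "has_fourier_coeff f \<alpha> \<beta> \<xi> c" "\<sigma> \<in> einterval \<alpha> \<beta>"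
  shows "has_mean (\<lambda>t. f (Complex \<sigma> t) * cis (- (\<xi> * t))) (of_real (exp (\<sigma> * \<xi>)) * c)"
proof -
  have "has_mean (\<lambda>t. f (Complex \<sigma> t) * exp (- of_real \<xi> * Complex \<sigma> t)) c"
    using assms by (simp add: has_fourier_coeff_iff)
  then have "has_mean (\<lambda>t. of_real (exp (\<sigma> * \<xi>)) * (f (Complex \<sigma> t) * exp (- of_real \<xi> * Complex \<sigma> t))) (of_real (exp (\<sigma> * \<xi>)) * c)"
    by (rule has_mean_cmult)
  moreover have "of_real (exp (\<sigma> * \<xi>)) * (f (Complex \<sigma> t) * exp (- of_real \<xi> * Complex \<sigma> t)) = f (Complex \<sigma> t) * cis (- (\<xi> * t))" for t
  proof -
    have "exp (- of_real \<xi> * Complex \<sigma> t) = of_real (exp (\<sigma> * (- \<xi>))) * cis ((- \<xi>) * t)"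
      by (simp only: exp_Complex_line flip: of_real_minus)
    moreover have "complex_of_real (exp (\<sigma> * \<xi>)) * of_real (exp (\<sigma> * (- \<xi>))) = 1"
      by (simp flip: of_real_mult exp_add)
    ultimately show ?thesis by (simp add: mult_ac) 
  qed
  ultimately show ?thesis by (simp only:)
qed

lemma has_fourier_coeff_unique:
  assumes "has_fourier_coeff f \<alpha> \<beta> \<xi> c" "has_fourier_coeff f \<alpha> \<beta> \<xi> d" "\<alpha> < \<beta>"
  shows "c = d"
proof -
  obtain \<sigma> where \<sigma>: "\<sigma> \<in> einterval \<alpha> \<beta>" using einterval_nonempty[OF assms(3)] by blast
  show ?thesis
    by (rule has_mean_unique[OF assms(1,2)[unfolded has_fourier_coeff_iff, rule_format, OF \<sigma>]])
qed

section \<open>Riesz products\<close>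

text \<open>Complex valued so that \<open>has_mean\<close> applies, though the values are real. A
  factor is nonnegative as soon as \<open>norm (z \<xi>) \<le> 1\<close>, and it contains the
  frequencies 0, -\<xi> and \<xi> with weights 1, \<open>z \<xi> / 2\<close> and
  \<open>cnj (z \<xi>) / 2\<close>.\<close>

definition riesz_product :: "real set \<Rightarrow> (real \<Rightarrow> complex) \<Rightarrow> real \<Rightarrow> complex" where
  "riesz_product F z t = (\<Prod>\<xi>\<in>F. 1 + of_real (Re (z \<xi> * cis (- (\<xi> * t)))))"

lemma of_real_Re_cis:
  "of_real (Re (z * cis (- x))) = (z * cis (- x) + cnj z * cis x) / 2"
  by (simp add: complex_eq_iff)

lemma continuous_riesz_product: "continuous_on UNIV (riesz_product F z)"
  unfolding riesz_product_def by (intro continuous_intros)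

lemma riesz_product_nonneg:
  assumes "\<And>\<xi>. \<xi> \<in> F \<Longrightarrow> norm (z \<xi>) \<le> 1"
  shows "riesz_product F z t = of_real (Re (riesz_product F z t))" "Re (riesz_product F z t) \<ge> 0"
proof -
  have eq: "riesz_product F z t = of_real (\<Prod>\<xi>\<in>F. 1 + Re (z \<xi> * cis (- (\<xi> * t))))"
    unfolding riesz_product_def by simp
  show "riesz_product F z t = of_real (Re (riesz_product F z t))" unfolding eq by simp
  have "1 + Re (z \<xi> * cis (- (\<xi> * t))) \<ge> 0" if "\<xi> \<in> F" for \<xi>
    using abs_Re_le_cmod[of "z \<xi> * cis (- (\<xi> * t))"] assms[OF that] unfolding norm_mult norm_cis by linarith
  then show "Re (riesz_product F z t) \<ge> 0" unfolding eq Re_complex_of_real by (rule prod_nonneg)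
qed

lemma has_mean_norm_le:
  assumes "continuous_on UNIV g" "continuous_on UNIV k" "has_mean g c" "has_mean k d"
    and "\<And>t. norm (g t) \<le> B * Re (k t)"
  shows "norm c \<le> B * Re d"
proof -
  have 1: "((\<lambda>T::real. norm (1 / (2 * of_real T) * integral {-T..T} g)) \<longlongrightarrow> norm c) at_top"
    using assms(3) unfolding has_mean_def by (rule tendsto_norm)
  have 2: "((\<lambda>T::real. B * Re (1 / (2 * of_real T) * integral {-T..T} k)) \<longlongrightarrow> B * Re d) at_top"
    using assms(4) unfolding has_mean_def by (intro tendsto_intros)
  have le: "norm (1 / (2 * complex_of_real T) * integral {-T..T} g) \<le> B * Re (1 / (2 * of_real T) * integral {-T..T} k)"
    if "T > 0" for T
  proof -
    have k: "k integrable_on {-T..T}" by (rule continuous_integrable_real[OF assms(2)])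
    have Rek: "(\<lambda>t. Re (k t)) integrable_on {-T..T}"
      using integrable_linear[OF k bounded_linear_Re] by (simp add: o_def)
    have ReI: "integral {-T..T} (\<lambda>t. Re (k t)) = Re (integral {-T..T} k)"
      using integral_linear[OF k bounded_linear_Re] by (simp add: o_def)
    have "norm (integral {-T..T} g) \<le> integral {-T..T} (\<lambda>t. B * Re (k t))"
      using continuous_integrable_real[OF assms(1)] Rek assms(5)
      by (intro integral_norm_bound_integral) (auto intro: integrable_on_mult_right)
    also have "\<dots> = B * Re (integral {-T..T} k)" by (simp add: ReI)
    finally have "norm (integral {-T..T} g) / (2 * T) \<le> B * Re (integral {-T..T} k) / (2 * T)"
      using that by (intro divide_right_mono) auto
    moreover have "1 / (2 * complex_of_real T) = of_real (1 / (2 * T))" by simp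
    then have "Re (1 / (2 * complex_of_real T) * integral {-T..T} k) = Re (integral {-T..T} k) / (2 * T)"
      by (simp only: times_complex.sel Re_complex_of_real Im_complex_of_real) simp
    ultimately show ?thesis using that by (simp add: norm_mult norm_divide)
  qed
  show ?thesis
    by (rule tendsto_le[OF _ 2 1 eventually_mono[OF eventually_gt_at_top[of "0::real"] le]]) simp
qed

text \<open>Only the frequencies of \<open>F\<close> itself survive: by independence no other combination
  of them is a frequency of \<open>h\<close>.\<close>

lemma has_mean_riesz_product:
  assumes indep: "lin_indep_over_Q \<Lambda>"
    and cont: "continuous_on UNIV h"
    and mean: "\<And>\<mu>. has_mean (\<lambda>t. h t * cis (- (\<mu> * t))) (A \<mu>)"
    and supp: "\<And>\<mu>. A \<mu> \<noteq> 0 \<Longrightarrow> \<mu> \<in> insert 0 \<Lambda>"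
    and F: "finite F" "F \<subseteq> \<Lambda>"
    and "\<mu> \<in> module.span (\<lambda>(q::rat) (x::real). of_rat q * x) (\<Lambda> - F)"
  shows "has_mean (\<lambda>t. h t * riesz_product F z t * cis (- (\<mu> * t)))
           (A \<mu> + (if \<mu> = 0 then (\<Sum>\<xi>\<in>F. z \<xi> * A \<xi>) / 2 else 0))"
  using F assms(7)
proof (induction F arbitrary: \<mu> rule: finite_induct)
  case empty
  then show ?case using mean[of \<mu>] by (auto simp: riesz_product_def)
next
  case (insert n F)
  interpret V: vector_space "\<lambda>(q::rat) (x::real). of_rat q * x" by (rule vector_space_rat_real)
  have ind: "V.independent \<Lambda>" using indep by (simp add: lin_indep_over_Q_def)
  have n: "n \<in> \<Lambda>" "n \<in> \<Lambda> - F" using insert by auto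
  have nspan: "n \<notin> V.span (\<Lambda> - {n})" using ind n(1) unfolding V.dependent_def by blast
  have \<mu>: "\<mu> \<in> V.span (\<Lambda> - {n})" "\<mu> \<in> V.span (\<Lambda> - F)"
    using insert.prems V.span_mono[of "\<Lambda> - insert n F" "\<Lambda> - {n}"] V.span_mono[of "\<Lambda> - insert n F" "\<Lambda> - F"] by blast+
  have nF: "n \<in> V.span (\<Lambda> - F)" using n(2) by (rule V.span_base)
  have ne: "\<mu> + n \<noteq> 0" "\<mu> - n \<noteq> 0"
    using \<mu>(1) nspan V.span_neg[OF \<mu>(1)] by (auto simp: add_eq_0_iff)
  have ne2: "x \<noteq> n" if "x \<in> V.span (\<Lambda> - {n})" for x using that nspan by blast
  \<comment> \<open>If \<open>\<mu> + n\<close> were an exponent for nonzero \<mu>, it would differ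
    from n, and subtracting \<mu> would put n into the span of the other exponents.\<close>
  have plus: "A (\<mu> + n) = (if \<mu> = 0 then A n else 0)"
  proof -
    have False if "\<mu> \<noteq> 0" "\<mu> + n \<in> \<Lambda>"
    proof -
      have "\<mu> + n \<in> V.span (\<Lambda> - {n})" using that by (intro V.span_base) auto
      from V.span_diff[OF this \<mu>(1)] show False using nspan by simp
    qed
    then show ?thesis using supp[of "\<mu> + n"] ne by auto
  qed
  have minus: "A (\<mu> - n) = 0"
  proof (rule ccontr)
    assume "A (\<mu> - n) \<noteq> 0"
    then have \<Lambda>: "\<mu> - n \<in> \<Lambda>" using supp ne by blast
    show False
    proof (cases "\<mu> - n = n")
      \<comment> \<open>Here \<mu> is twice n, and halving it needs a rational scalar; this is the
        only place of the argument where integer combinations do not suffice.\<close>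
      case True
      then have "n = of_rat (1/2) * \<mu>" by (simp add: of_rat_divide)
      then show False using V.span_scale[OF \<mu>(1), of "1/2"] nspan by simp
    next
      case False
      then have "\<mu> - n \<in> V.span (\<Lambda> - {n})" using \<Lambda> by (intro V.span_base) auto
      from V.span_diff[OF \<mu>(1) this] show False using nspan by simp
    qed
  qed
  have F\<Lambda>: "F \<subseteq> \<Lambda>" using insert.prems by auto
  define G where "G \<nu> t = h t * riesz_product F z t * cis (- (\<nu> * t))" for \<nu> t
  have Gc: "continuous_on UNIV (G \<nu>)" for \<nu>
    unfolding G_def by (intro continuous_intros cont continuous_riesz_product)
  have 0: "has_mean (G \<mu>) (A \<mu> + (if \<mu> = 0 then (\<Sum>\<xi>\<in>F. z \<xi> * A \<xi>) / 2 else 0))"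
    unfolding G_def by (rule insert.IH[OF F\<Lambda> \<mu>(2)])
  have 1: "has_mean (G (\<mu> + n)) (A (\<mu> + n))"
    unfolding G_def using insert.IH[OF F\<Lambda> V.span_add[OF \<mu>(2) nF]] ne by simp
  have 2: "has_mean (G (\<mu> - n)) (A (\<mu> - n))"
    unfolding G_def using insert.IH[OF F\<Lambda> V.span_diff[OF \<mu>(2) nF]] ne by simp
  have "has_mean (\<lambda>t. G \<mu> t + (z n / 2 * G (\<mu> + n) t + cnj (z n) / 2 * G (\<mu> - n) t))
      ((A \<mu> + (if \<mu> = 0 then (\<Sum>\<xi>\<in>F. z \<xi> * A \<xi>) / 2 else 0)) + (z n / 2 * A (\<mu> + n) + cnj (z n) / 2 * A (\<mu> - n)))"
    by (intro has_mean_add has_mean_cmult 0 1 2 continuous_intros Gc)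
  moreover have "G \<mu> t + (z n / 2 * G (\<mu> + n) t + cnj (z n) / 2 * G (\<mu> - n) t)
      = h t * riesz_product (insert n F) z t * cis (- (\<mu> * t))" for t
  proof -
    have "cis (- ((\<mu> + n) * t)) = cis (- (n * t)) * cis (- (\<mu> * t))"
         "cis (- ((\<mu> - n) * t)) = cis (n * t) * cis (- (\<mu> * t))"
      by (simp_all add: cis_mult algebra_simps)
    moreover have "riesz_product (insert n F) z t = (1 + (z n * cis (- (n * t)) + cnj (z n) * cis (n * t)) / 2) * riesz_product F z t"
      using insert.hyps unfolding riesz_product_def of_real_Re_cis by simp
    ultimately show ?thesis unfolding G_def by (simp only:) (simp add: field_simps)
  qed
  moreover have "(A \<mu> + (if \<mu> = 0 then (\<Sum>\<xi>\<in>F. z \<xi> * A \<xi>) / 2 else 0)) + (z n / 2 * A (\<mu> + n) + cnj (z n) / 2 * A (\<mu> - n))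
      = A \<mu> + (if \<mu> = 0 then (\<Sum>\<xi>\<in>insert n F. z \<xi> * A \<xi>) / 2 else 0)"
    using insert.hyps unfolding plus minus by (simp add: field_simps)
  ultimately show ?case by (simp only:)
qed

lemma lin_indep_nonzero: "lin_indep_over_Q \<Lambda> \<Longrightarrow> 0 \<notin> \<Lambda>"
proof
  interpret V: vector_space "\<lambda>(q::rat) (x::real). of_rat q * x" by (rule vector_space_rat_real)
  assume "lin_indep_over_Q \<Lambda>" "0 \<in> \<Lambda>"
  then show False using V.dependent_zero by (simp add: lin_indep_over_Q_def)
qed

text \<open>Choosing \<open>z\<close> as the conjugate signs of the coefficients, the mean of
  \<open>h\<close> times the Riesz product is half of the sum. The product is nonnegative with mean
  1, so this mean is at most \<open>B\<close> in norm; hence the factor 2, whatever the size of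
  \<open>F\<close>.\<close>

theorem sum_norm_fourier_le:
  assumes indep: "lin_indep_over_Q \<Lambda>"
    and cont: "continuous_on UNIV h"
    and bound: "\<And>t. norm (h t) \<le> B"
    and mean: "\<And>\<mu>. has_mean (\<lambda>t. h t * cis (- (\<mu> * t))) (A \<mu>)"
    and supp: "\<And>\<mu>. A \<mu> \<noteq> 0 \<Longrightarrow> \<mu> \<in> \<Lambda>"
    and F: "finite F" "F \<subseteq> \<Lambda>"
  shows "(\<Sum>\<xi>\<in>F. norm (A \<xi>)) \<le> 2 * B"
proof -
  interpret V: vector_space "\<lambda>(q::rat) (x::real). of_rat q * x" by (rule vector_space_rat_real)
  define z where "z \<xi> = cnj (sgn (A \<xi>))" for \<xi>
  have z: "norm (z \<xi>) \<le> 1" for \<xi> by (simp add: z_def norm_sgn)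
  have zA: "z \<xi> * A \<xi> = of_real (norm (A \<xi>))" for \<xi>
    by (cases "A \<xi> = 0") (auto simp: z_def sgn_eq complex_norm_square power2_eq_square field_simps simp flip: complex_norm_square)
  note 0 = lin_indep_nonzero[OF indep]
  have "A 0 = 0" using supp 0 by blast
  have "has_mean (\<lambda>t. h t * riesz_product F z t * cis (- (0 * t))) (A 0 + (if 0 = (0::real) then (\<Sum>\<xi>\<in>F. z \<xi> * A \<xi>) / 2 else 0))"
    using supp by (intro has_mean_riesz_product[OF indep cont mean _ F]) (auto intro: V.span_zero)
  then have 1: "has_mean (\<lambda>t. h t * riesz_product F z t) (of_real (\<Sum>\<xi>\<in>F. norm (A \<xi>)) / 2)"
    using \<open>A 0 = 0\<close> zA by simp
  \<comment> \<open>The constant function 1 has the single frequency 0, which does not occur in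
    \<open>F\<close>; so no factor of the product changes its mean.\<close>
  have mean1: "has_mean (\<lambda>t. 1 * cis (- (\<mu> * t))) (if \<mu> = 0 then 1 else 0)" for \<mu>
    using has_mean_const[of 1] has_mean_cis[of "-\<mu>"] by auto
  have "has_mean (\<lambda>t. 1 * riesz_product F z t * cis (- (0 * t)))
      ((if 0 = (0::real) then 1 else 0) + (if 0 = (0::real) then (\<Sum>\<xi>\<in>F. z \<xi> * (if \<xi> = 0 then 1 else 0)) / 2 else 0))"
    by (intro has_mean_riesz_product[OF indep _ mean1 _ F]) (auto intro: V.span_zero split: if_splits)
  moreover have "(\<Sum>\<xi>\<in>F. z \<xi> * (if \<xi> = 0 then 1 else 0)) = 0"
    using 0 F(2) by (intro sum.neutral) auto
  ultimately have 2: "has_mean (riesz_product F z) 1" by simp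
  have "norm (complex_of_real (\<Sum>\<xi>\<in>F. norm (A \<xi>)) / 2) \<le> B * Re 1"
  proof (rule has_mean_norm_le[OF _ _ 1 2])
    fix t
    have "norm (riesz_product F z t) = Re (riesz_product F z t)"
      using riesz_product_nonneg[of F z t] z by (metis abs_of_nonneg norm_of_real)
    then show "norm (h t * riesz_product F z t) \<le> B * Re (riesz_product F z t)"
      using riesz_product_nonneg(2)[of F z t] z bound[of t] by (simp add: norm_mult mult_right_mono)
  qed (intro continuous_intros cont continuous_riesz_product)+
  moreover have "norm (complex_of_real (\<Sum>\<xi>\<in>F. norm (A \<xi>)) / 2) = (\<Sum>\<xi>\<in>F. norm (A \<xi>)) / 2"
    using sum_nonneg[of F "\<lambda>\<xi>. norm (A \<xi>)"] by (simp only: norm_divide norm_of_real) simp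
  ultimately show ?thesis by simp
qed

section \<open>Absolute convergence of the Dirichlet series\<close>

text \<open>The Weierstrass M-test for unordered sums. One finite set serves all dominated families,
  which gives uniformity in any parameter on which the family depends.\<close>

lemma summable_on_uniform_tail:
  fixes M :: "'a \<Rightarrow> real"
  assumes "M summable_on I" "\<epsilon> > 0"
  obtains F where "finite F" "F \<subseteq> I"
    "\<And>u :: 'a \<Rightarrow> complex. (\<And>i. i \<in> I \<Longrightarrow> norm (u i) \<le> M i) \<Longrightarrow> norm (infsum u I - sum u F) \<le> \<epsilon>"
proof -
  have "(M has_sum infsum M I) I" using assms(1) by simp
  then have "\<forall>\<^sub>F F in finite_subsets_at_top I. dist (sum M F) (infsum M I) < \<epsilon>"
    unfolding has_sum_def using assms(2) tendstoD by blast
  then obtain F where F: "finite F" "F \<subseteq> I" "dist (sum M F) (infsum M I) < \<epsilon>"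
    unfolding eventually_finite_subsets_at_top by blast
  have "norm (infsum u I - sum u F) \<le> \<epsilon>" if u: "\<And>i. i \<in> I \<Longrightarrow> norm (u i) \<le> M i" for u :: "'a \<Rightarrow> complex"
  proof -
    have nu: "(\<lambda>i. norm (u i)) summable_on I"
      by (rule summable_on_comparison_test[OF assms(1) u]) auto
    have "u summable_on I" using nu by (rule abs_summable_summable)
    then have "infsum u (I - F) = infsum u I - infsum u F"
      using F by (intro infsum_Diff) (auto intro: summable_on_finite)
    then have "norm (infsum u I - sum u F) = norm (infsum u (I - F))" using F by simp
    also have "\<dots> \<le> infsum (\<lambda>i. norm (u i)) (I - F)"
      by (rule norm_infsum_bound) (use nu summable_on_subset_banach in blast)
    also have "\<dots> \<le> infsum M (I - F)"
      by (rule infsum_mono) (use nu assms(1) u in \<open>auto intro: summable_on_subset_banach\<close>)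
    also have "\<dots> = infsum M I - infsum M F"
      using F assms(1) by (intro infsum_Diff) (auto intro: summable_on_finite)
    also have "\<dots> \<le> \<epsilon>" using F by (simp add: dist_real_def abs_if split: if_splits)
    finally show ?thesis .
  qed
  then show ?thesis using F(1,2) that by blast
qed

text \<open>The mean of \<open>g\<close> exists by almost periodicity, and only its value has to be
  identified: it is within every \<epsilon> of \<open>c\<close>.\<close>

lemma has_mean_approx:
  assumes "ap_fun g"
    and "\<And>\<epsilon>. \<epsilon> > 0 \<Longrightarrow> \<exists>p. continuous_on UNIV p \<and> has_mean p c \<and> (\<forall>t. norm (g t - p t) \<le> \<epsilon>)"
  shows "has_mean g c"
proof -
  obtain d where d: "has_mean g d" using ap_fun_uniform_mean[OF assms(1)] by metis
  have "norm (d - c) \<le> \<epsilon>" if \<epsilon>: "\<epsilon> > 0" for \<epsilon>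
  proof -
    obtain p where p: "continuous_on UNIV p" "has_mean p c" "\<And>t. norm (g t - p t) \<le> \<epsilon>"
      using assms(2)[OF \<epsilon>] by blast
    have gc: "continuous_on UNIV g" by (rule ap_fun_continuous[OF assms(1)])
    have "has_mean (\<lambda>t. g t + (-1) * p t) (d + (-1) * c)"
      by (intro has_mean_add has_mean_cmult d p gc continuous_intros)
    moreover have "continuous_on UNIV (\<lambda>t. g t + (-1) * p t)" by (intro continuous_intros gc p)
    moreover have "norm (g t + (-1) * p t) \<le> \<epsilon>" for t using p(3)[of t] by simp
    ultimately have "norm (d + (-1) * c) \<le> \<epsilon>" using has_mean_bound by blast
    then show ?thesis by simp
  qed
  from this[of "norm (d - c) / 2"] have "d = c" by (cases "d = c") auto
  then show ?thesis using d by simp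
qed

lemma ap_fun_sum_cis: "finite F \<Longrightarrow> ap_fun (\<lambda>t. \<Sum>i\<in>F. b i * cis (l i * t))"
  by (induction F rule: finite_induct) (auto intro!: ap_fun_add ap_fun_mult ap_fun_cis)

lemma has_mean_sum_cis:
  assumes "finite F" "inj_on l F"
  shows "has_mean (\<lambda>t. (\<Sum>i\<in>F. b i * cis (l i * t)) * cis (- (\<mu> * t))) (\<Sum>i\<in>F. if l i = \<mu> then b i else 0)"
  using assms
proof (induction F rule: finite_induct)
  case empty
  then show ?case using has_mean_const[of 0] by simp
next
  case (insert j F)
  have "has_mean (\<lambda>t. b j * cis ((l j - \<mu>) * t)) (b j * (if l j = \<mu> then 1 else 0))"
    by (rule has_mean_cmult) (use has_mean_cis[of "l j - \<mu>"] has_mean_const[of 1] in auto)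
  moreover have "b j * cis (l j * t) * cis (- (\<mu> * t)) = b j * cis ((l j - \<mu>) * t)" for t
    by (simp add: cis_mult algebra_simps)
  ultimately have "has_mean (\<lambda>t. b j * cis (l j * t) * cis (- (\<mu> * t))) (b j * (if l j = \<mu> then 1 else 0))"
    by (simp only:)
  then have "has_mean (\<lambda>t. b j * cis (l j * t) * cis (- (\<mu> * t))) (if l j = \<mu> then b j else 0)"
    by (simp only: mult_1_right mult_zero_right if_distrib[of "(*) (b j)"])
  moreover have "has_mean (\<lambda>t. (\<Sum>i\<in>F. b i * cis (l i * t)) * cis (- (\<mu> * t))) (\<Sum>i\<in>F. if l i = \<mu> then b i else 0)"
    using insert by simp
  ultimately have "has_mean (\<lambda>t. b j * cis (l j * t) * cis (- (\<mu> * t)) + (\<Sum>i\<in>F. b i * cis (l i * t)) * cis (- (\<mu> * t)))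
      ((if l j = \<mu> then b j else 0) + (\<Sum>i\<in>F. if l i = \<mu> then b i else 0))"
    by (intro has_mean_add continuous_intros)
  then show ?case using insert.hyps by (simp add: distrib_right)
qed

text \<open>Uniform limits of finite exponential sums, whose means are known. To make the mean at
  one frequency independent of \<epsilon>, the approximating finite set must contain the index of
  that frequency, if there is one; \<open>F0\<close> prescribes it.\<close>

lemma
  assumes sm: "(\<lambda>i. norm (b i)) summable_on I" and inj: "inj_on l I"
  shows ap_fun_infsum_cis: "ap_fun (\<lambda>t. \<Sum>\<^sub>\<infinity>i\<in>I. b i * cis (l i * t))"
    and has_mean_infsum_cis: "i \<in> I \<Longrightarrow> has_mean (\<lambda>t. (\<Sum>\<^sub>\<infinity>i\<in>I. b i * cis (l i * t)) * cis (- (l i * t))) (b i)"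
    and has_mean_infsum_cis_0: "\<mu> \<notin> l ` I \<Longrightarrow> has_mean (\<lambda>t. (\<Sum>\<^sub>\<infinity>i\<in>I. b i * cis (l i * t)) * cis (- (\<mu> * t))) 0"
proof -
  have approx: "\<exists>F. finite F \<and> F0 \<subseteq> F \<and> F \<subseteq> I \<and> (\<forall>t. norm ((\<Sum>\<^sub>\<infinity>i\<in>I. b i * cis (l i * t)) - (\<Sum>i\<in>F. b i * cis (l i * t))) \<le> \<epsilon>)"
    if e: "\<epsilon> > 0" and F0: "finite F0" "F0 \<subseteq> I" for \<epsilon> F0
  proof -
    obtain F where F: "finite F" "F \<subseteq> I"
      "\<And>u :: _ \<Rightarrow> complex. (\<And>i. i \<in> I \<Longrightarrow> norm (u i) \<le> norm (b i)) \<Longrightarrow> norm (infsum u I - sum u F) \<le> \<epsilon>/2"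
      using summable_on_uniform_tail[OF sm half_gt_zero[OF e]] by blast
    have "norm ((\<Sum>\<^sub>\<infinity>i\<in>I. b i * cis (l i * t)) - (\<Sum>i\<in>F \<union> F0. b i * cis (l i * t))) \<le> \<epsilon>" for t
    proof -
      define u where "u i = b i * cis (l i * t)" for i
      \<comment> \<open>The tail bound is available for \<open>F\<close> only. Deleting the
        additional indices keeps the family dominated, and the tail of \<open>v\<close> after
        \<open>F\<close> equals the tail of \<open>u\<close> after
        \<open>F \<union> F0\<close>.\<close>
      define v where "v i = (if i \<in> F0 - F then 0 else u i)" for i
      have u: "norm (infsum u I - sum u F) \<le> \<epsilon>/2" by (rule F(3)) (simp add: u_def norm_mult)
      have v: "norm (infsum v I - sum v F) \<le> \<epsilon>/2" by (rule F(3)) (simp add: u_def v_def norm_mult)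
      have us: "u summable_on I"
        by (rule abs_summable_summable) (use sm in \<open>simp add: u_def norm_mult\<close>)
      have "sum v F = sum u F" by (intro sum.cong) (auto simp: v_def)
      have fin: "finite (F0 - F)" "F0 - F \<subseteq> I" using F0 by auto
      have "infsum v I = infsum u (I - (F0 - F))" by (rule infsum_cong_neutral) (auto simp: v_def)
      also have "\<dots> = infsum u I - infsum u (F0 - F)"
        using fin us by (intro infsum_Diff) (auto intro: summable_on_finite)
      also have "infsum u (F0 - F) = sum u (F0 - F)" using fin by simp
      finally have "infsum v I = infsum u I - sum u (F0 - F)" .
      moreover have "sum u (F \<union> F0) = sum u F + sum u (F0 - F)"
        using F(1) F0(1) by (subst sum.union_disjoint[symmetric]) auto
      ultimately have "infsum u I - sum u (F \<union> F0) = infsum v I - sum v F"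
        using \<open>sum v F = sum u F\<close> by simp
      then show ?thesis using v e unfolding u_def by simp
    qed
    then show ?thesis using F F0 by (intro exI[of _ "F \<union> F0"]) auto
  qed
  show ap: "ap_fun (\<lambda>t. \<Sum>\<^sub>\<infinity>i\<in>I. b i * cis (l i * t))"
  proof (rule ap_fun_uniform_limit)
    fix \<epsilon> :: real assume e: "\<epsilon> > 0"
    obtain F where F: "finite F"
      "\<And>t. norm ((\<Sum>\<^sub>\<infinity>i\<in>I. b i * cis (l i * t)) - (\<Sum>i\<in>F. b i * cis (l i * t))) \<le> \<epsilon>"
      using approx[OF e finite.emptyI empty_subsetI] by blast
    show "\<exists>g. ap_fun g \<and> (\<forall>t. norm ((\<Sum>\<^sub>\<infinity>i\<in>I. b i * cis (l i * t)) - g t) \<le> \<epsilon>)"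
      using ap_fun_sum_cis[OF F(1)] F(2) by (intro exI[of _ "\<lambda>t. \<Sum>i\<in>F. b i * cis (l i * t)"]) simp
  qed
  have ap': "ap_fun (\<lambda>t. (\<Sum>\<^sub>\<infinity>i\<in>I. b i * cis (l i * t)) * cis (- (\<mu> * t)))" for \<mu>
    using ap_fun_mult[OF ap ap_fun_cis[of "-\<mu>"]] by simp
  have key: "\<exists>p. continuous_on UNIV p \<and> has_mean p (\<Sum>i\<in>F0. if l i = \<mu> then b i else 0) \<and>
      (\<forall>t. norm ((\<Sum>\<^sub>\<infinity>i\<in>I. b i * cis (l i * t)) * cis (- (\<mu> * t)) - p t) \<le> \<epsilon>)"
    if e: "\<epsilon> > 0" and F0: "finite F0" "F0 \<subseteq> I" "\<And>i. i \<in> I \<Longrightarrow> l i = \<mu> \<Longrightarrow> i \<in> F0" for \<epsilon> F0 \<mu>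
  proof -
    obtain F where F: "finite F" "F0 \<subseteq> F" "F \<subseteq> I"
      "\<And>t. norm ((\<Sum>\<^sub>\<infinity>i\<in>I. b i * cis (l i * t)) - (\<Sum>i\<in>F. b i * cis (l i * t))) \<le> \<epsilon>"
      using approx[OF e F0(1,2)] by blast
    have eq: "(\<Sum>i\<in>F. if l i = \<mu> then b i else 0) = (\<Sum>i\<in>F0. if l i = \<mu> then b i else 0)"
      by (rule sum.mono_neutral_right) (use F F0 in auto)
    have "has_mean (\<lambda>t. (\<Sum>i\<in>F. b i * cis (l i * t)) * cis (- (\<mu> * t))) (\<Sum>i\<in>F0. if l i = \<mu> then b i else 0)"
      unfolding eq[symmetric] by (rule has_mean_sum_cis[OF F(1) inj_on_subset[OF inj F(3)]])
    moreover have "norm ((\<Sum>\<^sub>\<infinity>i\<in>I. b i * cis (l i * t)) * cis (- (\<mu> * t)) - (\<Sum>i\<in>F. b i * cis (l i * t)) * cis (- (\<mu> * t))) \<le> \<epsilon>" for t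
      using F(4)[of t] by (simp add: norm_mult flip: left_diff_distrib)
    ultimately show ?thesis
      by (intro exI[of _ "\<lambda>t. (\<Sum>i\<in>F. b i * cis (l i * t)) * cis (- (\<mu> * t))"]) (auto intro!: continuous_intros)
  qed
  show "has_mean (\<lambda>t. (\<Sum>\<^sub>\<infinity>i\<in>I. b i * cis (l i * t)) * cis (- (l i * t))) (b i)" if "i \<in> I"
    using key[of _ "{i}" "l i"] that inj by (intro has_mean_approx[OF ap']) (auto simp: inj_on_def)
  show "has_mean (\<lambda>t. (\<Sum>\<^sub>\<infinity>i\<in>I. b i * cis (l i * t)) * cis (- (\<mu> * t))) 0" if "\<mu> \<notin> l ` I"
    using key[of _ "{}" \<mu>] that by (intro has_mean_approx[OF ap']) auto
qed

text \<open>Existence and uniqueness of coefficients extend the information about the listed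
  exponents to all real frequencies, as the bound and the uniqueness theorem require.\<close>

lemma is_dirichlet_series_coeff:
  assumes "\<alpha> < \<beta>" "almost_periodic_in f \<alpha> \<beta>" "is_dirichlet_series f \<alpha> \<beta> N a l"
  defines "I \<equiv> dirichlet_index N"
  shows "inj_on l I" "l ` I = fourier_exponents f \<alpha> \<beta>"
    and "\<And>i. i \<in> I \<Longrightarrow> has_fourier_coeff f \<alpha> \<beta> (l i) (a i)"
    and "\<And>i. i \<in> I \<Longrightarrow> a i \<noteq> 0"
    and "\<And>\<mu>. \<mu> \<notin> l ` I \<Longrightarrow> has_fourier_coeff f \<alpha> \<beta> \<mu> 0"
proof -
  have bij: "bij_betw l I (fourier_exponents f \<alpha> \<beta>)"
    and coeff: "\<And>i. i \<in> I \<Longrightarrow> has_fourier_coeff f \<alpha> \<beta> (l i) (a i)"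
    using assms(3) by (auto simp: is_dirichlet_series_def I_def)
  show "inj_on l I" and img: "l ` I = fourier_exponents f \<alpha> \<beta>" using bij by (auto simp: bij_betw_def)
  show "has_fourier_coeff f \<alpha> \<beta> (l i) (a i)" if "i \<in> I" for i by (rule coeff[OF that])
  show "a i \<noteq> 0" if "i \<in> I" for i
  proof -
    have "l i \<in> fourier_exponents f \<alpha> \<beta>" using img that by blast
    then obtain c where "c \<noteq> 0" "has_fourier_coeff f \<alpha> \<beta> (l i) c" by (auto simp: fourier_exponents_def)
    then show ?thesis using has_fourier_coeff_unique[OF coeff[OF that] _ assms(1)] by metis
  qed
  show "has_fourier_coeff f \<alpha> \<beta> \<mu> 0" if "\<mu> \<notin> l ` I" for \<mu>
  proof -
    obtain c where c: "has_fourier_coeff f \<alpha> \<beta> \<mu> c" using has_fourier_coeff_ex[OF assms(2,1)] by blast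
    then have "c = 0" using that img by (auto simp: fourier_exponents_def)
    then show ?thesis using c by simp
  qed
qed

theorem dirichlet_series_converges:
  assumes "\<alpha> < \<beta>" "almost_periodic_in f \<alpha> \<beta>" "is_dirichlet_series f \<alpha> \<beta> N a l"
    and indep: "lin_indep_over_Q (fourier_exponents f \<alpha> \<beta>)" and s: "s \<in> vstrip \<alpha> \<beta>"
  shows "(\<lambda>i. norm (a i) * exp (Re s * l i)) summable_on dirichlet_index N"
    and "f s = (\<Sum>\<^sub>\<infinity>i\<in>dirichlet_index N. a i * exp (of_real (l i) * s))"
proof -
  define I where "I = dirichlet_index N"
  define \<sigma> where "\<sigma> = Re s"
  have \<sigma>: "\<sigma> \<in> einterval \<alpha> \<beta>" using s by (simp add: vstrip_def \<sigma>_def)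
  note D = is_dirichlet_series_coeff[OF assms(1-3), folded I_def]
  define h where "h t = f (Complex \<sigma> t)" for t
  have ap: "ap_fun h" unfolding h_def by (rule almost_periodic_in_line[OF assms(2) \<sigma>])
  obtain B where B: "B > 0" "\<And>t. norm (h t) \<le> B" using ap_fun_bounded[OF ap] by blast
  define b where "b i = of_real (exp (\<sigma> * l i)) * a i" for i
  \<comment> \<open>The coefficients on the line through s, indexed by frequency rather than by
    position in the series.\<close>
  define A where "A \<mu> = (if \<mu> \<in> l ` I then b (inv_into I l \<mu>) else 0)" for \<mu>
  have Al: "A (l i) = b i" if "i \<in> I" for i using that D(1) by (simp add: A_def)
  have mean_i: "has_mean (\<lambda>t. h t * cis (- (l i * t))) (b i)" if "i \<in> I" for i
    unfolding h_def b_def by (rule has_fourier_coeff_line[OF D(3)[OF that] \<sigma>])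
  have mean_0: "has_mean (\<lambda>t. h t * cis (- (\<mu> * t))) 0" if "\<mu> \<notin> l ` I" for \<mu>
    using has_fourier_coeff_line[OF D(5)[OF that] \<sigma>] by (simp add: h_def)
  have meanA: "has_mean (\<lambda>t. h t * cis (- (\<mu> * t))) (A \<mu>)" for \<mu>
    using mean_i mean_0 Al by (cases "\<mu> \<in> l ` I") (auto simp: A_def)
  have sumA: "(\<Sum>\<xi>\<in>F. norm (A \<xi>)) \<le> 2 * B" if "finite F" "F \<subseteq> l ` I" for F
    using that unfolding D(2)
    by (intro sum_norm_fourier_le[OF indep ap_fun_continuous[OF ap] B(2) meanA]) (auto simp: A_def D(2) split: if_splits)
  have sumb: "(\<Sum>i\<in>F. norm (b i)) \<le> 2 * B" if "finite F" "F \<subseteq> I" for F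
  proof -
    have "(\<Sum>i\<in>F. norm (b i)) = (\<Sum>i\<in>F. norm (A (l i)))" using that Al by (intro sum.cong) auto
    also have "\<dots> = (\<Sum>\<xi>\<in>l ` F. norm (A \<xi>))"
      using inj_on_subset[OF D(1) that(2)] by (simp add: sum.reindex)
    also have "\<dots> \<le> 2 * B" using that by (intro sumA) auto
    finally show ?thesis .
  qed
  have nb: "(\<lambda>i. norm (b i)) summable_on I"
    by (rule nonneg_bdd_above_summable_on) (auto intro!: bdd_aboveI2[of _ _ "2 * B"] sumb)
  then show "(\<lambda>i. norm (a i) * exp (Re s * l i)) summable_on dirichlet_index N"
    by (simp add: b_def norm_mult I_def \<sigma>_def mult.commute)
  define g where "g t = (\<Sum>\<^sub>\<infinity>i\<in>I. b i * cis (l i * t))" for t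
  have apg: "ap_fun g" unfolding g_def by (rule ap_fun_infsum_cis[OF nb D(1)])
  \<comment> \<open>Both functions have the coefficient \<open>A \<mu>\<close> at every frequency,
    so their difference falls under the uniqueness theorem.\<close>
  define k where "k t = h t + (-1) * g t" for t
  have "ap_fun k" unfolding k_def by (intro ap_fun_add ap_fun_mult ap_fun_const ap apg)
  moreover have "has_mean (\<lambda>t. k t * cis (- (\<mu> * t))) 0" for \<mu>
  proof -
    have g: "has_mean (\<lambda>t. g t * cis (- (\<mu> * t))) (A \<mu>)"
      using has_mean_infsum_cis[OF nb D(1)] has_mean_infsum_cis_0[OF nb D(1)] Al
      unfolding g_def by (cases "\<mu> \<in> l ` I") (auto simp: A_def)
    have "has_mean (\<lambda>t. h t * cis (- (\<mu> * t)) + (-1) * (g t * cis (- (\<mu> * t)))) (A \<mu> + (-1) * A \<mu>)"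
      by (intro has_mean_add has_mean_cmult meanA g continuous_intros ap_fun_continuous ap apg)
    then show ?thesis by (simp add: k_def algebra_simps)
  qed
  ultimately have "k (Im s) = 0" by (rule ap_fun_eq_zero)
  then have "f s = g (Im s)" by (simp add: k_def h_def \<sigma>_def)
  also have "\<dots> = (\<Sum>\<^sub>\<infinity>i\<in>I. a i * exp (of_real (l i) * s))"
    unfolding g_def
  proof (rule infsum_cong)
    fix i
    show "b i * cis (l i * Im s) = a i * exp (of_real (l i) * s)"
      using exp_Complex_line[of "l i" \<sigma> "Im s"] by (simp add: b_def \<sigma>_def)
  qed
  finally show "f s = (\<Sum>\<^sub>\<infinity>i\<in>dirichlet_index N. a i * exp (of_real (l i) * s))" by (simp add: I_def)
qed

section \<open>Phases\<close>

text \<open>As x runs from 0 to \<open>pi\<close>, the length of \<open>A + B * cis x\<close> passes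
  from \<open>A + B\<close> to \<open>\<bar>A - B\<bar>\<close>. The triangle inequalities put
  \<open>C\<close> in between, so the third side closes the triangle for some x.\<close>

lemma triangle_phases:
  fixes A B C :: real
  assumes "A \<ge> 0" "B \<ge> 0" "C \<ge> 0" "A \<le> B + C" "B \<le> A + C" "C \<le> A + B"
  obtains u v :: complex where "norm u = 1" "norm v = 1" "A + B * u + C * v = 0"
proof -
  define \<phi> where "\<phi> x = norm (A + B * cis x)" for x
  have "\<phi> pi \<le> C"
  proof -
    have "\<phi> pi = norm (complex_of_real (A - B))" by (simp add: \<phi>_def)
    then have "\<phi> pi = \<bar>A - B\<bar>" by (simp only: norm_of_real)
    then show ?thesis using assms by simp
  qed
  moreover have "C \<le> \<phi> 0"
  proof -
    have "\<phi> 0 = norm (complex_of_real (A + B))" by (simp add: \<phi>_def)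
    then have "\<phi> 0 = \<bar>A + B\<bar>" by (simp only: norm_of_real)
    then show ?thesis using assms by simp
  qed
  moreover have "continuous_on {0..pi} \<phi>" unfolding \<phi>_def by (intro continuous_intros)
  ultimately obtain x where x: "\<phi> x = C" using IVT2'[of \<phi> pi C 0] by auto
  define w where "w = A + B * cis x"
  have w: "norm w = C" using x by (simp add: \<phi>_def w_def)
  show ?thesis
  proof (cases "C = 0")
    case True
    then have "w = 0" using w by simp
    then show ?thesis using that[of "cis x" 1] True by (simp add: w_def)
  next
    case False
    show ?thesis
    proof (rule that[of "cis x" "- w / C"])
      show "norm (- w / C) = 1" using w False assms(3) by (simp add: norm_divide)
      show "A + B * cis x + C * (- w / C) = 0" using False by (simp add: w_def)
    qed simp
  qed
qed

text \<open>Cutting at the first partial sum that reaches \<open>S / 2\<close> splits the terms into three groups,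
  each of sum at most \<open>S / 2\<close>; the terms of one group get the same phase.\<close>

lemma polygon_phases:
  fixes r :: "nat \<Rightarrow> real"
  assumes nonneg: "\<And>i. i \<in> I \<Longrightarrow> r i \<ge> 0" and sm: "r summable_on I"
    and S: "infsum r I > 0" and half: "\<And>i. i \<in> I \<Longrightarrow> 2 * r i \<le> infsum r I"
  obtains w :: "nat \<Rightarrow> complex" where "\<And>i. norm (w i) = 1" "(\<Sum>\<^sub>\<infinity>i\<in>I. r i * w i) = 0"
proof -
  define P where "P k = sum r (I \<inter> {..<k})" for k
  have "(r has_sum infsum r I) I" using sm by simp
  then have "\<forall>\<^sub>F F in finite_subsets_at_top I. sum r F > infsum r I / 2"
    unfolding has_sum_def using S by (intro order_tendstoD) auto
  then obtain F where F: "finite F" "F \<subseteq> I" "sum r F > infsum r I / 2"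
    unfolding eventually_finite_subsets_at_top by blast
  obtain k0 where "F \<subseteq> {..<k0}" using F(1) finite_nat_iff_bounded by blast
  then have "sum r F \<le> P k0" unfolding P_def using F nonneg by (intro sum_mono2) auto
  then have ex: "P k0 \<ge> infsum r I / 2" using F by simp
  define k where "k = (LEAST k. P k \<ge> infsum r I / 2)"
  have k: "P k \<ge> infsum r I / 2" unfolding k_def by (rule LeastI[of "\<lambda>k. P k \<ge> infsum r I / 2", OF ex])
  have least: "P j < infsum r I / 2" if "j < k" for j
    using not_less_Least[OF that[unfolded k_def]] by simp
  have "P 0 = 0" by (simp add: P_def)
  \<comment> \<open>The predecessor \<open>j\<close> of \<open>k\<close> is the index at which the
    partial sums cross half of the total; it forms the middle group by itself.\<close>
  with k S have "k \<noteq> 0" by (intro notI) simp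
  then obtain j where j: "k = Suc j" by (cases k) auto
  have I_eq: "I \<inter> {..<Suc j} = (I \<inter> {..<j}) \<union> (I \<inter> {j})" by auto
  have Psuc: "P (Suc j) = P j + sum r (I \<inter> {j})"
    unfolding P_def I_eq by (rule sum.union_disjoint) auto
  define C where "C = infsum r (I - {..<Suc j})"
  have fin: "finite (I \<inter> {..<Suc j})" by simp
  have "infsum r (I - I \<inter> {..<Suc j}) = infsum r I - infsum r (I \<inter> {..<Suc j})"
    using sm by (intro infsum_Diff) (auto intro: summable_on_finite)
  moreover have "I - I \<inter> {..<Suc j} = I - {..<Suc j}" by auto
  ultimately have C: "C = infsum r I - P (Suc j)" by (simp add: C_def P_def)
  have C0: "C \<ge> 0" unfolding C_def using nonneg by (intro infsum_nonneg) auto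
  define A where "A = P j"
  \<comment> \<open>A single term is at most half by hypothesis. Written as a sum over
    \<open>I \<inter> {j}\<close>, the group needs no proof that \<open>j\<close> belongs to
    \<open>I\<close>.\<close>
  define B where "B = sum r (I \<inter> {j})"
  have A: "A \<ge> 0" "A \<le> infsum r I / 2"
    unfolding A_def using least[of j] j nonneg by (auto simp: P_def intro!: sum_nonneg)
  have B: "B \<ge> 0" "B \<le> infsum r I / 2"
    unfolding B_def using nonneg half S by (cases "j \<in> I"; force)+
  have sum: "A + B + C = infsum r I" using C Psuc by (simp add: A_def B_def)
  have C2: "C \<le> infsum r I / 2" using k C j by simp
  obtain u v :: complex where uv: "norm u = 1" "norm v = 1" "A + B * u + C * v = 0"
    by (rule triangle_phases[of A B C]) (use A B C0 C2 sum in auto)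
  have sm2: "r summable_on (I - {..<Suc j})" using sm by (rule summable_on_subset_banach) auto
  define w where "w i = (if i < j then 1 else if i = j then u else v)" for i
  have "(\<Sum>\<^sub>\<infinity>i\<in>I. r i * w i) = (\<Sum>\<^sub>\<infinity>i\<in>I \<inter> {..<Suc j} \<union> (I - {..<Suc j}). r i * w i)"
    by (rule arg_cong[where f = "infsum _"]) auto
  also have "\<dots> = (\<Sum>\<^sub>\<infinity>i\<in>I \<inter> {..<Suc j}. r i * w i) + (\<Sum>\<^sub>\<infinity>i\<in>I - {..<Suc j}. r i * w i)"
  proof (rule infsum_Un_disjoint)
    have "(\<lambda>i. complex_of_real (r i) * v) summable_on (I - {..<Suc j})"
      by (intro summable_on_cmult_left summable_on_of_real sm2)
    then show "(\<lambda>i. r i * w i) summable_on (I - {..<Suc j})"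
      by (rule summable_on_cong[THEN iffD1, rotated]) (auto simp: w_def)
  qed (auto intro: summable_on_finite)
  also have "(\<Sum>\<^sub>\<infinity>i\<in>I - {..<Suc j}. r i * w i) = (\<Sum>\<^sub>\<infinity>i\<in>I - {..<Suc j}. complex_of_real (r i) * v)"
    by (rule infsum_cong) (auto simp: w_def)
  also have "\<dots> = C * v"
    unfolding infsum_cmult_left' infsumI[OF has_sum_of_real_iff[THEN iffD2, OF has_sum_infsum[OF sm2]]] C_def ..
  also have "(\<Sum>\<^sub>\<infinity>i\<in>I \<inter> {..<Suc j}. r i * w i) = (\<Sum>i\<in>I \<inter> {..<Suc j}. r i * w i)" by simp
  also have "\<dots> = (\<Sum>i\<in>I \<inter> {..<j}. r i * w i) + (\<Sum>i\<in>I \<inter> {j}. r i * w i)"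
    unfolding I_eq by (rule sum.union_disjoint) auto
  also have "(\<Sum>i\<in>I \<inter> {..<j}. r i * w i) = A" by (simp add: A_def P_def w_def)
  also have "(\<Sum>i\<in>I \<inter> {j}. r i * w i) = B * u" by (cases "j \<in> I") (auto simp: B_def w_def)
  finally have "(\<Sum>\<^sub>\<infinity>i\<in>I. r i * w i) = 0" using uv(3) by simp
  moreover have "norm (w i) = 1" for i using uv by (simp add: w_def)
  ultimately show ?thesis using that by blast
qed

section \<open>Kronecker's theorem for prescribed phases\<close>

lemma lin_indep_over_Q_imp_int:
  assumes "lin_indep_over_Q S"
  shows "module.independent (\<lambda>r. (*) (real_of_int r)) S"
proof -
  interpret V: vector_space "\<lambda>(q::rat) (x::real). of_rat q * x" by (rule vector_space_rat_real)
  interpret Z: Modules.module "\<lambda>r. (*) (real_of_int r)"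
    by unfold_locales (simp_all add: algebra_simps)
  show ?thesis
  proof
    assume "Z.dependent S"
    then obtain T u where T: "finite T" "T \<subseteq> S" "(\<Sum>v\<in>T. real_of_int (u v) * v) = 0" "\<exists>v\<in>T. u v \<noteq> 0"
      unfolding Z.dependent_explicit by blast
    then have "(\<Sum>v\<in>T. real_of_rat (of_int (u v)) * v) = 0" "\<exists>v\<in>T. of_int (u v) \<noteq> (0::rat)" by auto
    then have "V.dependent S" unfolding V.dependent_explicit using T(1,2)
      by (intro exI[of _ T] exI[of _ "\<lambda>v. of_int (u v)"]) simp
    then show False using assms by (simp add: lin_indep_over_Q_def)
  qed
qed

lemma kronecker_cis:
  fixes l :: "'a \<Rightarrow> real" and w :: "'a \<Rightarrow> complex"
  assumes "finite J" "inj_on l J" "lin_indep_over_Q S" "l ` J \<subseteq> S"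
    and w: "\<And>i. i \<in> J \<Longrightarrow> norm (w i) = 1" and "\<epsilon> > 0"
  obtains t where "\<And>i. i \<in> J \<Longrightarrow> norm (cis (l i * t) - w i) \<le> \<epsilon>"
proof -
  interpret V: vector_space "\<lambda>(q::rat) (x::real). of_rat q * x" by (rule vector_space_rat_real)
  define n where "n = card J"
  obtain e where "bij_betw e {0..<n} J" using ex_bij_betw_nat_finite[OF assms(1)] by (auto simp: n_def)
  then have e: "e ` {..<n} = J" "inj_on e {..<n}" by (auto simp: bij_betw_def atLeast0LessThan)
  define \<theta> where "\<theta> k = l (e k)" for k
  define \<psi> where "\<psi> k = Arg (w (e k)) / (2 * pi)" for k
  have img: "\<theta> ` {..<n} = l ` J" using e(1) by (auto simp: \<theta>_def)
  have "lin_indep_over_Q (\<theta> ` {..<n})"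
    using assms(3,4) V.independent_mono unfolding img lin_indep_over_Q_def by blast
  moreover have "inj_on \<theta> {..<n}"
    using comp_inj_on[OF e(2), of l] assms(2) e(1) by (simp add: \<theta>_def[abs_def] o_def)
  moreover have "\<epsilon> / (2 * pi) > 0" using assms(6) by simp
  ultimately obtain t h where th: "\<And>k. k < n \<Longrightarrow> \<bar>t * \<theta> k - of_int (h k) - \<psi> k\<bar> < \<epsilon> / (2 * pi)"
    using Kronecker_thm_1[OF lin_indep_over_Q_imp_int, of \<theta> n "\<epsilon> / (2 * pi)" \<psi>] by metis
  show ?thesis
  \<comment> \<open>Kronecker's theorem measures phases in full turns and modulo integers; passing
    to radians explains both this factor and the tolerance
    \<open>\<epsilon> / (2 * pi)\<close>.\<close>
  proof (rule that[of "2 * pi * t"])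
    fix i assume "i \<in> J"
    then obtain k where k: "k < n" "i = e k" using e(1) by auto
    have wi: "w i = cis (2 * pi * \<psi> k)"
      using rcis_cmod_Arg[of "w i"] w[OF \<open>i \<in> J\<close>] by (simp add: \<psi>_def k(2) rcis_def)
    have "cis (l i * (2 * pi * t)) = cis (2 * pi * (t * \<theta> k - of_int (h k))) * cis (2 * pi * of_int (h k))"
      unfolding cis_mult by (simp add: \<theta>_def k(2) algebra_simps)
    also have "cis (2 * pi * of_int (h k)) = 1" by (rule cis_multiple_2pi) simp
    finally have "norm (cis (l i * (2 * pi * t)) - w i) = norm (cis (2 * pi * (t * \<theta> k - of_int (h k))) - cis (2 * pi * \<psi> k))"
      unfolding wi by simp
    also have "\<dots> \<le> \<bar>2 * pi * (t * \<theta> k - of_int (h k)) - 2 * pi * \<psi> k\<bar>" by (rule norm_cis_diff_le)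
    also have "\<dots> = 2 * pi * \<bar>t * \<theta> k - of_int (h k) - \<psi> k\<bar>"
      by (simp add: abs_mult flip: right_diff_distrib)
    also have "\<dots> \<le> \<epsilon>" using th[OF k(1)] by (simp add: field_simps)
    finally show "norm (cis (l i * (2 * pi * t)) - w i) \<le> \<epsilon>" .
  qed
qed

section \<open>Existence of a zero\<close>

lemma exists_zero_if_polygon:
  assumes ab: "\<alpha> < \<beta>" and ap: "almost_periodic_in f \<alpha> \<beta>" and dir: "is_dirichlet_series f \<alpha> \<beta> N a l"
    and indep: "lin_indep_over_Q (fourier_exponents f \<alpha> \<beta>)"
    and \<sigma>: "\<sigma> \<in> einterval \<alpha> \<beta>" and ne: "dirichlet_index N \<noteq> {}"
    and half: "\<And>i. i \<in> dirichlet_index N \<Longrightarrow>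
      2 * (norm (a i) * exp (\<sigma> * l i)) \<le> (\<Sum>\<^sub>\<infinity>i\<in>dirichlet_index N. norm (a i) * exp (\<sigma> * l i))"
  shows "\<exists>s\<in>vstrip \<alpha> \<beta>. f s = 0"
proof (rule ccontr)
  assume nz: "\<not> ?thesis"
  define I where "I = dirichlet_index N"
  note D = is_dirichlet_series_coeff[OF ab ap dir, folded I_def]
  note E = dirichlet_series_converges[OF ab ap dir indep, folded I_def]
  define r where "r x i = norm (a i) * exp (x * l i)" for x i
  have sm: "r x summable_on I" if "x \<in> einterval \<alpha> \<beta>" for x
    using E(1)[of "Complex x 0"] that by (simp add: vstrip_def r_def[abs_def])
  obtain i0 where i0: "i0 \<in> I" using ne by (auto simp: I_def)
  have "r \<sigma> i0 \<le> infsum (r \<sigma>) I"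
    using finite_sum_le_infsum[OF sm[OF \<sigma>], of "{i0}"] i0 by (simp add: r_def)
  moreover have "r \<sigma> i0 > 0" using D(4)[OF i0] by (simp add: r_def)
  ultimately have S: "infsum (r \<sigma>) I > 0" by linarith
  obtain \<theta> :: "nat \<Rightarrow> complex" where \<theta>: "\<And>i. norm (\<theta> i) = 1" "(\<Sum>\<^sub>\<infinity>i\<in>I. r \<sigma> i * \<theta> i) = 0"
    by (rule polygon_phases[OF _ sm[OF \<sigma>] S]) (use half in \<open>auto simp: r_def[abs_def] I_def\<close>)
  \<comment> \<open>The closing phases belong to the moduli. Multiplying by the conjugate sign of
    \<open>a i\<close> cancels its argument; the value 1 outside \<open>I\<close> only keeps all
    norms equal to 1.\<close>
  define w where "w i = (if i \<in> I then \<theta> i * cnj (sgn (a i)) else 1)" for i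
  have w: "norm (w i) = 1" for i using \<theta>(1) D(4) by (simp add: w_def norm_mult norm_sgn)
  have aw: "a i * w i = of_real (norm (a i)) * \<theta> i" if "i \<in> I" for i
  proof -
    have "a i * cnj (sgn (a i)) = of_real (norm (a i))"
      using D(4)[OF that] by (simp add: sgn_eq complex_norm_square[symmetric] power2_eq_square)
    then show ?thesis using that by (simp add: w_def mult_ac)
  qed
  define u where "u s i = a i * exp (of_real (l i) * s)" for s i
  have nu: "norm (u s i) = r (Re s) i" for s i by (simp add: u_def r_def norm_mult mult.commute)
  define g where "g s = (\<Sum>\<^sub>\<infinity>i\<in>I. u s i * w i)" for s
  \<comment> \<open>Kronecker's theorem handles finitely many exponents at a time, so the n-th
    translate matches the first n phases up to 1/(n + 1).\<close>
  have "\<exists>t. \<forall>i\<in>I \<inter> {..<n}. norm (cis (l i * t) - w i) \<le> inverse (Suc n)" for n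
    using kronecker_cis[of "I \<inter> {..<n}" l "fourier_exponents f \<alpha> \<beta>" w "inverse (Suc n)"]
      inj_on_subset[OF D(1)] indep D(2) w by (metis finite_Int finite_lessThan image_mono inf_le1 inverse_positive_iff_positive of_nat_0_less_iff zero_less_Suc)
  then obtain t where t: "\<And>n i. i \<in> I \<Longrightarrow> i < n \<Longrightarrow> norm (cis (l i * t n) - w i) \<le> inverse (Suc n)"
    by (metis IntI lessThan_iff)
  define fn where "fn n s = f (s + \<i> * of_real (t n))" for n s
  have shift: "s + \<i> * of_real x \<in> vstrip \<alpha> \<beta>" if "s \<in> vstrip \<alpha> \<beta>" for s x
    using that by (simp add: vstrip_def)
  have fn_eq: "fn n s = (\<Sum>\<^sub>\<infinity>i\<in>I. u s i * cis (l i * t n))" if "s \<in> vstrip \<alpha> \<beta>" for n s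
    unfolding fn_def E(2)[OF shift[OF that]]
    by (intro infsum_cong) (simp add: u_def cis_conv_exp ring_distribs exp_add mult_ac)
  have us: "(\<lambda>i. u s i * c i) summable_on I" if "s \<in> vstrip \<alpha> \<beta>" "\<And>i. norm (c i) \<le> 1" for s c
  proof (rule abs_summable_summable, rule summable_on_comparison_test)
    show "r (Re s) summable_on I" using that by (intro sm) (simp add: vstrip_def)
    show "norm (u s i * c i) \<le> r (Re s) i" for i
      using that(2)[of i] mult_left_mono[of "norm (c i)" 1 "r (Re s) i"] by (simp add: norm_mult nu r_def)
  qed auto
  have unif: "uniform_limit K fn g sequentially"
    if K: "\<And>s. s \<in> K \<Longrightarrow> x \<le> Re s \<and> Re s \<le> y" and x: "x \<in> einterval \<alpha> \<beta>" and y: "y \<in> einterval \<alpha> \<beta>" for K x y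
  proof (rule uniform_limitI)
    fix e :: real assume e: "e > 0"
    have KU: "s \<in> vstrip \<alpha> \<beta>" if "s \<in> K" for s
      using x y K[OF that] unfolding vstrip_def einterval_iff mem_Collect_eq
      by (meson ereal_less_eq(3) le_less_trans less_le_trans)
    \<comment> \<open>A term between two abscissae is at most the sum of its values at both; the
      factor 2 bounds the difference of two unimodular phases.\<close>
    define M where "M i = 2 * (r x i + r y i)" for i
    have M: "M summable_on I" unfolding M_def[abs_def] by (intro summable_on_cmult_right summable_on_add sm x y)
    have uM: "2 * norm (u s i) \<le> M i" if "s \<in> K" for s i
    proof -
      have "Re s * l i \<le> max (x * l i) (y * l i)"
      proof (cases "l i \<ge> 0")
        case True
        then have "Re s * l i \<le> y * l i" using K[OF that] by (intro mult_right_mono) auto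
        then show ?thesis by simp
      next
        case False
        then have "Re s * l i \<le> x * l i" using K[OF that] by (intro mult_right_mono_neg) auto
        then show ?thesis by simp
      qed
      then have "exp (Re s * l i) \<le> max (exp (x * l i)) (exp (y * l i))"
        by (auto simp: max_def split: if_splits intro: order_trans)
      also have "\<dots> \<le> exp (x * l i) + exp (y * l i)" by (simp add: max_def add_increasing add_increasing2)
      finally have "norm (a i) * exp (Re s * l i) \<le> norm (a i) * (exp (x * l i) + exp (y * l i))"
        by (rule mult_left_mono) simp
      then show ?thesis by (simp add: nu M_def r_def distrib_left)
    qed
    have M0: "M i \<ge> 0" for i by (simp add: M_def r_def)
    obtain F where F: "finite F" "F \<subseteq> I"
      "\<And>v :: nat \<Rightarrow> complex. (\<And>i. i \<in> I \<Longrightarrow> norm (v i) \<le> M i) \<Longrightarrow> norm (infsum v I - sum v F) \<le> e/4"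
      using summable_on_uniform_tail[OF M, of "e/4"] e by auto
    obtain k0 where k0: "F \<subseteq> {..<k0}" using F(1) finite_nat_iff_bounded by blast
    have "(\<lambda>n. inverse (real (Suc n)) * sum M F) \<longlonglongrightarrow> 0 * sum M F"
      by (intro tendsto_mult LIMSEQ_inverse_real_of_nat tendsto_const)
    then have "\<forall>\<^sub>F n in sequentially. inverse (real (Suc n)) * sum M F < e/4"
      using e by (intro order_tendstoD) auto
    moreover have "\<forall>\<^sub>F n in sequentially. n \<ge> k0" by (rule eventually_ge_at_top)
    ultimately show "\<forall>\<^sub>F n in sequentially. \<forall>s\<in>K. dist (fn n s) (g s) < e"
    proof eventually_elim
      case (elim n)
      show ?case
      proof
        fix s assume s: "s \<in> K"
        define v where "v i = u s i * cis (l i * t n) - u s i * w i" for i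
        have v_eq: "v i = u s i * (cis (l i * t n) - w i)" for i by (simp add: v_def right_diff_distrib)
        have "norm (v i) \<le> M i" for i
        proof -
          have "norm (cis (l i * t n) - w i) \<le> 2"
            using norm_triangle_ineq4[of "cis (l i * t n)" "w i"] w[of i] by simp
          then have "norm (v i) \<le> norm (u s i) * 2" unfolding v_eq norm_mult by (rule mult_left_mono) simp
          then show ?thesis using uM[OF s, of i] by simp
        qed
        then have 1: "norm (infsum v I - sum v F) \<le> e/4" by (intro F(3))
        have "norm (sum v F) \<le> (\<Sum>i\<in>F. inverse (real (Suc n)) * M i)"
        proof (rule sum_norm_le)
          fix i assume i: "i \<in> F"
          have "norm (cis (l i * t n) - w i) \<le> inverse (Suc n)"
            by (rule t) (use i F(2) k0 elim in auto)
          moreover have "norm (u s i) \<le> M i" using uM[OF s, of i] norm_ge_zero[of "u s i"] by linarith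
          ultimately have "norm (u s i) * norm (cis (l i * t n) - w i) \<le> M i * inverse (Suc n)"
            using M0 by (intro mult_mono) auto
          then show "norm (v i) \<le> inverse (real (Suc n)) * M i" unfolding v_eq norm_mult by (simp add: mult.commute)
        qed
        then have 2: "norm (sum v F) < e/4" using elim by (simp add: sum_distrib_left)
        have "fn n s - g s = infsum v I"
        proof -
          have "((\<lambda>i. u s i * cis (l i * t n) + - (u s i * w i)) has_sum (fn n s + - g s)) I"
            unfolding fn_eq[OF KU[OF s]] g_def
            by (intro has_sum_add has_sum_uminusI has_sum_infsum us KU s) (simp_all add: w)
          then show ?thesis by (simp add: infsumI v_def[abs_def])
        qed
        then have "norm (fn n s - g s) \<le> norm (infsum v I - sum v F) + norm (sum v F)"
          by (metis diff_add_cancel norm_triangle_ineq)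
        then show "dist (fn n s) (g s) < e" using 1 2 e by (simp add: dist_norm)
      qed
    qed
  qed
  have unifK: "uniform_limit K fn g sequentially" if K: "compact K" "K \<subseteq> vstrip \<alpha> \<beta>" for K
  proof (cases "K = {}")
    case False
    have "compact (Re ` K)" by (intro compact_continuous_image continuous_intros K)
    moreover have "Re ` K \<noteq> {}" using False by simp
    ultimately obtain x y where "x \<in> Re ` K" "\<And>z. z \<in> Re ` K \<Longrightarrow> x \<le> z" "y \<in> Re ` K" "\<And>z. z \<in> Re ` K \<Longrightarrow> z \<le> y"
      using compact_attains_inf compact_attains_sup by metis
    then show ?thesis using K(2) by (intro unif[of K x y]) (auto simp: vstrip_def)
  qed simp
  have hol: "f holomorphic_on vstrip \<alpha> \<beta>" using ap by (simp add: almost_periodic_in_def)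
  have holn: "fn n holomorphic_on vstrip \<alpha> \<beta>" for n
    unfolding fn_def using holomorphic_on_compose_gen[OF _ hol, of "\<lambda>s. s + \<i> * of_real (t n)" "vstrip \<alpha> \<beta>"] shift
    by (simp add: o_def image_subset_iff holomorphic_intros)
  have holg: "g holomorphic_on vstrip \<alpha> \<beta>"
  proof (rule holomorphic_uniform_sequence[OF open_vstrip holn])
    fix s assume "s \<in> vstrip \<alpha> \<beta>"
    then obtain d where "d > 0" "cball s d \<subseteq> vstrip \<alpha> \<beta>"
      using open_vstrip open_contains_cball by blast
    then show "\<exists>d>0. cball s d \<subseteq> vstrip \<alpha> \<beta> \<and> uniform_limit (cball s d) fn g sequentially"
      using unifK[OF compact_cball] by blast
  qed
  define s0 where "s0 = Complex \<sigma> 0"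
  have s0: "s0 \<in> vstrip \<alpha> \<beta>" using \<sigma> by (simp add: s0_def vstrip_def)
  have u0: "u (Complex \<sigma> x) i * w i = r \<sigma> i * \<theta> i * cis (l i * x)" if "i \<in> I" for i x
    using aw[OF that] exp_Complex_line[of "l i" \<sigma> x] by (simp add: u_def r_def mult_ac)
  have g0: "g s0 = 0"
  proof -
    have "g s0 = (\<Sum>\<^sub>\<infinity>i\<in>I. r \<sigma> i * \<theta> i)"
      unfolding g_def s0_def by (rule infsum_cong) (use u0[of _ 0] in simp)
    then show ?thesis using \<theta>(2) by simp
  qed
  \<comment> \<open>A constant limit would be 0, because it vanishes at \<open>s0\<close>. But on
    the line through \<sigma> it is an absolutely convergent series with the nonzero coefficient
    \<open>r \<sigma> i0 * \<theta> i0\<close>.\<close>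
  have nonconst: "\<not> g constant_on vstrip \<alpha> \<beta>"
  proof
    assume "g constant_on vstrip \<alpha> \<beta>"
    then have const: "g s = 0" if "s \<in> vstrip \<alpha> \<beta>" for s
      using g0 s0 that unfolding constant_on_def by metis
    have "(\<lambda>i. norm (r \<sigma> i * \<theta> i)) summable_on I"
      using sm[OF \<sigma>] by (simp add: norm_mult \<theta>(1) r_def[abs_def])
    from has_mean_infsum_cis[OF this D(1) i0]
    have "has_mean (\<lambda>x. (\<Sum>\<^sub>\<infinity>i\<in>I. r \<sigma> i * \<theta> i * cis (l i * x)) * cis (- (l i0 * x))) (r \<sigma> i0 * \<theta> i0)" .
    moreover have "(\<Sum>\<^sub>\<infinity>i\<in>I. r \<sigma> i * \<theta> i * cis (l i * x)) = 0" for x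
    proof -
      have "(\<Sum>\<^sub>\<infinity>i\<in>I. r \<sigma> i * \<theta> i * cis (l i * x)) = g (Complex \<sigma> x)"
        unfolding g_def by (rule infsum_cong) (simp add: u0)
      then show ?thesis using const \<sigma> by (simp add: vstrip_def)
    qed
    ultimately have "has_mean (\<lambda>x. 0) (r \<sigma> i0 * \<theta> i0)" by simp
    then have "r \<sigma> i0 * \<theta> i0 = 0" using has_mean_unique has_mean_const by blast
    moreover have "\<theta> i0 \<noteq> 0" using \<theta>(1)[of i0] by auto
    ultimately show False using \<open>r \<sigma> i0 > 0\<close> by simp
  qed
  have "fn n z \<noteq> 0" if "z \<in> vstrip \<alpha> \<beta>" for n z
    using nz shift[OF that] by (auto simp: fn_def)
  with open_vstrip convex_connected[OF convex_vstrip] holn holg unifK nonconst have "g s0 \<noteq> 0"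
    using s0 by (rule Hurwitz_no_zeros)
  then show False using g0 by simp
qed

section \<open>The series near the ends of the strip\<close>

lemma abs_dirichlet_sum_eq:
  assumes "(\<lambda>i. norm (a i) * exp (\<sigma> * l i)) summable_on dirichlet_index N"
  shows "abs_dirichlet_sum N a l \<sigma> = ennreal (\<Sum>\<^sub>\<infinity>i\<in>dirichlet_index N. norm (a i) * exp (\<sigma> * l i))"
  unfolding abs_dirichlet_sum_def
  by (subst nonneg_infsum_complete, simp, subst infsum_nonneg_is_SUPREMUM_ennreal[OF assms])
     (auto intro!: SUP_cong sum_ennreal)

text \<open>Away from a finite set of indices the terms at \<open>\<sigma>1\<close> are below a bound \<open>m\<close> that exceeds the
  terms at the endpoint \<open>x\<close>, and by convexity this persists between \<open>x\<close> and \<open>\<sigma>1\<close>; the finitely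
  many other terms converge to their values at \<open>x\<close>.\<close>

lemma polygon_near_endpoint:
  fixes G :: "real filter"
  assumes "G \<noteq> bot"
    and sm: "\<And>\<sigma>. \<sigma> \<in> S \<Longrightarrow> (\<lambda>i. norm (a i) * exp (\<sigma> * l i)) summable_on dirichlet_index N"
    and \<sigma>1: "\<sigma>1 \<in> S"
    and between: "\<forall>\<^sub>F \<sigma> in G. \<sigma> \<in> S \<and> (\<forall>y. ennreal (exp (\<sigma> * y)) \<le> max (eexp_mult x y) (ennreal (exp (\<sigma>1 * y))))"
    and lim: "\<And>y. ((\<lambda>\<sigma>. ennreal (exp (\<sigma> * y))) \<longlongrightarrow> eexp_mult x y) G"
    and L: "(abs_dirichlet_sum N a l \<longlongrightarrow> L) G" "L > 2 * dirichlet_term_sup N a l x"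
  shows "\<exists>\<sigma>\<in>S. \<forall>i\<in>dirichlet_index N.
    2 * (norm (a i) * exp (\<sigma> * l i)) \<le> (\<Sum>\<^sub>\<infinity>i\<in>dirichlet_index N. norm (a i) * exp (\<sigma> * l i))"
proof -
  define I where "I = dirichlet_index N"
  \<comment> \<open>\<open>L\<close> may be infinite. The intermediate value is finite, and its half
    \<open>m\<close> will bound every single term while the sum exceeds
    \<open>2 * m\<close>.\<close>
  obtain y where y: "2 * dirichlet_term_sup N a l x < y" "y < L" using dense[OF L(2)] by blast
  have "y < top" using y(2) top_greatest by (rule less_le_trans)
  then obtain y' where y': "y = ennreal y'" "y' \<ge> 0" by (cases y) auto
  define m where "m = y' / 2"
  have y2: "y = 2 * ennreal m" using y' by (simp add: m_def ennreal_mult'[symmetric] flip: ennreal_numeral)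
  have Dm: "dirichlet_term_sup N a l x < ennreal m"
    using y(1) unfolding y2 by (metis mult_left_mono not_le zero_le)
  have m: "m > 0" using Dm y'(2) by (auto simp: m_def less_le intro!: ccontr[of "0 < y'"])
  have end_lt: "ennreal (norm (a i)) * eexp_mult x (l i) < ennreal m" if "i \<in> I" for i
    using Dm that unfolding dirichlet_term_sup_def I_def by (meson SUP_upper le_less_trans)
  obtain F where F: "finite F" "F \<subseteq> I"
    "\<And>u :: nat \<Rightarrow> complex. (\<And>i. i \<in> I \<Longrightarrow> norm (u i) \<le> norm (a i) * exp (\<sigma>1 * l i)) \<Longrightarrow> norm (infsum u I - sum u F) \<le> m/2"
    using summable_on_uniform_tail[OF sm[OF \<sigma>1], of "m/2"] m unfolding I_def by auto
  have small: "norm (a i) * exp (\<sigma>1 * l i) < m" if i: "i \<in> I" "i \<notin> F" for i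
  proof -
    \<comment> \<open>The uniform tail bound, applied to a family supported at the single index i,
      bounds that one term.\<close>
    define u where "u k = (if k = i then complex_of_real (norm (a i) * exp (\<sigma>1 * l i)) else 0)" for k
    have "norm (infsum u I - sum u F) \<le> m/2"
      by (rule F(3)) (auto simp: u_def norm_mult)
    moreover have "sum u F = 0" using i by (intro sum.neutral) (auto simp: u_def)
    moreover have "infsum u I = infsum u {i}"
      by (rule infsum_cong_neutral) (use i in \<open>auto simp: u_def\<close>)
    ultimately show ?thesis using m by (simp add: u_def norm_mult)
  qed
  have "\<forall>\<^sub>F \<sigma> in G. ennreal (norm (a i)) * ennreal (exp (\<sigma> * l i)) < ennreal m" if "i \<in> F" for i
    using ennreal_tendsto_cmult[OF _ lim] end_lt F(2) that by (intro order_tendstoD) auto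
  then have "\<forall>\<^sub>F \<sigma> in G. \<forall>i\<in>F. ennreal (norm (a i)) * ennreal (exp (\<sigma> * l i)) < ennreal m"
    using F(1) by (simp add: eventually_ball_finite)
  moreover have "\<forall>\<^sub>F \<sigma> in G. abs_dirichlet_sum N a l \<sigma> > y" using L(1) y(2) by (rule order_tendstoD)
  ultimately have "\<forall>\<^sub>F \<sigma> in G. \<sigma> \<in> S \<and> (\<forall>y. ennreal (exp (\<sigma> * y)) \<le> max (eexp_mult x y) (ennreal (exp (\<sigma>1 * y))))
      \<and> (\<forall>i\<in>F. ennreal (norm (a i)) * ennreal (exp (\<sigma> * l i)) < ennreal m) \<and> abs_dirichlet_sum N a l \<sigma> > y"
    using between by eventually_elim auto
  then obtain \<sigma> where \<sigma>: "\<sigma> \<in> S" "\<And>y. ennreal (exp (\<sigma> * y)) \<le> max (eexp_mult x y) (ennreal (exp (\<sigma>1 * y)))"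
      "\<And>i. i \<in> F \<Longrightarrow> ennreal (norm (a i)) * ennreal (exp (\<sigma> * l i)) < ennreal m" "abs_dirichlet_sum N a l \<sigma> > y"
    using eventually_happens'[OF assms(1)] by blast
  have le_m: "norm (a i) * exp (\<sigma> * l i) \<le> m" if "i \<in> I" for i
  proof -
    have "ennreal (norm (a i)) * ennreal (exp (\<sigma> * l i)) \<le> ennreal m"
    proof (cases "i \<in> F")
      case True
      then show ?thesis using \<sigma>(3) by (simp add: less_imp_le)
    next
      case False
      have "ennreal (norm (a i)) * ennreal (exp (\<sigma> * l i)) \<le> ennreal (norm (a i)) * max (eexp_mult x (l i)) (ennreal (exp (\<sigma>1 * l i)))"
        by (rule mult_left_mono[OF \<sigma>(2)]) simp
      also have "\<dots> \<le> ennreal m"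
        using end_lt[OF that] small[OF that False] by (auto simp: max_def less_imp_le ennreal_leI ennreal_mult'[symmetric])
      finally show ?thesis .
    qed
    then have "ennreal (norm (a i) * exp (\<sigma> * l i)) \<le> ennreal m" by (simp add: ennreal_mult)
    then show ?thesis using m by (subst (asm) ennreal_le_iff) auto
  qed
  have "ennreal y' < ennreal (\<Sum>\<^sub>\<infinity>i\<in>I. norm (a i) * exp (\<sigma> * l i))"
    using \<sigma>(4) abs_dirichlet_sum_eq[OF sm[OF \<sigma>(1)]] y'(1) by (simp add: I_def)
  then have "y' < (\<Sum>\<^sub>\<infinity>i\<in>I. norm (a i) * exp (\<sigma> * l i))" using y'(2) by (simp add: ennreal_less_iff)
  then have "2 * (norm (a i) * exp (\<sigma> * l i)) \<le> (\<Sum>\<^sub>\<infinity>i\<in>I. norm (a i) * exp (\<sigma> * l i))" if "i \<in> I" for i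
    using le_m[OF that] by (simp add: m_def)
  then show ?thesis using \<sigma>(1) unfolding I_def by blast
qed

lemma exp_mult_between:
  fixes p q x :: real
  assumes "min p q \<le> x" "x \<le> max p q"
  shows "ennreal (exp (x * y)) \<le> max (ennreal (exp (p * y))) (ennreal (exp (q * y)))"
proof -
  have "x * y \<le> max (p * y) (q * y)"
  proof (cases "y \<ge> 0")
    case True
    have "x * y \<le> max p q * y" using assms(2) True by (rule mult_right_mono)
    then show ?thesis by (auto simp: max_def split: if_splits)
  next
    case False
    have "x * y \<le> min p q * y" using assms(1) False by (intro mult_right_mono_neg) auto
    then show ?thesis by (auto simp: max_def min_def split: if_splits)
  qed
  then show ?thesis by (auto simp: max_def le_max_iff_disj ennreal_le_iff split: if_splits)
qed

text \<open>The filter on extended reals is the image of a real filter, \<open>at_right p\<close> or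
  \<open>at_bot\<close> according to the endpoint. This lets \<open>polygon_near_endpoint\<close>
  treat finite and infinite endpoints alike.\<close>

lemma at_right_endpoint:
  assumes "\<sigma>1 \<in> einterval \<alpha> \<beta>"
  obtains G :: "real filter" where "G \<noteq> bot" "at_right \<alpha> = filtermap ereal G"
    "\<forall>\<^sub>F \<sigma> in G. \<sigma> \<in> einterval \<alpha> \<beta> \<and> (\<forall>y. ennreal (exp (\<sigma> * y)) \<le> max (eexp_mult \<alpha> y) (ennreal (exp (\<sigma>1 * y))))"
    "\<forall>y. ((\<lambda>\<sigma>. ennreal (exp (\<sigma> * y))) \<longlongrightarrow> eexp_mult \<alpha> y) G"
proof (cases \<alpha>)
  case (real p)
  have p: "p < \<sigma>1" "ereal \<sigma>1 < \<beta>" using assms real by (auto simp: einterval_iff)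
  show ?thesis
  proof (rule that[of "at_right p"])
    have "\<forall>\<^sub>F \<sigma> in at_right p. \<sigma> \<in> {p<..<\<sigma>1}" by (rule eventually_at_right_real[OF p(1)])
    then show "\<forall>\<^sub>F \<sigma> in at_right p. \<sigma> \<in> einterval \<alpha> \<beta> \<and> (\<forall>y. ennreal (exp (\<sigma> * y)) \<le> max (eexp_mult \<alpha> y) (ennreal (exp (\<sigma>1 * y))))"
    proof eventually_elim
      case (elim \<sigma>)
      have "ereal \<sigma> < \<beta>" using elim by (intro less_trans[OF _ p(2)]) simp
      then show ?case using elim exp_mult_between[of p \<sigma>1 \<sigma>] p real by (simp add: einterval_iff)
    qed
    show "\<forall>y. ((\<lambda>\<sigma>. ennreal (exp (\<sigma> * y))) \<longlongrightarrow> eexp_mult \<alpha> y) (at_right p)"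
      unfolding real eexp_mult_simps by (intro allI tendsto_ennrealI tendsto_intros)
  qed (simp_all add: real at_right_ereal)
next
  case PInf
  then show ?thesis using assms by (simp add: einterval_iff)
next
  case MInf
  show ?thesis
  proof (rule that[of at_bot])
    have "\<forall>\<^sub>F \<sigma> in at_bot. \<sigma> \<le> \<sigma>1" by (rule eventually_le_at_bot)
    then show "\<forall>\<^sub>F \<sigma> in at_bot. \<sigma> \<in> einterval \<alpha> \<beta> \<and> (\<forall>y. ennreal (exp (\<sigma> * y)) \<le> max (eexp_mult \<alpha> y) (ennreal (exp (\<sigma>1 * y))))"
    proof eventually_elim
      case (elim \<sigma>)
      have "ereal \<sigma> < \<beta>" using elim assms le_less_trans[of "ereal \<sigma>" "ereal \<sigma>1" \<beta>] by (simp add: einterval_iff)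
      \<comment> \<open>For negative y the value at the endpoint is infinite, for y = 0 all values
        are 1, and for positive y monotonicity compares with \<sigma>1.\<close>
      moreover have "ennreal (exp (\<sigma> * y)) \<le> max (eexp_mult \<alpha> y) (ennreal (exp (\<sigma>1 * y)))" for y
        using elim MInf by (cases y "0::real" rule: linorder_cases) (auto simp: le_max_iff_disj intro: ennreal_leI)
      ultimately show ?case using MInf by (simp add: einterval_iff)
    qed
    show "\<forall>y. ((\<lambda>\<sigma>. ennreal (exp (\<sigma> * y))) \<longlongrightarrow> eexp_mult \<alpha> y) at_bot"
      unfolding MInf using tendsto_eexp_mult_MInf by simp
  qed (simp_all add: MInf at_right_MInf)
qed

lemma at_left_endpoint:
  assumes "\<sigma>1 \<in> einterval \<alpha> \<beta>"
  obtains G :: "real filter" where "G \<noteq> bot" "at_left \<beta> = filtermap ereal G"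
    "\<forall>\<^sub>F \<sigma> in G. \<sigma> \<in> einterval \<alpha> \<beta> \<and> (\<forall>y. ennreal (exp (\<sigma> * y)) \<le> max (eexp_mult \<beta> y) (ennreal (exp (\<sigma>1 * y))))"
    "\<forall>y. ((\<lambda>\<sigma>. ennreal (exp (\<sigma> * y))) \<longlongrightarrow> eexp_mult \<beta> y) G"
proof (cases \<beta>)
  case (real p)
  have p: "\<sigma>1 < p" "\<alpha> < ereal \<sigma>1" using assms real by (auto simp: einterval_iff)
  show ?thesis
  proof (rule that[of "at_left p"])
    have "\<forall>\<^sub>F \<sigma> in at_left p. \<sigma> \<in> {\<sigma>1<..<p}" by (rule eventually_at_left_real[OF p(1)])
    then show "\<forall>\<^sub>F \<sigma> in at_left p. \<sigma> \<in> einterval \<alpha> \<beta> \<and> (\<forall>y. ennreal (exp (\<sigma> * y)) \<le> max (eexp_mult \<beta> y) (ennreal (exp (\<sigma>1 * y))))"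
    proof eventually_elim
      case (elim \<sigma>)
      have "\<alpha> < ereal \<sigma>" using elim by (intro less_trans[OF p(2)]) simp
      then show ?case using elim exp_mult_between[of p \<sigma>1 \<sigma>] p real by (simp add: einterval_iff)
    qed
    show "\<forall>y. ((\<lambda>\<sigma>. ennreal (exp (\<sigma> * y))) \<longlongrightarrow> eexp_mult \<beta> y) (at_left p)"
      unfolding real eexp_mult_simps by (intro allI tendsto_ennrealI tendsto_intros)
  qed (simp_all add: real at_left_ereal)
next
  case MInf
  then show ?thesis using assms by (simp add: einterval_iff)
next
  case PInf
  show ?thesis
  proof (rule that[of at_top])
    have "\<forall>\<^sub>F \<sigma> in at_top. \<sigma>1 \<le> \<sigma>" by (rule eventually_ge_at_top)
    then show "\<forall>\<^sub>F \<sigma> in at_top. \<sigma> \<in> einterval \<alpha> \<beta> \<and> (\<forall>y. ennreal (exp (\<sigma> * y)) \<le> max (eexp_mult \<beta> y) (ennreal (exp (\<sigma>1 * y))))"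
    proof eventually_elim
      case (elim \<sigma>)
      have "\<alpha> < ereal \<sigma>" using elim assms less_le_trans[of \<alpha> "ereal \<sigma>1" "ereal \<sigma>"] by (simp add: einterval_iff)
      moreover have "ennreal (exp (\<sigma> * y)) \<le> max (eexp_mult \<beta> y) (ennreal (exp (\<sigma>1 * y)))" for y
        using elim PInf by (cases y "0::real" rule: linorder_cases) (auto simp: le_max_iff_disj intro: ennreal_leI)
      ultimately show ?case using PInf by (simp add: einterval_iff)
    qed
    show "\<forall>y. ((\<lambda>\<sigma>. ennreal (exp (\<sigma> * y))) \<longlongrightarrow> eexp_mult \<beta> y) at_top"
      unfolding PInf using tendsto_eexp_mult_PInf by blast
  qed (simp_all add: PInf at_left_PInf)
qed

theorem corollary10:
  fixes f :: "complex \<Rightarrow> complex" and \<alpha> \<beta> :: ereal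
    and N :: enat and a :: "nat \<Rightarrow> complex" and l :: "nat \<Rightarrow> real"
  assumes "\<alpha> < \<beta>"
    and "almost_periodic_in f \<alpha> \<beta>"
    and "is_dirichlet_series f \<alpha> \<beta> N a l"
    and "lin_indep_over_Q (fourier_exponents f \<alpha> \<beta>)"
    and "infinite (fourier_exponents f \<alpha> \<beta>) \<or> card (fourier_exponents f \<alpha> \<beta>) \<ge> 3"
    and "largest_ap_strip f \<alpha> \<beta>"
    and "(\<exists>L. ((abs_dirichlet_sum N a l \<circ> real_of_ereal) \<longlongrightarrow> L) (at_right \<alpha>)
              \<and> L > 2 * dirichlet_term_sup N a l \<alpha>) \<or>
         (\<exists>L. ((abs_dirichlet_sum N a l \<circ> real_of_ereal) \<longlongrightarrow> L) (at_left \<beta>)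
              \<and> L > 2 * dirichlet_term_sup N a l \<beta>)"
  shows "zero_re_set f \<alpha> \<beta> \<noteq> {}"
proof -
  obtain \<sigma>1 where \<sigma>1: "\<sigma>1 \<in> einterval \<alpha> \<beta>" using einterval_nonempty[OF assms(1)] by blast
  have sm: "(\<lambda>i. norm (a i) * exp (\<sigma> * l i)) summable_on dirichlet_index N" if "\<sigma> \<in> einterval \<alpha> \<beta>" for \<sigma>
    using dirichlet_series_converges(1)[OF assms(1-4), of "Complex \<sigma> 0"] that by (simp add: vstrip_def)
  have "fourier_exponents f \<alpha> \<beta> \<noteq> {}" using assms(5) by auto
  then have ne: "dirichlet_index N \<noteq> {}"
    using is_dirichlet_series_coeff(2)[OF assms(1-3)] by blast
  have "\<exists>\<sigma>\<in>einterval \<alpha> \<beta>. \<forall>i\<in>dirichlet_index N.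
    2 * (norm (a i) * exp (\<sigma> * l i)) \<le> (\<Sum>\<^sub>\<infinity>i\<in>dirichlet_index N. norm (a i) * exp (\<sigma> * l i))"
    using assms(7)
  proof (elim disjE exE conjE)
    fix L assume L: "((abs_dirichlet_sum N a l \<circ> real_of_ereal) \<longlongrightarrow> L) (at_right \<alpha>)"
      "L > 2 * dirichlet_term_sup N a l \<alpha>"
    obtain G :: "real filter" where G: "G \<noteq> bot" "at_right \<alpha> = filtermap ereal G"
      "\<forall>\<^sub>F \<sigma> in G. \<sigma> \<in> einterval \<alpha> \<beta> \<and> (\<forall>y. ennreal (exp (\<sigma> * y)) \<le> max (eexp_mult \<alpha> y) (ennreal (exp (\<sigma>1 * y))))"
      "\<forall>y. ((\<lambda>\<sigma>. ennreal (exp (\<sigma> * y))) \<longlongrightarrow> eexp_mult \<alpha> y) G"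
      by (rule at_right_endpoint[OF \<sigma>1])
    have lim: "(abs_dirichlet_sum N a l \<longlongrightarrow> L) G"
      using L(1) unfolding G(2) by (simp add: filterlim_filtermap)
    from G(1) sm \<sigma>1 G(3) G(4)[rule_format] lim L(2) show ?thesis by (rule polygon_near_endpoint)
  next
    fix L assume L: "((abs_dirichlet_sum N a l \<circ> real_of_ereal) \<longlongrightarrow> L) (at_left \<beta>)"
      "L > 2 * dirichlet_term_sup N a l \<beta>"
    obtain G :: "real filter" where G: "G \<noteq> bot" "at_left \<beta> = filtermap ereal G"
      "\<forall>\<^sub>F \<sigma> in G. \<sigma> \<in> einterval \<alpha> \<beta> \<and> (\<forall>y. ennreal (exp (\<sigma> * y)) \<le> max (eexp_mult \<beta> y) (ennreal (exp (\<sigma>1 * y))))"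
      "\<forall>y. ((\<lambda>\<sigma>. ennreal (exp (\<sigma> * y))) \<longlongrightarrow> eexp_mult \<beta> y) G"
      by (rule at_left_endpoint[OF \<sigma>1])
    have lim: "(abs_dirichlet_sum N a l \<longlongrightarrow> L) G"
      using L(1) unfolding G(2) by (simp add: filterlim_filtermap)
    from G(1) sm \<sigma>1 G(3) G(4)[rule_format] lim L(2) show ?thesis by (rule polygon_near_endpoint)
  qed
  then obtain \<sigma> where \<sigma>: "\<sigma> \<in> einterval \<alpha> \<beta>" "\<And>i. i \<in> dirichlet_index N \<Longrightarrow>
    2 * (norm (a i) * exp (\<sigma> * l i)) \<le> (\<Sum>\<^sub>\<infinity>i\<in>dirichlet_index N. norm (a i) * exp (\<sigma> * l i))" by blast
  obtain s where s: "s \<in> vstrip \<alpha> \<beta>" "f s = 0"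
    using exists_zero_if_polygon[OF assms(1-4) \<sigma>(1) ne \<sigma>(2)] by blast
  \<comment> \<open>One zero in the open strip is enough: its real part belongs both to the closure
    and to the open interval.\<close>
  have "Re s \<in> closure {Re s |s. f s = 0 \<and> s \<in> vstrip \<alpha> \<beta>}"
    by (rule subsetD[OF closure_subset]) (use s in blast)
  then have "Re s \<in> zero_re_set f \<alpha> \<beta>" using s(1) by (simp add: zero_re_set_def vstrip_def)
  then show ?thesis by blast
qed

end
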